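(* Let $P(D)=\partial_1^2-\partial_2^2$ be the wave operator in one spatial variable. Moreover, let $F_1\subset F_2$, $F_1\ne F_2$, be closed subsets of $\mathbb{R}^2$ such that for every characteristic hyperplane $H$ for $P(D)$ the set $(\mathbb{R}^2\setminus F_1)\cap H$ does not have a bounded connected component which is contained in $F_2$. Then $(F_1,F_2)$ is a $P$-Runge pair (for smooth Whitney jets).
   Context: Smooth Whitney jets. For a compact set $K\subset\mathbb{R}^d$ (here $d=2$), $\mathscr{E}(K)$ is the space of families $f=(f^{(\alpha)})_{\alpha\in\mathbb{N}_0^d}$ of continuous complex-valued functions on $K$ such that, with $T^n_xf(y)=\sum_{|\alpha|\le n}\frac{f^{(\alpha)}(x)}{\alpha!}(y-x)^\alpha$ and $$q_{K,n,t}(f)=\sup\Big\{\tfrac{|f^{(\alpha)}(y)-\partial^\alpha T^n_xf(y)|}{|x-y|^{n-|\alpha|}}: |\alpha|\le n,\ x,y\in K,\ 0<|x-y|<t\Big\},$$ one has $\lim_{t\to0}q_{K,n,t}(f)=0$ for all $n\in\mathbb{N}_0$. It is a Fréchet space with the seminorms $\|f\|_{n,K}=\sup\{|f^{(\alpha)}(x)|:x\in K,|\alpha|\le n\}+\sup_{t>0}q_{K,n,t}(f)$. For a closed set $F\subset\mathbb{R}^d$, $\mathscr{E}(F)$ is the projective limit of the spaces $\mathscr{E}(K_l)$ along a compact exhaustion $(K_l)_l$ of $F$, i.e. the space of families $(f^{(\alpha)})_\alpha$ of continuous functions on $F$ whose restriction to every compact $K\subset F$ lies in $\mathscr{E}(K)$,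 with the topology given by the seminorms $f\mapsto\|f|_K\|_{n,K}$. Operators. $\partial_j$ acts on jets by $\partial_jf=(f^{(\alpha+e_j)})_\alpha$; $P(D)$ acts on $\mathscr{E}(F)$ accordingly, with $D_j=-i\partial_j$ (so here $P(\xi)=\xi_2^2-\xi_1^2$). Put $\mathscr{E}_P(F)=\{f\in\mathscr{E}(F):P(D)f=0\}$. $P$-Runge pair. For closed $F_1\subset F_2$, $(F_1,F_2)$ is a $P$-Runge pair if the image of $\mathscr{E}_P(F_2)$ under the restriction map $f\mapsto(f^{(\alpha)}|_{F_1})_\alpha$ is dense in $\mathscr{E}_P(F_1)$ (with the topology of $\mathscr{E}(F_1)$). Characteristic hyperplanes. A hyperplane $H=\{x\in\mathbb{R}^d:\sum_jx_jN_j=c\}$ ($N\in\mathbb{R}^d\setminus\{0\}$, $c\in\mathbb{R}$) is characteristic for $P(D)$ if $P_m(N)=0$, where $P_m$ is the principal part (homogeneous part of top degree $m$) of $P$. For the wave operator here these are the lines with normal vector $N$ satisfying $N_1^2=N_2^2$. *)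

theory Defs
  imports "HOL-Analysis.Analysis" "HOL-Library.Poly_Mapping"
begin

section \<open>Multi-indices and partial derivatives on the plane\<close>

type_synonym multiindex = "nat ^ 2"

definition mi_abs :: "multiindex \<Rightarrow> nat" where
  "mi_abs \<alpha> = (\<Sum>j\<in>UNIV. \<alpha> $ j)"

definition mi_fact :: "multiindex \<Rightarrow> real" where
  "mi_fact \<alpha> = (\<Prod>j\<in>UNIV. fact (\<alpha> $ j))"

definition mi_power :: "real ^ 2 \<Rightarrow> multiindex \<Rightarrow> real" where
  "mi_power x \<alpha> = (\<Prod>j\<in>UNIV. (x $ j) ^ (\<alpha> $ j))"

definition partial_deriv :: "2 \<Rightarrow> (real ^ 2 \<Rightarrow> complex) \<Rightarrow> real ^ 2 \<Rightarrow> complex" where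
  "partial_deriv j g x = vector_derivative (\<lambda>t. g (x + t *\<^sub>R axis j 1)) (at 0)"

text \<open>Only applied to polynomials, for which the order of differentiation is immaterial.\<close>

definition mi_deriv :: "multiindex \<Rightarrow> (real ^ 2 \<Rightarrow> complex) \<Rightarrow> real ^ 2 \<Rightarrow> complex" where
  "mi_deriv \<alpha> g = (partial_deriv 1 ^^ (\<alpha> $ 1)) ((partial_deriv 2 ^^ (\<alpha> $ 2)) g)"


section \<open>Smooth Whitney jets\<close>

type_synonym jet = "multiindex \<Rightarrow> real ^ 2 \<Rightarrow> complex"

definition taylor :: "nat \<Rightarrow> jet \<Rightarrow> real ^ 2 \<Rightarrow> real ^ 2 \<Rightarrow> complex" where
  "taylor n f x y =
     (\<Sum>\<alpha> | mi_abs \<alpha> \<le> n. f \<alpha> x / of_real (mi_fact \<alpha>) * of_real (mi_power (y - x) \<alpha>))"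

text \<open>
  The quantities below take values in the extended nonnegative reals, where every supremum
  exists and the supremum of the empty set is 0.
\<close>

definition whitney_q :: "(real ^ 2) set \<Rightarrow> nat \<Rightarrow> real \<Rightarrow> jet \<Rightarrow> ennreal" where
  "whitney_q K n t f =
     Sup {ennreal (cmod (f \<alpha> y - mi_deriv \<alpha> (taylor n f x) y) / norm (x - y) ^ (n - mi_abs \<alpha>)) |
          \<alpha> x y. mi_abs \<alpha> \<le> n \<and> x \<in> K \<and> y \<in> K \<and> 0 < norm (x - y) \<and> norm (x - y) < t}"

definition whitney_norm :: "nat \<Rightarrow> (real ^ 2) set \<Rightarrow> jet \<Rightarrow> ennreal" where
  "whitney_norm n K f =
     Sup {ennreal (cmod (f \<alpha> x)) | \<alpha> x. x \<in> K \<and> mi_abs \<alpha> \<le> n} +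
     (SUP t\<in>{0<..}. whitney_q K n t f)"

definition is_whitney_jet_on :: "(real ^ 2) set \<Rightarrow> jet \<Rightarrow> bool" where
  "is_whitney_jet_on K f \<longleftrightarrow>
     (\<forall>\<alpha>. continuous_on K (f \<alpha>)) \<and>
     (\<forall>n. ((\<lambda>t. whitney_q K n t f) \<longlongrightarrow> 0) (at_right 0))"

text \<open>
  A family of functions on \<open>F\<close> is represented by the family of total functions that vanish
  off \<open>F\<close>, so that equality of jets on \<open>F\<close> is equality of their representatives.
\<close>

definition whitney_space :: "(real ^ 2) set \<Rightarrow> jet set" where
  "whitney_space F =
     {f. (\<forall>\<alpha>. continuous_on F (f \<alpha>)) \<and>
         (\<forall>K. compact K \<longrightarrow> K \<subseteq> F \<longrightarrow> is_whitney_jet_on K f) \<and>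
         (\<forall>\<alpha> x. x \<notin> F \<longrightarrow> f \<alpha> x = 0)}"

definition jet_restrict :: "(real ^ 2) set \<Rightarrow> jet \<Rightarrow> jet" where
  "jet_restrict F f = (\<lambda>\<alpha> x. if x \<in> F then f \<alpha> x else 0)"

definition whitney_ball :: "(real ^ 2) set \<Rightarrow> nat \<Rightarrow> (real ^ 2) set \<Rightarrow> jet \<Rightarrow> real \<Rightarrow> jet set" where
  "whitney_ball F n K g \<epsilon> =
     {f \<in> whitney_space F. whitney_norm n K (\<lambda>\<alpha> x. f \<alpha> x - g \<alpha> x) < ennreal \<epsilon>}"

text \<open>The topology defined by the seminorms \<open>whitney_norm n K\<close>, \<open>K\<close> a compact subset of \<open>F\<close>.\<close>

definition whitney_topology :: "(real ^ 2) set \<Rightarrow> jet topology" where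
  "whitney_topology F =
     topology_generated_by
       {whitney_ball F n K g \<epsilon> | n K g \<epsilon>.
          compact K \<and> K \<subseteq> F \<and> g \<in> whitney_space F \<and> \<epsilon> > 0}"


section \<open>Differential operators with constant coefficients\<close>

text \<open>A polynomial in two variables is its finitely supported family of coefficients.\<close>

type_synonym poly2 = "multiindex \<Rightarrow>\<^sub>0 complex"

definition pvar :: "2 \<Rightarrow> poly2" where
  "pvar j = Poly_Mapping.single (axis j 1) 1"

definition jet_partial :: "2 \<Rightarrow> jet \<Rightarrow> jet" where
  "jet_partial j f = (\<lambda>\<alpha>. f (\<alpha> + axis j 1))"

definition jet_D :: "2 \<Rightarrow> jet \<Rightarrow> jet" where
  "jet_D j f = (\<lambda>\<alpha> x. - \<i> * jet_partial j f \<alpha> x)"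

definition poly_D :: "poly2 \<Rightarrow> jet \<Rightarrow> jet" where
  "poly_D P f = (\<lambda>\<alpha> x. \<Sum>\<beta>\<in>Poly_Mapping.keys P.
     Poly_Mapping.lookup P \<beta> * (jet_D 1 ^^ (\<beta> $ 1)) ((jet_D 2 ^^ (\<beta> $ 2)) f) \<alpha> x)"

definition kernel_space :: "poly2 \<Rightarrow> (real ^ 2) set \<Rightarrow> jet set" where
  "kernel_space P F = {f \<in> whitney_space F. poly_D P f = (\<lambda>\<alpha> x. 0)}"

definition runge_pair :: "poly2 \<Rightarrow> (real ^ 2) set \<Rightarrow> (real ^ 2) set \<Rightarrow> bool" where
  "runge_pair P F1 F2 \<longleftrightarrow>
     subtopology (whitney_topology F1) (kernel_space P F1)
       closure_of (jet_restrict F1 ` kernel_space P F2) = kernel_space P F1"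

definition poly2_degree :: "poly2 \<Rightarrow> nat" where
  "poly2_degree P = Max (insert 0 (mi_abs ` Poly_Mapping.keys P))"

definition principal_part :: "poly2 \<Rightarrow> real ^ 2 \<Rightarrow> complex" where
  "principal_part P N =
     (\<Sum>\<alpha> | \<alpha> \<in> Poly_Mapping.keys P \<and> mi_abs \<alpha> = poly2_degree P.
        Poly_Mapping.lookup P \<alpha> * of_real (mi_power N \<alpha>))"

definition characteristic_hyperplane :: "poly2 \<Rightarrow> (real ^ 2) set \<Rightarrow> bool" where
  "characteristic_hyperplane P H \<longleftrightarrow>
     (\<exists>N c. N \<noteq> 0 \<and> H = {x. (\<Sum>j\<in>UNIV. x $ j * N $ j) = c} \<and> principal_part P N = 0)"


section \<open>The wave operator\<close>

text \<open>
  Since \<open>D\<^sub>j = - \<i> \<partial>\<^sub>j\<close>, the symbol of \<open>\<partial>\<^sub>1\<^sup>2 - \<partial>\<^sub>2\<^sup>2\<close> is \<open>\<xi>\<^sub>2\<^sup>2 - \<xi>\<^sub>1\<^sup>2\<close>.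
\<close>

definition wave_symbol :: poly2 where
  "wave_symbol = pvar 2 ^ 2 - pvar 1 ^ 2"

lemma axis_1_neq: "axis 1 2 \<noteq> (axis 2 2 :: multiindex)"
  by (auto simp: axis_eq_axis)

lemma wave_symbol_single:
  "wave_symbol = Poly_Mapping.single (axis 2 2) 1 - Poly_Mapping.single (axis 1 2) 1"
proof -
  have "axis j 1 + axis j 1 = (axis j 2 :: multiindex)" for j :: 2
    by (auto simp: axis_def vec_eq_iff)
  thus ?thesis
    by (simp add: wave_symbol_def pvar_def power2_eq_square mult_single)
qed

lemma keys_wave_symbol: "Poly_Mapping.keys wave_symbol = {axis 1 2, axis 2 2}"
  using axis_1_neq
  by (auto simp: wave_symbol_single in_keys_iff lookup_minus lookup_single when_def split: if_splits)

lemma lookup_wave_symbol: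
  "Poly_Mapping.lookup wave_symbol (axis 1 2) = -1"
  "Poly_Mapping.lookup wave_symbol (axis 2 2) = 1"
  using axis_1_neq
  by (auto simp: wave_symbol_single lookup_minus lookup_single when_def)

lemma poly_D_wave_symbol:
  "poly_D wave_symbol f =
     (\<lambda>\<alpha> x. jet_partial 1 (jet_partial 1 f) \<alpha> x - jet_partial 2 (jet_partial 2 f) \<alpha> x)"
proof -
  have "(jet_D j ^^ 2) f \<alpha> x = - jet_partial j (jet_partial j f) \<alpha> x" for j \<alpha> x
    by (simp add: numeral_2_eq_2 jet_D_def jet_partial_def)
  moreover have "axis 1 2 $ (1::2) = (2::nat)" "axis 1 2 $ (2::2) = (0::nat)"
    "axis 2 2 $ (1::2) = (0::nat)" "axis 2 2 $ (2::2) = (2::nat)"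
    by (simp_all add: axis_def)
  ultimately show ?thesis
    by (simp add: poly_D_def keys_wave_symbol lookup_wave_symbol axis_1_neq fun_eq_iff)
qed

lemma principal_part_wave_symbol:
  "principal_part wave_symbol N = of_real ((N $ 2)\<^sup>2 - (N $ 1)\<^sup>2)"
proof -
  have a: "mi_abs (axis j 2) = 2" for j
    by (simp add: mi_abs_def axis_def)
  have p: "mi_power N (axis j 2) = (N $ j)\<^sup>2" for j
    using exhaust_2[of j] by (auto simp: mi_power_def axis_def UNIV_2)
  have "{\<alpha>. \<alpha> \<in> Poly_Mapping.keys wave_symbol \<and> mi_abs \<alpha> = poly2_degree wave_symbol}
      = {axis 1 2, axis 2 2}"
    by (auto simp: poly2_degree_def keys_wave_symbol a)
  thus ?thesis
    by (simp add: principal_part_def lookup_wave_symbol axis_1_neq p)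
qed

end

theory Submission
  imports Defs "HOL-Computational_Algebra.Polynomial"
begin

text \<open>
  In characteristic coordinates the operator is \<open>\<partial>\<^sub>s \<partial>\<^sub>t\<close>. Let \<open>f\<close> be a jet on \<open>F1\<close> in its kernel and let
  \<open>K \<subseteq> F1\<close> be compact. Gluing Taylor polynomials of \<open>f\<close> at a small scale gives a smooth \<open>G\<close> that is close
  to \<open>f\<close> on \<open>K\<close> and satisfies \<open>\<partial>\<^sub>s \<partial>\<^sub>t G = k + r\<close>, where \<open>k\<close> vanishes near \<open>K\<close> and \<open>r\<close> is small. The error \<open>r\<close>
  is removed by a small double primitive. To remove \<open>k\<close> on \<open>F2\<close> without changing \<open>G\<close> on \<open>K\<close>, integrate
  it first in \<open>t\<close> and then in \<open>s\<close>, on every characteristic line starting from both ends of each gap of \<open>K\<close>.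
  The two primitives disagree, but by hypothesis every bounded gap contains a point outside \<open>F2\<close>, and the
  transition from one to the other is made near that point. This direct construction
  replaces the usual duality argument and needs no extension theorem for \<open>f\<close>.
\<close>

section \<open>Smooth functions as families of derivatives\<close>

text \<open>The hypothesis concerns gaps of \<open>F1\<close>, but a compact subset may have gaps
  that \<open>F1\<close> fills. Approximation is therefore done on \<open>F1\<close> cut with a
  square in characteristic coordinates: a characteristic line meets the square in an interval, so
  gaps of the intersection are gaps of \<open>F1\<close>. The equation has to hold exactly on all of
  \<open>F2\<close>, closeness only on a compact set. Hence the splitting of the error: one part is
  small with no condition on its support, the other may be large but vanishes on a whole
  neighbourhood of the compact set. Its primitive along a line is then locally constant near that
  set, and only the mismatch between different constants has to be repaired. Taylor polynomials can
  be glued because the wave operator is homogeneous: truncating a formal solution leaves an exact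
  solution. Gluing loses powers of the mesh, but the Whitney condition holds at every order, so a
  high Taylor order pays for the loss.\<close>

text \<open>
  A smooth function on the plane is carried along with all its derivatives: \<open>J a b\<close> plays the role
  of \<open>\<partial>\<^sub>1\<^sup>a \<partial>\<^sub>2\<^sup>b J\<close>. The equality of mixed derivatives is thus built into the data and never
  has to be proved.
\<close>

type_synonym planar_jet = "nat \<Rightarrow> nat \<Rightarrow> real \<times> real \<Rightarrow> complex"

definition smooth_jet :: "planar_jet \<Rightarrow> bool" where
  "smooth_jet J \<longleftrightarrow> (\<forall>a b p. (J a b has_derivative
      (\<lambda>h. fst h *\<^sub>R J (Suc a) b p + snd h *\<^sub>R J a (Suc b) p)) (at p))"

definition flat_at :: "planar_jet \<Rightarrow> real \<times> real \<Rightarrow> bool" where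
  "flat_at J p \<longleftrightarrow> (\<forall>a b. J a b p = 0)"

definition d1 :: "planar_jet \<Rightarrow> planar_jet" where "d1 J = (\<lambda>a. J (Suc a))"
definition d2 :: "planar_jet \<Rightarrow> planar_jet" where "d2 J = (\<lambda>a b. J a (Suc b))"

definition jadd :: "planar_jet \<Rightarrow> planar_jet \<Rightarrow> planar_jet" where "jadd J K = (\<lambda>a b p. J a b p + K a b p)"
definition jsub :: "planar_jet \<Rightarrow> planar_jet \<Rightarrow> planar_jet" where "jsub J K = (\<lambda>a b p. J a b p - K a b p)"

text \<open>
  The Leibniz rule as a recursion; no binomial sums are needed.
\<close>

fun jmul :: "planar_jet \<Rightarrow> planar_jet \<Rightarrow> planar_jet" where
  "jmul J K 0 0 = (\<lambda>p. J 0 0 p * K 0 0 p)"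
| "jmul J K 0 (Suc b) = (\<lambda>p. jmul (d2 J) K 0 b p + jmul J (d2 K) 0 b p)"
| "jmul J K (Suc a) b = (\<lambda>p. jmul (d1 J) K a b p + jmul J (d1 K) a b p)"

definition jprod :: "(nat \<Rightarrow> real \<Rightarrow> real) \<Rightarrow> (nat \<Rightarrow> real \<Rightarrow> real) \<Rightarrow> planar_jet" where
  "jprod \<phi> \<psi> = (\<lambda>a b p. of_real (\<phi> a (fst p) * \<psi> b (snd p)))"

definition smooth1 :: "(nat \<Rightarrow> real \<Rightarrow> real) \<Rightarrow> bool" where
  "smooth1 \<phi> \<longleftrightarrow> (\<forall>n x. (\<phi> n has_real_derivative \<phi> (Suc n) x) (at x))"

definition unit1 :: "nat \<Rightarrow> real \<Rightarrow> real" where "unit1 n x = (if n = 0 then 1 else 0)"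

lemma smooth1_unit1: "smooth1 unit1"
  unfolding smooth1_def by (auto simp: unit1_def[abs_def])

lemma smooth_jetD: "smooth_jet J \<Longrightarrow> (J a b has_derivative
      (\<lambda>h. fst h *\<^sub>R J (Suc a) b p + snd h *\<^sub>R J a (Suc b) p)) (at p)"
  unfolding smooth_jet_def by blast

lemma smooth_jet_continuous: "smooth_jet J \<Longrightarrow> continuous_on S (J a b)"
  using has_derivative_continuous[OF smooth_jetD] by (intro continuous_at_imp_continuous_on) blast

lemma smooth_jet_d1: "smooth_jet J \<Longrightarrow> smooth_jet (d1 J)"
  and smooth_jet_d2: "smooth_jet J \<Longrightarrow> smooth_jet (d2 J)"
  by (auto simp: smooth_jet_def d1_def d2_def)

lemma smooth_jet_0: "smooth_jet (\<lambda>a b p. 0)"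
  by (auto simp: smooth_jet_def)

lemma smooth_jet_jadd: "smooth_jet J \<Longrightarrow> smooth_jet K \<Longrightarrow> smooth_jet (jadd J K)"
  unfolding jadd_def
  by (subst smooth_jet_def, intro allI, rule has_derivative_eq_rhs[OF has_derivative_add[OF smooth_jetD smooth_jetD]])
     (auto simp: algebra_simps)

lemma smooth_jet_jsub: "smooth_jet J \<Longrightarrow> smooth_jet K \<Longrightarrow> smooth_jet (jsub J K)"
  unfolding jsub_def
  by (subst smooth_jet_def, intro allI, rule has_derivative_eq_rhs[OF has_derivative_diff[OF smooth_jetD smooth_jetD]])
     (auto simp: algebra_simps)

lemma smooth_jet_sum:
  assumes "\<And>i. i \<in> I \<Longrightarrow> smooth_jet (J i)"
  shows "smooth_jet (\<lambda>a b p. \<Sum>i\<in>I. J i a b p)"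
  unfolding smooth_jet_def
proof (intro allI)
  fix a b p
  have "((\<lambda>p. \<Sum>i\<in>I. J i a b p) has_derivative
     (\<lambda>h. \<Sum>i\<in>I. fst h *\<^sub>R J i (Suc a) b p + snd h *\<^sub>R J i a (Suc b) p)) (at p)"
    by (intro has_derivative_sum smooth_jetD assms)
  then show "((\<lambda>p. \<Sum>i\<in>I. J i a b p) has_derivative
     (\<lambda>h. fst h *\<^sub>R (\<Sum>i\<in>I. J i (Suc a) b p) + snd h *\<^sub>R (\<Sum>i\<in>I. J i a (Suc b) p))) (at p)"
    by (simp add: sum.distrib scaleR_sum_right)
qed

lemma smooth_jet_jprod:
  assumes "smooth1 \<phi>" "smooth1 \<psi>" shows "smooth_jet (jprod \<phi> \<psi>)"
  unfolding smooth_jet_def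
proof (intro allI)
  fix a b and p :: "real \<times> real"
  have 1: "((\<lambda>p. \<phi> a (fst p)) has_derivative (\<lambda>h. \<phi> (Suc a) (fst p) * fst h)) (at p)"
    using has_derivative_compose[OF has_derivative_fst[OF has_derivative_ident], of "\<phi> a" "\<lambda>h. \<phi> (Suc a) (fst p) * h" p UNIV] assms(1)
    by (simp add: smooth1_def has_field_derivative_def)
  have 2: "((\<lambda>p. \<psi> b (snd p)) has_derivative (\<lambda>h. \<psi> (Suc b) (snd p) * snd h)) (at p)"
    using has_derivative_compose[OF has_derivative_snd[OF has_derivative_ident], of "\<psi> b" "\<lambda>h. \<psi> (Suc b) (snd p) * h" p UNIV] assms(2)
    by (simp add: smooth1_def has_field_derivative_def)
  show "(jprod \<phi> \<psi> a b has_derivative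
      (\<lambda>h. fst h *\<^sub>R jprod \<phi> \<psi> (Suc a) b p + snd h *\<^sub>R jprod \<phi> \<psi> a (Suc b) p)) (at p)"
    unfolding jprod_def
    by (rule has_derivative_eq_rhs[OF has_derivative_of_real[OF has_derivative_mult[OF 1 2]]])
       (auto simp: scaleR_conv_of_real algebra_simps)
qed

lemma d1_d2: "d1 (d2 J) = d2 (d1 J)"
  by (simp add: d1_def d2_def)

text \<open>The recursion differentiates in the second variable only once the first order is
  \<open>0\<close>. As \<open>d1\<close> and \<open>d2\<close> commute, the product rule in the
  second variable holds at every order.\<close>

lemma jmul_Suc2: "jmul J K a (Suc b) p = jmul (d2 J) K a b p + jmul J (d2 K) a b p"
  by (induction a arbitrary: J K) (simp_all add: d1_d2 algebra_simps)

lemma d2_jmul: "d2 (jmul J K) = jadd (jmul (d2 J) K) (jmul J (d2 K))"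
  by (intro ext) (simp add: jmul_Suc2 jadd_def, simp add: d2_def jmul_Suc2)

lemma smooth_jet_jmul:
  assumes "smooth_jet J" "smooth_jet K" shows "smooth_jet (jmul J K)"
proof -
  have "(jmul J K a b has_derivative
      (\<lambda>h. fst h *\<^sub>R jmul J K (Suc a) b p + snd h *\<^sub>R jmul J K a (Suc b) p)) (at p)" for a b p
    using assms
  proof (induction J K a b rule: jmul.induct)
    case (1 J K)
    have e: "jmul J K 0 0 = (\<lambda>p. J 0 0 p * K 0 0 p)" by simp
    show ?case unfolding e
      by (rule has_derivative_eq_rhs[OF has_derivative_mult[OF smooth_jetD[OF 1(1)] smooth_jetD[OF 1(2)]]])
         (auto simp: d1_def d2_def algebra_simps)
  next
    case (2 J K b)
    have e: "jmul J K 0 (Suc b) = (\<lambda>p. jmul (d2 J) K 0 b p + jmul J (d2 K) 0 b p)" by simp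
    show ?case unfolding e
      by (rule has_derivative_eq_rhs[OF has_derivative_add[OF 2(1)[OF smooth_jet_d2[OF 2(3)] 2(4)]
            2(2)[OF 2(3) smooth_jet_d2[OF 2(4)]]]])
         (auto simp: d1_d2 algebra_simps)
  next
    case (3 J K a b)
    have e: "jmul J K (Suc a) b = (\<lambda>p. jmul (d1 J) K a b p + jmul J (d1 K) a b p)" by simp
    show ?case unfolding e
      by (rule has_derivative_eq_rhs[OF has_derivative_add[OF 3(1)[OF smooth_jet_d1[OF 3(3)] 3(4)]
            3(2)[OF 3(3) smooth_jet_d1[OF 3(4)]]]])
         (auto simp: jmul_Suc2 algebra_simps)
  qed
  then show ?thesis by (simp add: smooth_jet_def)
qed

lemma jmul_flat1: "flat_at J p \<Longrightarrow> jmul J K a b p = 0"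
  by (induction J K a b rule: jmul.induct) (auto simp: flat_at_def d1_def d2_def)

lemma jmul_flat2: "flat_at K p \<Longrightarrow> jmul J K a b p = 0"
  by (induction J K a b rule: jmul.induct) (auto simp: flat_at_def d1_def d2_def)

lemma jmul_sum1: "jmul (\<lambda>a b p. \<Sum>i\<in>I. J i a b p) K a b p = (\<Sum>i\<in>I. jmul (J i) K a b p)"
proof (induction a arbitrary: J K)
  case 0
  show ?case
    by (induction b arbitrary: J K) (simp_all add: sum_distrib_right d2_def sum.distrib)
next
  case (Suc a)
  then show ?case by (simp add: d1_def sum.distrib)
qed

lemma jmul_jsub1: "jmul (jsub J J') K a b p = jmul J K a b p - jmul J' K a b p"
proof (induction a arbitrary: J J' K)
  case 0
  show ?case
  proof (induction b arbitrary: J J' K)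
    case (Suc b)
    have "d2 (jsub J J') = jsub (d2 J) (d2 J')" by (simp add: d2_def jsub_def)
    with Suc show ?case by simp
  qed (simp add: jsub_def algebra_simps)
next
  case (Suc a)
  have "d1 (jsub J J') = jsub (d1 J) (d1 J')" by (simp add: d1_def jsub_def)
  with Suc show ?case by simp
qed

lemma jmul_jsub2: "jmul J (jsub K K') a b p = jmul J K a b p - jmul J K' a b p"
proof (induction a arbitrary: J K K')
  case 0
  show ?case
  proof (induction b arbitrary: J K K')
    case (Suc b)
    have "d2 (jsub K K') = jsub (d2 K) (d2 K')" by (simp add: d2_def jsub_def)
    with Suc show ?case by simp
  qed (simp add: jsub_def algebra_simps)
next
  case (Suc a)
  have "d1 (jsub K K') = jsub (d1 K) (d1 K')" by (simp add: d1_def jsub_def)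
  with Suc show ?case by simp
qed

text \<open>\<open>jmul\<close> is additive in its first factor and vanishes where that factor is
  flat, so only the jet of \<open>J\<close> at \<open>p\<close> counts and \<open>J\<close> may be
  replaced by the constant 1. Applied wherever a cut-off equals 1.\<close>

lemma jmul_one: 
  assumes "\<And>a b. J a b p = (if a = 0 \<and> b = 0 then 1 else 0)"
  shows "jmul J K a b p = K a b p"
proof -
  have j: "jmul J K a b p = jmul (\<lambda>a b q. if a = 0 \<and> b = 0 then 1 else 0) K a b p" (is "_ = jmul ?I _ _ _ _")
  proof -
    have "flat_at (jsub J ?I) p" using assms by (simp add: flat_at_def jsub_def)
    from jmul_flat1[OF this, of K a b] show ?thesis by (simp add: jmul_jsub1)
  qed
  have f: "flat_at (d1 ?I) p" "flat_at (d2 ?I) p" for p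
    by (auto simp: flat_at_def d1_def d2_def)
  have "jmul ?I K 0 b p = K 0 b p" for K b
    by (induction b arbitrary: K) (auto simp: jmul_flat1[OF f(2)], auto simp: d2_def)
  then have "jmul ?I K a b p = K a b p"
    by (induction a arbitrary: K) (auto simp: jmul_flat1[OF f(1)], auto simp: d1_def)
  then show ?thesis by (simp add: j)
qed

text \<open>Unfolding the recursion gives \<open>2 ^ (a + b)\<close> products of one derivative of
  \<open>J\<close> with one of \<open>K\<close>.\<close>

lemma norm_jmul_le:
  assumes "\<And>i j. i \<le> a \<Longrightarrow> j \<le> b \<Longrightarrow> cmod (J i j p) \<le> B"
    and "\<And>i j. i \<le> a \<Longrightarrow> j \<le> b \<Longrightarrow> cmod (K i j p) \<le> C"
  shows "cmod (jmul J K a b p) \<le> 2 ^ (a + b) * (B * C)"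
  using assms
proof (induction J K a b rule: jmul.induct)
  case (1 J K)
  then show ?case by (simp add: norm_mult mult_mono')
next
  case (2 J K b)
  have "cmod (jmul (d2 J) K 0 b p) \<le> 2 ^ (0 + b) * (B * C)"
    by (rule 2(1)) (auto simp: d2_def 2)
  moreover have "cmod (jmul J (d2 K) 0 b p) \<le> 2 ^ (0 + b) * (B * C)"
    by (rule 2(2)) (auto simp: d2_def 2)
  ultimately show ?case by (simp add: norm_triangle_le)
next
  case (3 J K a b)
  have "cmod (jmul (d1 J) K a b p) \<le> 2 ^ (a + b) * (B * C)"
    by (rule 3(1)) (auto simp: d1_def 3)
  moreover have "cmod (jmul J (d1 K) a b p) \<le> 2 ^ (a + b) * (B * C)"
    by (rule 3(2)) (auto simp: d1_def 3)
  ultimately show ?case by (simp add: norm_triangle_le)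
qed

text \<open>By this exchange of variables, constructions along the second variable are reused along
  the first.\<close>

definition jswap :: "planar_jet \<Rightarrow> planar_jet" where
  "jswap J = (\<lambda>a b p. J b a (snd p, fst p))"

lemma smooth_jet_jswap: 
  assumes "smooth_jet J" shows "smooth_jet (jswap J)"
  unfolding smooth_jet_def jswap_def
proof (intro allI)
  fix a b and p :: "real \<times> real"
  have s: "((\<lambda>p::real\<times>real. (snd p, fst p)) has_derivative (\<lambda>h. (snd h, fst h))) (at p)"
    by (auto intro!: derivative_eq_intros)
  show "((\<lambda>p. J b a (snd p, fst p)) has_derivative
     (\<lambda>h. fst h *\<^sub>R J b (Suc a) (snd p, fst p) + snd h *\<^sub>R J (Suc b) a (snd p, fst p))) (at p)"
    using has_derivative_compose[OF s smooth_jetD[OF assms]]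
    by (simp add: add.commute)
qed

section \<open>Smooth step functions and primitives\<close>

text \<open>
  \<open>exp_inv n\<close> is the \<open>n\<close>-th derivative of the function that is \<open>exp (- 1 / x)\<close> for \<open>x > 0\<close> and \<open>0\<close> elsewhere.
\<close>

fun exp_poly :: "nat \<Rightarrow> real poly" where
  "exp_poly 0 = 1"
| "exp_poly (Suc n) = [:0, 0, 1:] * (exp_poly n - pderiv (exp_poly n))"

definition exp_inv :: "nat \<Rightarrow> real \<Rightarrow> real" where
  "exp_inv n x = (if x \<le> 0 then 0 else poly (exp_poly n) (1 / x) * exp (- (1 / x)))"

text \<open>The factor \<open>y ^ k\<close> makes the induction over the coefficients go through;
  the case \<open>k = 1\<close> absorbs the division by \<open>h\<close> in the difference quotient
  of \<open>exp_inv n\<close> at \<open>0\<close>.\<close>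

lemma poly_exp_tendsto_0: "((\<lambda>y::real. y ^ k * poly p y * exp (- y)) \<longlongrightarrow> 0) at_top"
proof (induction p arbitrary: k)
  case 0
  then show ?case by simp
next
  case (pCons a p)
  have "((\<lambda>y. a * (y ^ k / exp y) + y ^ Suc k * poly p y * exp (- y)) \<longlongrightarrow> a * 0 + 0) at_top"
    by (intro tendsto_intros pCons.IH tendsto_power_div_exp_0)
  then show ?case by (simp add: algebra_simps exp_minus divide_inverse)
qed

lemma smooth1_exp_inv: "smooth1 exp_inv"
  unfolding smooth1_def
proof (intro allI)
  fix n and x :: real
  consider "x < 0" | "x = 0" | "x > 0" by linarith
  then show "(exp_inv n has_real_derivative exp_inv (Suc n) x) (at x)"
  proof cases
    case 1
    have "((\<lambda>x. 0) has_real_derivative 0) (at x)" by simp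
    then have "(exp_inv n has_real_derivative 0) (at x)"
      by (rule has_field_derivative_transform_within_open[of _ _ _ "{..<0}"])
         (use 1 in \<open>auto simp: exp_inv_def\<close>)
    then show ?thesis using 1 by (simp add: exp_inv_def)
  next
    case 3
    \<comment> \<open>With y = 1/x, the derivative of p(y) exp(-y) in x is y^2 (p(y) - p'(y))
      exp(-y); this is the recursion defining \<open>exp_poly\<close>.\<close>
    have d: "((\<lambda>x. poly (exp_poly n) (1 / x) * exp (- (1 / x))) has_real_derivative exp_inv (Suc n) x) (at x)"
      using 3 by (auto intro!: derivative_eq_intros simp: exp_inv_def field_simps power2_eq_square)
    show ?thesis
      by (rule has_field_derivative_transform_within_open[OF d, of "{0<..}"])
         (use 3 in \<open>auto simp: exp_inv_def\<close>)
  next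
    case 2
    have r: "((\<lambda>h. exp_inv n h / h) \<longlongrightarrow> 0) (at_right 0)"
    proof -
      have "((\<lambda>h::real. inverse h ^ 1 * poly (exp_poly n) (inverse h) * exp (- inverse h)) \<longlongrightarrow> 0) (at_right 0)"
        by (rule filterlim_compose[OF poly_exp_tendsto_0 filterlim_inverse_at_top_right])
      then show ?thesis
        by (rule Lim_transform_eventually)
           (auto simp: eventually_at_right_field exp_inv_def divide_inverse algebra_simps intro!: exI[of _ 1])
    qed
    have l: "((\<lambda>h. exp_inv n h / h) \<longlongrightarrow> 0) (at_left 0)"
      by (rule Lim_transform_eventually[OF tendsto_const])
         (auto simp: eventually_at_left_field exp_inv_def intro!: exI[of _ "-1"])
    have "((\<lambda>h. exp_inv n h / h) \<longlongrightarrow> 0) (at 0)"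
      using l r filterlim_split_at by blast
    then show ?thesis using 2 by (simp add: DERIV_def exp_inv_def)
  qed
qed

fun leibniz1 :: "(nat \<Rightarrow> real \<Rightarrow> real) \<Rightarrow> (nat \<Rightarrow> real \<Rightarrow> real) \<Rightarrow> nat \<Rightarrow> real \<Rightarrow> real" where
  "leibniz1 f g 0 = (\<lambda>x. f 0 x * g 0 x)"
| "leibniz1 f g (Suc n) = (\<lambda>x. leibniz1 (\<lambda>n. f (Suc n)) g n x + leibniz1 f (\<lambda>n. g (Suc n)) n x)"

lemma smooth1_leibniz1:
  assumes "smooth1 f" "smooth1 g" shows "smooth1 (leibniz1 f g)"
proof -
  have "(leibniz1 f g n has_real_derivative leibniz1 f g (Suc n) x) (at x)" for n x
    using assms
  proof (induction f g n rule: leibniz1.induct)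
    case (1 f g)
    have e: "leibniz1 f g 0 = (\<lambda>x. f 0 x * g 0 x)" by simp
    have "(f 0 has_real_derivative f 1 x) (at x)" "(g 0 has_real_derivative g 1 x) (at x)"
      using 1 unfolding smooth1_def by (metis One_nat_def)+
    then show ?case unfolding e
      by (auto intro!: derivative_eq_intros)
  next
    case (2 f g n)
    have s: "smooth1 (\<lambda>n. f (Suc n))" "smooth1 (\<lambda>n. g (Suc n))"
      using 2(3,4) by (auto simp: smooth1_def)
    have e: "leibniz1 f g (Suc n) = (\<lambda>x. leibniz1 (\<lambda>n. f (Suc n)) g n x + leibniz1 f (\<lambda>n. g (Suc n)) n x)" by simp
    show ?case unfolding e
      by (rule DERIV_cong[OF DERIV_add[OF 2(1)[OF s(1) 2(4)] 2(2)[OF 2(3) s(2)]]]) simp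
  qed
  then show ?thesis by (simp add: smooth1_def)
qed

text \<open>The step is the primitive of the bump \<open>exp_inv 0 x * exp_inv 0 (1 - x)\<close>,
  normalised by its integral; the bump and all its derivatives vanish outside the unit
  interval.\<close>

lemma smooth_step_unit:
  obtains \<sigma> where "smooth1 \<sigma>" "\<And>n x. x \<le> 0 \<Longrightarrow> \<sigma> n x = 0" 
    "\<And>x. 1 \<le> x \<Longrightarrow> \<sigma> 0 x = 1" "\<And>n x. 1 \<le> x \<Longrightarrow> \<sigma> (Suc n) x = 0"
proof -
  define rfl where "rfl n x = (- 1) ^ n * exp_inv n (1 - x)" for n x
  define \<psi> where "\<psi> = leibniz1 exp_inv rfl"
  have "smooth1 rfl"
    unfolding smooth1_def
  proof (intro allI)
    fix n x
    have "(exp_inv n has_real_derivative exp_inv (Suc n) (1 - x)) (at (1 - x))"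
      using smooth1_exp_inv by (simp add: smooth1_def)
    then have "((\<lambda>x. exp_inv n (1 - x)) has_real_derivative exp_inv (Suc n) (1 - x) * - 1) (at x)"
      by (rule DERIV_chain2) (auto intro!: derivative_eq_intros)
    then show "(rfl n has_real_derivative rfl (Suc n) x) (at x)"
      unfolding rfl_def by (auto intro!: derivative_eq_intros)
  qed
  then have sm: "smooth1 \<psi>"
    unfolding \<psi>_def by (intro smooth1_leibniz1 smooth1_exp_inv)
  have z1: "leibniz1 f g n x = 0" if "\<And>n. f n x = 0" for f g n x
    using that by (induction f g n rule: leibniz1.induct) auto
  have z2: "leibniz1 f g n x = 0" if "\<And>n. g n x = 0" for f g n x
    using that by (induction f g n rule: leibniz1.induct) auto
  have z: "\<psi> n x = 0" if "x \<le> 0 \<or> 1 \<le> x" for n x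
    using that z1[of exp_inv] z2[of rfl] by (auto simp: \<psi>_def rfl_def exp_inv_def)
  have pos: "\<psi> 0 x \<ge> 0" for x
    by (auto simp: \<psi>_def rfl_def exp_inv_def)
  have pos': "\<psi> 0 (1/2) > 0"
    by (auto simp: \<psi>_def rfl_def exp_inv_def)
  have cont: "continuous_on S (\<psi> 0)" for S
    using sm unfolding smooth1_def by (meson DERIV_continuous_on has_field_derivative_at_within)
  \<comment> \<open>Starting the integral at \<open>- 1\<close>, left of the support of
    \<open>\<psi>\<close>, makes every \<open>x \<ge> 0\<close> an interior point when the integral
    is differentiated.\<close>
  define I where "I = integral {- 1..1} (\<psi> 0)"
  have int: "\<psi> 0 integrable_on {a..b}" for a b
    by (intro integrable_continuous_real cont)
  have "I \<ge> 0" unfolding I_def by (intro integral_nonneg int pos)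
  moreover have "I \<noteq> 0"
    unfolding I_def using integral_eq_0_iff[of "-1" 1 "\<psi> 0"] cont pos pos' by (auto intro!: bexI[of _ "1/2"])
  ultimately have I: "I > 0" by simp
  define \<sigma> where "\<sigma> n x = (case n of 0 \<Rightarrow> integral {- 1..x} (\<psi> 0) / I | Suc n \<Rightarrow> \<psi> n x / I)" for n x
  have s0: "integral {a..x} (\<psi> 0) = 0" if "x \<le> 0 \<or> a \<ge> 1" for x a
    using that integral_cong[of "{a..x}" "\<psi> 0" "\<lambda>_. 0"] z by force
  show thesis
  proof (rule that[of \<sigma>])
    have D0: "(\<sigma> 0 has_real_derivative \<sigma> (Suc 0) x) (at x)" for x
    proof (cases "x < 0")
      case True
      have "((\<lambda>x. 0) has_real_derivative 0) (at x)" by simp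
      then have "(\<sigma> 0 has_real_derivative 0) (at x)"
        by (rule has_field_derivative_transform_within_open[of _ _ _ "{..<0}"])
           (use True s0 in \<open>auto simp: \<sigma>_def\<close>)
      then show ?thesis using True z by (simp add: \<sigma>_def)
    next
      case False
      have "((\<lambda>x. integral {- 1..x} (\<psi> 0)) has_real_derivative \<psi> 0 x) (at x within {-1..x+1})"
        by (rule integral_has_real_derivative[OF cont]) (use False in auto)
      moreover have "at x within {-1..x+1} = at x"
        by (rule at_within_interior) (use False in auto)
      ultimately have "((\<lambda>x. integral {- 1..x} (\<psi> 0)) has_real_derivative \<psi> 0 x) (at x)" by simp
      then show ?thesis unfolding \<sigma>_def using I by (auto intro!: derivative_eq_intros)
    qed
    have "(\<sigma> n has_real_derivative \<sigma> (Suc n) x) (at x)" for n x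
    proof (cases n)
      case (Suc m)
      have "(\<psi> m has_real_derivative \<psi> (Suc m) x) (at x)" using sm by (simp add: smooth1_def)
      then show ?thesis using Suc I unfolding \<sigma>_def by (auto intro!: derivative_eq_intros)
    qed (use D0 in simp)
    then show "smooth1 \<sigma>" by (simp add: smooth1_def)
    show "\<sigma> n x = 0" if "x \<le> 0" for n x
      using that z s0 by (auto simp: \<sigma>_def split: nat.split)
    show "\<sigma> (Suc n) x = 0" if "1 \<le> x" for n x
      using that z by (auto simp: \<sigma>_def)
    show "\<sigma> 0 x = 1" if "1 \<le> x" for x
    proof -
      have "integral {- 1..x} (\<psi> 0) = I + integral {1..x} (\<psi> 0)"
        unfolding I_def using Henstock_Kurzweil_Integration.integral_combine[of "-1" 1 x "\<psi> 0"] that int by simp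
      then show ?thesis using I s0 by (simp add: \<sigma>_def)
    qed
  qed
qed

lemma smooth1_affine:
  assumes "smooth1 \<phi>" shows "smooth1 (\<lambda>n x. c ^ n * \<phi> n (c * x + d))"
  unfolding smooth1_def
proof (intro allI)
  fix n x
  have "(\<phi> n has_real_derivative \<phi> (Suc n) (c * x + d)) (at (c * x + d))"
    using assms by (simp add: smooth1_def)
  then have "((\<lambda>x. \<phi> n (c * x + d)) has_real_derivative \<phi> (Suc n) (c * x + d) * c) (at x)"
    by (rule DERIV_chain2) (auto intro!: derivative_eq_intros)
  then show "((\<lambda>x. c ^ n * \<phi> n (c * x + d)) has_real_derivative c ^ Suc n * \<phi> (Suc n) (c * x + d)) (at x)"
    by (auto intro!: derivative_eq_intros)
qed

lemma smooth_step:
  fixes l u :: real assumes "l < u"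
  obtains \<sigma> where "smooth1 \<sigma>" "\<And>n x. x \<le> l \<Longrightarrow> \<sigma> n x = 0" 
    "\<And>n x. u \<le> x \<Longrightarrow> \<sigma> n x = unit1 n x"
proof -
  obtain \<sigma> where s: "smooth1 \<sigma>" "\<And>n x. x \<le> 0 \<Longrightarrow> \<sigma> n x = 0" 
    "\<And>x. 1 \<le> x \<Longrightarrow> \<sigma> 0 x = 1" "\<And>n x. 1 \<le> x \<Longrightarrow> \<sigma> (Suc n) x = 0"
    using smooth_step_unit by metis
  define c where "c = 1 / (u - l)"
  have e: "c * x + - l * c = (x - l) / (u - l)" for x
    by (simp add: c_def diff_divide_distrib)
  show thesis
  proof (rule that[OF smooth1_affine[OF s(1), of c "- l * c"]], goal_cases)
    case (1 n x)
    then show ?case using assms unfolding e by (intro mult_eq_0_iff[THEN iffD2] disjI2 s(2)) (simp add: divide_nonpos_pos)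
  next
    case (2 n x)
    then have "1 \<le> c * x + - l * c" using assms unfolding e by simp
    then show ?case using s(3,4) by (cases n) (auto simp: unit1_def)
  qed
qed

text \<open>
  The primitive in the second variable that vanishes for \<open>t = 0\<close>: substituting \<open>t v\<close> for the
  variable of integration fixes the interval, so that one may differentiate under the integral
  sign for all signs of \<open>t\<close>.
\<close>

definition prim2 :: "planar_jet \<Rightarrow> planar_jet" where
  "prim2 J = (\<lambda>a b p. case b of 0 \<Rightarrow> integral {0..1} (\<lambda>v. snd p *\<^sub>R J a 0 (fst p, snd p * v)) | Suc b \<Rightarrow> J a b p)"

lemma smooth_jet_partial1:
  assumes "smooth_jet J"
  shows "((\<lambda>s. J a b (s, t)) has_vector_derivative J (Suc a) b (s, t)) (at s within S)"
proof -
  have "((\<lambda>s. (s, t)) has_derivative (\<lambda>h. (h, 0))) (at s)"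
    by (auto intro!: derivative_eq_intros)
  from has_derivative_compose[OF this smooth_jetD[OF assms]] show ?thesis
    by (auto simp: has_vector_derivative_def intro: has_derivative_at_withinI)
qed

lemma smooth_jet_partial2:
  assumes "smooth_jet J"
  shows "((\<lambda>t. J a b (s, t)) has_vector_derivative J a (Suc b) (s, t)) (at t within S)"
proof -
  have "((\<lambda>t. (s, t)) has_derivative (\<lambda>h. (0, h))) (at t)"
    by (auto intro!: derivative_eq_intros)
  from has_derivative_compose[OF this smooth_jetD[OF assms]] show ?thesis
    by (auto simp: has_vector_derivative_def intro: has_derivative_at_withinI)
qed

lemma continuous_on_jet_comp:
  assumes "smooth_jet J" "continuous_on S f"
  shows "continuous_on S (\<lambda>x. J a b (f x))"
  using continuous_on_compose2[OF smooth_jet_continuous[OF assms(1), of UNIV a b] assms(2)] by simp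

text \<open>The derivative of \<open>t *\<^sub>R J a 0 (s, t * v)\<close> in \<open>t\<close> is
  also the derivative of \<open>v *\<^sub>R J a 0 (s, t * v)\<close> in \<open>v\<close>, so it
  integrates to \<open>J a 0 (s, t)\<close>.\<close>

lemma prim2_integral:
  assumes J: "smooth_jet J"
  shows "((\<lambda>t. integral {0..1} (\<lambda>v. t *\<^sub>R J a 0 (s, t * v))) has_vector_derivative J a 0 (s, t)) (at t)"
proof -
  have d: "((\<lambda>t. t *\<^sub>R J a 0 (s, t * v)) has_vector_derivative (J a 0 (s, t * v) + (t * v) *\<^sub>R J a 1 (s, t * v))) (at t)" for t v
  proof -
    have "((\<lambda>t. t * v) has_real_derivative v) (at t)" by (auto intro!: derivative_eq_intros)
    from vector_diff_chain_at[OF this[unfolded has_real_derivative_iff_has_vector_derivative] smooth_jet_partial2[OF J]]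
    have "((\<lambda>t. J a 0 (s, t * v)) has_vector_derivative v *\<^sub>R J a 1 (s, t * v)) (at t)"
      by (simp add: o_def)
    then show ?thesis
      by (auto intro!: derivative_eq_intros simp: algebra_simps)
  qed
  have c: "continuous_on S (\<lambda>v. t *\<^sub>R J a 0 (s, t * v))" for S t
    by (intro continuous_intros continuous_on_jet_comp J)
  have L: "((\<lambda>t. integral (cbox 0 1) (\<lambda>v. t *\<^sub>R J a 0 (s, t * v))) has_vector_derivative 
     integral (cbox 0 1) (\<lambda>v. J a 0 (s, t * v) + (t * v) *\<^sub>R J a 1 (s, t * v))) (at t within UNIV)"
  proof (rule leibniz_rule_vector_derivative)
    show "continuous_on (UNIV \<times> cbox 0 1) (\<lambda>(x, v). J a 0 (s, x * v) + (x * v) *\<^sub>R J a 1 (s, x * v))"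
      unfolding case_prod_beta by (intro continuous_intros continuous_on_jet_comp J)
  qed (use d c in \<open>auto intro!: integrable_continuous_real\<close>)
  have "((\<lambda>v. J a 0 (s, t * v) + (t * v) *\<^sub>R J a 1 (s, t * v)) has_integral 1 *\<^sub>R J a 0 (s, t * 1) - 0 *\<^sub>R J a 0 (s, t * 0)) {0..1}"
  proof (rule fundamental_theorem_of_calculus)
    fix v :: real
    have "((\<lambda>v. t * v) has_real_derivative t) (at v)" by (auto intro!: derivative_eq_intros)
    from vector_diff_chain_at[OF this[unfolded has_real_derivative_iff_has_vector_derivative] smooth_jet_partial2[OF J]]
    have "((\<lambda>v. J a 0 (s, t * v)) has_vector_derivative t *\<^sub>R J a 1 (s, t * v)) (at v)"
      by (simp add: o_def)
    then show "((\<lambda>v. v *\<^sub>R J a 0 (s, t * v)) has_vector_derivative (J a 0 (s, t * v) + (t * v) *\<^sub>R J a 1 (s, t * v))) (at v within {0..1})"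
      using has_vector_derivative_scaleR[OF DERIV_ident, of _ _ v UNIV] has_vector_derivative_at_within
      by (fastforce simp: algebra_simps)
  qed simp
  then have "integral {0..1} (\<lambda>v. J a 0 (s, t * v) + (t * v) *\<^sub>R J a 1 (s, t * v)) = J a 0 (s, t)"
    by (simp add: integral_unique)
  with L show ?thesis by simp
qed

lemma prim2_partial1:
  assumes J: "smooth_jet J"
  shows "((\<lambda>s. integral {0..1} (\<lambda>v. t *\<^sub>R J a 0 (s, t * v))) has_vector_derivative 
     integral {0..1} (\<lambda>v. t *\<^sub>R J (Suc a) 0 (s, t * v))) (at s)"
proof -
  have c: "continuous_on S (\<lambda>v. t *\<^sub>R J a 0 (s, t * v))" for S t s
    by (intro continuous_intros continuous_on_jet_comp J)
  have "((\<lambda>s. integral (cbox 0 1) (\<lambda>v. t *\<^sub>R J a 0 (s, t * v))) has_vector_derivative 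
     integral (cbox 0 1) (\<lambda>v. t *\<^sub>R J (Suc a) 0 (s, t * v))) (at s within UNIV)"
  proof (rule leibniz_rule_vector_derivative)
    show "continuous_on (UNIV \<times> cbox 0 1) (\<lambda>(x, v). t *\<^sub>R J (Suc a) 0 (x, t * v))"
      unfolding case_prod_beta by (intro continuous_intros continuous_on_jet_comp J)
    fix s v show "((\<lambda>s. t *\<^sub>R J a 0 (s, t * v)) has_vector_derivative t *\<^sub>R J (Suc a) 0 (s, t * v)) (at s within UNIV)"
      using smooth_jet_partial1[OF J, of a 0 "t * v" s UNIV] by (auto intro!: derivative_eq_intros)
  qed (use c in \<open>auto intro!: integrable_continuous_real\<close>)
  then show ?thesis by simp
qed

lemma smooth_jet_prim2:
  assumes J: "smooth_jet J" shows "smooth_jet (prim2 J)"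
  unfolding smooth_jet_def
proof (intro allI)
  fix a b p
  show "(prim2 J a b has_derivative (\<lambda>h. fst h *\<^sub>R prim2 J (Suc a) b p + snd h *\<^sub>R prim2 J a (Suc b) p)) (at p)"
  proof (cases b)
    case (Suc b')
    then show ?thesis using smooth_jetD[OF J] by (simp add: prim2_def)
  next
    case 0
    obtain s t where p: "p = (s, t)" by (cases p)
    define g where "g = (\<lambda>s t. integral {0..1} (\<lambda>v. t *\<^sub>R J a 0 (s, t * v)))"
    \<comment> \<open>Both partial derivatives exist, and continuity of one of them gives total
      differentiability: the one in \<open>t\<close> is \<open>J a 0\<close> itself.\<close>
    have "((\<lambda>(x, y). g x y) has_derivative (\<lambda>(tx, ty). tx *\<^sub>R prim2 J (Suc a) b p + blinfun_scaleR_left (J a 0 (s, t)) ty)) (at (s, t) within UNIV \<times> UNIV)"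
    proof (rule has_derivative_partialsI)
      show "((\<lambda>x. g x t) has_derivative (\<lambda>tx. tx *\<^sub>R prim2 J (Suc a) b p)) (at s within UNIV)"
        using prim2_partial1[OF J, of t a s] by (simp add: g_def prim2_def 0 p has_vector_derivative_def)
      show "((\<lambda>y. g x y) has_derivative blinfun_apply (blinfun_scaleR_left (J a 0 (x, y)))) (at y within UNIV)" for x y
        using prim2_integral[OF J, of a x y] by (simp add: g_def has_vector_derivative_def)
      have "isCont (J a 0) (s, t)"
        using smooth_jetD[OF J] has_derivative_continuous by blast
      then have "isCont (\<lambda>p. blinfun_scaleR_left (J a 0 p)) (s, t)"
        by (intro continuous_intros)
      then show "continuous (at (s, t) within UNIV \<times> UNIV) (\<lambda>(x, y). blinfun_scaleR_left (J a 0 (x, y)))"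
        by (simp add: case_prod_beta')
    qed auto
    moreover have "prim2 J a 0 = (\<lambda>(x, y). g x y)"
      by (simp add: prim2_def g_def fun_eq_iff)
    moreover have "prim2 J a (Suc 0) p = J a 0 p"
      by (simp add: prim2_def)
    ultimately show ?thesis
      by (simp add: 0 p case_prod_beta')
  qed
qed

lemma d2_prim2: "d2 (prim2 J) = J"
  by (simp add: d2_def prim2_def)

section \<open>Solving the wave equation away from a compact set\<close>

text \<open>Stronger than flatness at the point: where \<open>d2 J\<close> vanishes on an open set,
  \<open>J\<close> is locally constant in \<open>t\<close>, which flatness on a closed set would not
  give. It is moreover an open condition, so compactness yields uniform radii.\<close>

definition vanish_near :: "planar_jet \<Rightarrow> real \<times> real \<Rightarrow> bool" where
  "vanish_near J p \<longleftrightarrow> (\<exists>U. open U \<and> p \<in> U \<and> (\<forall>q\<in>U. flat_at J q))"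

definition box_at :: "real \<times> real \<Rightarrow> real \<Rightarrow> (real \<times> real) set" where
  "box_at p r = {q. \<bar>fst q - fst p\<bar> < r \<and> \<bar>snd q - snd p\<bar> < r}"

text \<open>The trace of \<open>J\<close> at height \<open>t\<close>, continued constantly in the
  second variable. It is killed by \<open>d2\<close> and coincides with \<open>J\<close> on any box
  reaching height \<open>t\<close> in which \<open>d2 J\<close> vanishes.\<close>

definition slice :: "planar_jet \<Rightarrow> real \<Rightarrow> planar_jet" where
  "slice J t = (\<lambda>a b p. if b = 0 then J a 0 (fst p, t) else 0)"

lemma box_at_bounds:
  assumes "q \<in> box_at (s, t) r"
  shows "s - r < fst q" "fst q < s + r" "t - r < snd q" "snd q < t + r"
  using assms by (auto simp: box_at_def abs_less_iff)

lemma open_box_at: "open (box_at p r)"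
  unfolding box_at_def by (intro open_Collect_conj open_Collect_less continuous_intros)

lemma box_at_self: "r > 0 \<Longrightarrow> p \<in> box_at p r"
  by (simp add: box_at_def)

lemma open_contains_box_at:
  assumes "open U" "p \<in> U" obtains r where "r > 0" "box_at p r \<subseteq> U"
proof -
  obtain e where e: "e > 0" "ball p e \<subseteq> U" using assms open_contains_ball by blast
  have "box_at p (e / 2) \<subseteq> ball p e"
  proof
    fix q assume "q \<in> box_at p (e / 2)"
    then have "\<bar>fst q - fst p\<bar> + \<bar>snd q - snd p\<bar> < e" by (simp add: box_at_def)
    moreover have "dist p q \<le> \<bar>fst q - fst p\<bar> + \<bar>snd q - snd p\<bar>"
      using sqrt_sum_squares_le_sum_abs[of "dist (fst p) (fst q)" "dist (snd p) (snd q)"]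
      by (simp add: dist_prod_def dist_real_def abs_minus_commute)
    ultimately show "q \<in> ball p e" by simp
  qed
  then show thesis using that[of "e / 2"] e by auto
qed

lemma flat_at_jsub: "flat_at (jsub J K) p \<longleftrightarrow> (\<forall>a b. J a b p = K a b p)"
  by (simp add: flat_at_def jsub_def)

lemma vanish_nearI: "open U \<Longrightarrow> p \<in> U \<Longrightarrow> (\<And>q. q \<in> U \<Longrightarrow> flat_at J q) \<Longrightarrow> vanish_near J p"
  by (auto simp: vanish_near_def)

lemma vanish_near_trans:
  assumes "vanish_near (jsub J K) p" "vanish_near (jsub K L) p"
  shows "vanish_near (jsub J L) p"
proof -
  obtain U V where "open U" "p \<in> U" "\<forall>q\<in>U. flat_at (jsub J K) q" "open V" "p \<in> V" "\<forall>q\<in>V. flat_at (jsub K L) q"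
    using assms unfolding vanish_near_def by blast
  then show ?thesis
    by (intro vanish_nearI[of "U \<inter> V"]) (auto simp: flat_at_jsub)
qed

lemma vanish_near_sym: "vanish_near (jsub J K) p \<longleftrightarrow> vanish_near (jsub K J) p"
  by (auto simp: vanish_near_def flat_at_jsub eq_commute)

lemma open_vanish_near: "open {p. vanish_near J p}"
  unfolding vanish_near_def open_subopen[of "{p. \<exists>U. open U \<and> p \<in> U \<and> (\<forall>q\<in>U. flat_at J q)}"] by auto

lemma smooth1_diff: "smooth1 f \<Longrightarrow> smooth1 g \<Longrightarrow> smooth1 (\<lambda>n x. f n x - g n x)"
  unfolding smooth1_def by (auto intro!: derivative_eq_intros)

lemma smooth_jet_slice:
  assumes "smooth_jet J" shows "smooth_jet (slice J t)"
  unfolding smooth_jet_def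
proof (intro allI)
  fix a b and p :: "real \<times> real"
  have "((\<lambda>p. J a 0 (fst p, t)) has_derivative (\<lambda>h. fst h *\<^sub>R J (Suc a) 0 (fst p, t))) (at p)"
    using has_derivative_compose[OF has_derivative_fst[OF has_derivative_ident] smooth_jet_partial1[OF assms, of a 0 t "fst p" UNIV, unfolded has_vector_derivative_def], of UNIV]
    by simp
  then show "(slice J t a b has_derivative
      (\<lambda>h. fst h *\<^sub>R slice J t (Suc a) b p + snd h *\<^sub>R slice J t a (Suc b) p)) (at p)"
    by (cases "b = 0") (auto simp: slice_def)
qed

lemma d2_slice: "flat_at (d2 (slice J t)) p"
  by (simp add: flat_at_def d2_def slice_def)

lemma flat_jprod1: "(\<And>n. \<phi> n (fst p) = 0) \<Longrightarrow> flat_at (jprod \<phi> \<psi>) p"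
  and flat_jprod2: "(\<And>n. \<psi> n (snd p) = 0) \<Longrightarrow> flat_at (jprod \<phi> \<psi>) p"
  by (simp_all add: flat_at_def jprod_def)

lemma jmul_jprod_one:
  assumes "\<And>n. \<phi> n (fst p) = unit1 n (fst p)" "\<And>n. \<psi> n (snd p) = unit1 n (snd p)"
  shows "jmul (jprod \<phi> \<psi>) K a b p = K a b p"
  by (rule jmul_one) (simp add: jprod_def assms unit1_def)

lemma constant_along_2:
  assumes J: "smooth_jet J" and z: "\<And>t. \<bar>t - t0\<bar> < r \<Longrightarrow> flat_at (d2 J) (s, t)"
    and "\<bar>t - t0\<bar> < r" "\<bar>t' - t0\<bar> < r"
  shows "J a b (s, t) = slice J t' a b (s, t)"
proof (cases b)
  case 0
  have "\<exists>c. \<forall>t\<in>ball t0 r. J a 0 (s, t) = c"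
  proof (rule has_derivative_zero_constant)
    fix t assume "t \<in> ball t0 r"
    then have "flat_at (d2 J) (s, t)" by (intro z) (simp add: dist_real_def abs_minus_commute)
    then have "J a (Suc 0) (s, t) = 0" by (simp add: flat_at_def d2_def)
    with smooth_jet_partial2[OF J, of a 0 s t "ball t0 r"]
    show "((\<lambda>t. J a 0 (s, t)) has_derivative (\<lambda>h. 0)) (at t within ball t0 r)"
      by (simp add: has_vector_derivative_def)
  qed simp
  with assms(3,4) 0 show ?thesis by (force simp: slice_def dist_real_def abs_minus_commute)
next
  case (Suc b')
  with z[OF assms(3)] show ?thesis by (simp add: slice_def flat_at_def d2_def)
qed

text \<open>Passing from \<open>m\<close> to \<open>m + D\<close> by a cut-off \<open>X\<close>
  gives the derivative \<open>d2 m + (d2 X) D + X (d2 D)\<close>. The critical middle term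
  disappears either because \<open>X\<close> does not vary with \<open>t\<close> or because the two
  functions already agree.\<close>

lemma d2_blend:
  assumes "flat_at (d2 m) p" "flat_at (d2 D) p" "flat_at (d2 X) p \<or> flat_at D p"
  shows "flat_at (d2 (jadd m (jmul X D))) p"
proof -
  have "d2 (jadd m (jmul X D)) = jadd (d2 m) (d2 (jmul X D))"
    by (simp add: d2_def jadd_def)
  moreover have "jmul (d2 X) D a b p = 0" for a b
    using assms(3) jmul_flat1 jmul_flat2 by blast
  moreover have "jmul X (d2 D) a b p = 0" for a b
    using assms(2) jmul_flat2 by blast
  ultimately show ?thesis
    using assms(1) by (simp add: d2_jmul flat_at_def) (simp add: jadd_def)
qed

lemma vanish_near_blend:
  assumes "vanish_near D p" shows "vanish_near (jsub (jadd m (jmul X D)) m) p"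
  using assms unfolding vanish_near_def
  by (metis (no_types, lifting) add.right_neutral flat_at_jsub jadd_def jmul_flat2)

text \<open>
  On a line \<open>s = s0\<close> the function \<open>\<Phi>\<close> is locally constant near \<open>K\<close>, but its values at different
  points of \<open>K\<close> disagree. Going upwards along the line, \<open>m\<close> is corrected by a smooth step in \<open>t\<close>
  whenever a gap of \<open>K\<close> of length at least \<open>\<eta>\<close> is crossed; the step is placed around a point of
  the gap outside \<open>F\<close>, where \<open>\<partial>\<^sub>2 m\<close> is allowed to be nonzero (across shorter gaps \<open>\<Phi>\<close>
  is constant).
\<close>

lemma local_match:
  assumes "compact K" "closed F" and \<Phi>: "smooth_jet \<Phi>" and van: "\<And>p. p \<in> K \<Longrightarrow> vanish_near (d2 \<Phi>) p"
    and gap: "\<And>a b. a < b \<Longrightarrow> (s0, a) \<in> K \<Longrightarrow> (s0, b) \<in> K \<Longrightarrow> (\<And>t. a < t \<Longrightarrow> t < b \<Longrightarrow> (s0, t) \<notin> K) \<Longrightarrow>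
       \<exists>t. a < t \<and> t < b \<and> (s0, t) \<notin> F"
  shows "\<exists>\<epsilon>>0. \<exists>m. smooth_jet m \<and> (\<forall>p\<in>F. \<bar>fst p - s0\<bar> < \<epsilon> \<longrightarrow> flat_at (d2 m) p) \<and>
     (\<forall>p\<in>K. \<bar>fst p - s0\<bar> < \<epsilon> \<longrightarrow> vanish_near (jsub m \<Phi>) p)"
proof -
  define V where "V = {p. vanish_near (d2 \<Phi>) p}"
  have V: "open V" "K \<subseteq> V" using open_vanish_near van by (auto simp: V_def)
  obtain e where e: "e > 0" "(\<Union>p\<in>K. ball p e) \<subseteq> V"
    using compact_subset_open_imp_ball_epsilon_subset[OF \<open>compact K\<close> V] by blast
  \<comment> \<open>Half of \<open>e\<close>, since the distance is estimated by the sum of the two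
    coordinate differences.\<close>
  define \<eta> where "\<eta> = e / 2"
  have \<eta>: "\<eta> > 0" using e by (simp add: \<eta>_def)
  have near: "flat_at (d2 \<Phi>) (s, t')" if "(s0, t) \<in> K" "\<bar>s - s0\<bar> < \<eta>" "\<bar>t' - t\<bar> < \<eta>" for s t t'
  proof -
    have "dist (s0, t) (s, t') \<le> \<bar>s - s0\<bar> + \<bar>t' - t\<bar>"
      using sqrt_sum_squares_le_sum_abs[of "dist s0 s" "dist t t'"]
      by (simp add: dist_prod_def dist_real_def abs_minus_commute)
    then have "(s, t') \<in> ball (s0, t) e" using that by (simp add: \<eta>_def)
    then have "vanish_near (d2 \<Phi>) (s, t')" using e that(1) by (fastforce simp: V_def)
    then show ?thesis by (auto simp: vanish_near_def)
  qed
  have near': "vanish_near (jsub \<Phi> (slice \<Phi> t2)) (s0, t)" if "(s0, t) \<in> K" "\<bar>t2 - t\<bar> < \<eta>" for t t2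
  proof (rule vanish_nearI[OF open_box_at box_at_self[OF \<eta>]])
    fix q assume "q \<in> box_at (s0, t) \<eta>"
    then have q: "\<bar>fst q - s0\<bar> < \<eta>" "\<bar>snd q - t\<bar> < \<eta>" by (auto simp: box_at_def)
    have "\<Phi> a b (fst q, snd q) = slice \<Phi> t2 a b (fst q, snd q)" for a b
      by (rule constant_along_2[OF \<Phi> near[OF that(1) q(1)] q(2) that(2)])
    then show "flat_at (jsub \<Phi> (slice \<Phi> t2)) q" by (simp add: flat_at_jsub)
  qed
  define Kt where "Kt = {t. (s0, t) \<in> K}"
  have "Kt = snd ` (K \<inter> {s0} \<times> UNIV)" by (force simp: Kt_def)
  moreover have "compact (K \<inter> {s0} \<times> UNIV)"
    by (intro compact_Int_closed \<open>compact K\<close> closed_Times) auto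
  ultimately have Kt: "compact Kt"
    by (auto intro!: compact_continuous_image continuous_intros)
  then obtain R where R: "R > 0" "\<And>t. t \<in> Kt \<Longrightarrow> \<bar>t\<bar> < R"
    using bounded_pos_less[of Kt] compact_imp_bounded by (metis real_norm_def)
  define A where "A \<epsilon> m \<longleftrightarrow> (\<forall>p\<in>F. \<bar>fst p - s0\<bar> < \<epsilon> \<longrightarrow> flat_at (d2 m) p)" for \<epsilon> :: real and m
  \<comment> \<open>The line is swept in windows of height \<open>\<eta> / 2\<close>. All points of
    \<open>K\<close> in one window lie within \<open>\<eta>\<close> of the lowest of them, so a
    single slice of \<open>\<Phi>\<close> matches \<open>\<Phi>\<close> near all of them. Below
    \<open>- R\<close> there is nothing to match.\<close>
  have step: "\<exists>\<epsilon>>0. \<exists>m. smooth_jet m \<and> A \<epsilon> m \<and> (\<forall>t\<in>Kt. t \<le> - R + real n * (\<eta> / 2) \<longrightarrow> vanish_near (jsub m \<Phi>) (s0, t))" for n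
  proof (induction n)
    case 0
    have "smooth_jet (\<lambda>a b p. 0) \<and> A 1 (\<lambda>a b p. 0) \<and> (\<forall>t\<in>Kt. t \<le> - R \<longrightarrow> vanish_near (jsub (\<lambda>a b p. 0) \<Phi>) (s0, t))"
      using R by (force simp: smooth_jet_0 A_def flat_at_def d2_def)
    then show ?case by (auto intro!: exI[of _ "1::real"])
  next
    case (Suc n)
    define T where "T = - R + real n * (\<eta> / 2)"
    have T': "- R + real (Suc n) * (\<eta> / 2) = T + \<eta> / 2" by (simp add: T_def algebra_simps add_divide_distrib)
    obtain \<epsilon> m where \<epsilon>: "\<epsilon> > 0" and m: "smooth_jet m" "A \<epsilon> m" 
      and mK: "\<And>t. t \<in> Kt \<Longrightarrow> t \<le> T \<Longrightarrow> vanish_near (jsub m \<Phi>) (s0, t)"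
      using Suc.IH unfolding T_def by blast
    show ?case unfolding T'
    proof (cases "\<exists>t\<in>Kt. T < t \<and> t \<le> T + \<eta> / 2")
      case False
      then show "\<exists>\<epsilon>>0. \<exists>m. smooth_jet m \<and> A \<epsilon> m \<and> (\<forall>t\<in>Kt. t \<le> T + \<eta> / 2 \<longrightarrow> vanish_near (jsub m \<Phi>) (s0, t))"
        using \<epsilon> m mK by (metis not_le)
    next
      case True
      have "compact (Kt \<inter> {T..T + \<eta> / 2})" "Kt \<inter> {T..T + \<eta> / 2} \<noteq> {}"
        using Kt True by (auto intro: compact_Int_closed)
      then obtain t2 where t2: "t2 \<in> Kt" "T \<le> t2" "t2 \<le> T + \<eta> / 2" "\<And>t. t \<in> Kt \<Longrightarrow> T \<le> t \<Longrightarrow> t \<le> T + \<eta> / 2 \<Longrightarrow> t2 \<le> t"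
        using compact_attains_inf[of "Kt \<inter> {T..T + \<eta> / 2}"] by (metis IntE IntI atLeastAtMost_iff)
      define P where "P = slice \<Phi> t2"
      have P: "smooth_jet P" unfolding P_def by (rule smooth_jet_slice[OF \<Phi>])
      have above: "vanish_near (jsub \<Phi> P) (s0, t)" if "t \<in> Kt" "t2 \<le> t" "t \<le> T + \<eta> / 2" for t
        unfolding P_def by (rule near') (use that t2 \<eta> in \<open>auto simp: Kt_def\<close>)
      show "\<exists>\<epsilon>>0. \<exists>m. smooth_jet m \<and> A \<epsilon> m \<and> (\<forall>t\<in>Kt. t \<le> T + \<eta> / 2 \<longrightarrow> vanish_near (jsub m \<Phi>) (s0, t))"
      proof (cases "\<exists>t\<in>Kt. t \<le> T")
        case False
        have "smooth_jet P \<and> A 1 P \<and> (\<forall>t\<in>Kt. t \<le> T + \<eta> / 2 \<longrightarrow> vanish_near (jsub P \<Phi>) (s0, t))"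
          using False t2 P d2_slice by (auto simp: A_def P_def[symmetric] vanish_near_sym[of P] intro!: above)
            (auto simp: P_def)
        then show ?thesis by (auto intro!: exI[of _ "1::real"])
      next
        case True
        have "compact (Kt \<inter> {..T})" "Kt \<inter> {..T} \<noteq> {}"
          using Kt True by (auto intro: compact_Int_closed)
        then obtain t1 where t1: "t1 \<in> Kt" "t1 \<le> T" "\<And>t. t \<in> Kt \<Longrightarrow> t \<le> T \<Longrightarrow> t \<le> t1"
          using compact_attains_sup[of "Kt \<inter> {..T}"] by (metis IntE IntI atMost_iff)
        \<comment> \<open>\<open>t1\<close> and \<open>t2\<close> are consecutive (or equal) points
          of \<open>K\<close> on the line. If they are close, \<open>P\<close> matches
          \<open>\<Phi>\<close> near \<open>t1\<close> too, hence agrees with \<open>m\<close>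
          there, and the switch is made at \<open>t1\<close>. Otherwise the gap supplies a point
          outside \<open>F\<close>. Either way \<open>m\<close> and \<open>P\<close> agree at all
          points of \<open>F\<close> in the window around \<open>c\<close>.\<close>
        have "\<exists>c r. 0 < r \<and> r \<le> \<epsilon> \<and> t1 \<le> c \<and> c \<le> t2 \<and>
           (\<forall>p\<in>F. \<bar>fst p - s0\<bar> < r \<longrightarrow> \<bar>snd p - c\<bar> < r \<longrightarrow> flat_at (jsub m P) p) \<and>
           (\<forall>t\<in>Kt. \<bar>t - c\<bar> < r \<longrightarrow> vanish_near (jsub m P) (s0, t))"
        proof (cases "t2 - t1 < \<eta>")
          case True
          have "vanish_near (jsub \<Phi> P) (s0, t1)"
            unfolding P_def by (rule near') (use t1 t2 True in \<open>auto simp: Kt_def\<close>)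
          with mK[OF t1(1,2)] have "vanish_near (jsub m P) (s0, t1)" by (rule vanish_near_trans)
          then obtain U where U: "open U" "(s0, t1) \<in> U" "\<forall>q\<in>U. flat_at (jsub m P) q"
            unfolding vanish_near_def by blast
          then obtain r where r: "r > 0" "box_at (s0, t1) r \<subseteq> U"
            using open_contains_box_at by metis
          have fl: "flat_at (jsub m P) p" if "\<bar>fst p - s0\<bar> < r" "\<bar>snd p - t1\<bar> < r" for p
            using U(3) r that by (auto simp: box_at_def)
          moreover have "vanish_near (jsub m P) (s0, t)" if "\<bar>t - t1\<bar> < r" for t
            by (rule vanish_nearI[OF open_box_at[of "(s0, t1)" r]]) (use that r fl in \<open>auto simp: box_at_def\<close>)
          ultimately show ?thesis
            using t1 t2 r \<epsilon> by (intro exI[of _ t1] exI[of _ "min r \<epsilon>"]) auto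
        next
          case False
          then have "t1 < t2" using \<eta> by simp
          have none: "t \<notin> Kt" if "t1 < t" "t < t2" for t
            using that t1(3)[of t] t2(3) t2(4)[of t] by force
          obtain c where c: "t1 < c" "c < t2" "(s0, c) \<notin> F"
            using gap[OF \<open>t1 < t2\<close>] t1 t2 none by (auto simp: Kt_def)
          obtain r where r: "r > 0" "box_at (s0, c) r \<subseteq> - F"
            using open_contains_box_at[of "- F" "(s0, c)"] c \<open>closed F\<close> by auto
          define r' where "r' = Min {r, \<epsilon>, c - t1, t2 - c}"
          have r': "r' > 0" "r' \<le> r" "r' \<le> \<epsilon>" "r' \<le> c - t1" "r' \<le> t2 - c"
            using r \<epsilon> c by (auto simp: r'_def)
          have "p \<notin> F" if "\<bar>fst p - s0\<bar> < r'" "\<bar>snd p - c\<bar> < r'" for p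
          proof -
            have "p \<in> box_at (s0, c) r" using r' that by (simp add: box_at_def)
            then show ?thesis using r by blast
          qed
          moreover have "t \<notin> Kt" if "\<bar>t - c\<bar> < r'" for t
            using none[of t] r' that by auto
          ultimately show ?thesis using r' c by (intro exI[of _ c] exI[of _ r']) auto
        qed
        then obtain c r where r: "0 < r" "r \<le> \<epsilon>" "t1 \<le> c" "c \<le> t2"
          and W1: "\<And>p. p \<in> F \<Longrightarrow> \<bar>fst p - s0\<bar> < r \<Longrightarrow> \<bar>snd p - c\<bar> < r \<Longrightarrow> flat_at (jsub m P) p"
          and W2: "\<And>t. t \<in> Kt \<Longrightarrow> \<bar>t - c\<bar> < r \<Longrightarrow> vanish_near (jsub m P) (s0, t)"
          by blast
        \<comment> \<open>The transition fills only half of the window, so that a point at distance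
          at least \<open>r\<close> from height \<open>c\<close> has a neighbourhood on which the
          cut-off is constantly 0 or 1.\<close>
        obtain \<sigma> where \<sigma>: "smooth1 \<sigma>" "\<And>n x. x \<le> c - r / 2 \<Longrightarrow> \<sigma> n x = 0" "\<And>n x. c + r / 2 \<le> x \<Longrightarrow> \<sigma> n x = unit1 n x"
          using smooth_step[of "c - r / 2" "c + r / 2"] r by auto
        define X where "X = jprod unit1 \<sigma>"
        define m' where "m' = jadd m (jmul X (jsub P m))"
        have X: "smooth_jet X" unfolding X_def by (intro smooth_jet_jprod smooth1_unit1 \<sigma>)
        have X0: "flat_at X q" if "snd q \<le> c - r / 2" for q
          unfolding X_def using \<sigma>(2) that by (intro flat_jprod2) auto
        have X1: "jmul X J a b q = J a b q" if "c + r / 2 \<le> snd q" for q J a b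
          unfolding X_def using \<sigma>(3) that by (intro jmul_jprod_one) auto
        have X': "flat_at (d2 X) q" if "\<not> \<bar>snd q - c\<bar> < r" for q
        proof -
          have "snd q \<le> c - r / 2 \<or> c + r / 2 \<le> snd q" using that r by auto
          then show ?thesis
            using \<sigma>(2,3) by (auto simp: flat_at_def X_def d2_def jprod_def unit1_def)
        qed
        have 1: "smooth_jet m'" unfolding m'_def
          by (intro smooth_jet_jadd smooth_jet_jmul smooth_jet_jsub P X m)
        have 2: "A r m'" unfolding A_def
        proof (intro ballI impI)
          fix p assume p: "p \<in> F" "\<bar>fst p - s0\<bar> < r"
          have fm: "flat_at (d2 m) p" using m(2) p r by (auto simp: A_def)
          have "flat_at (d2 (jsub P m)) p"
            using fm d2_slice[of \<Phi> t2 p] by (simp add: P_def flat_at_def d2_def jsub_def)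
          then show "flat_at (d2 m') p"
            unfolding m'_def using fm W1[OF p] X'[of p]
            by (intro d2_blend) (auto simp: flat_at_jsub eq_commute)
        qed
        have 3: "vanish_near (jsub m' \<Phi>) (s0, t)" if t: "t \<in> Kt" "t \<le> T + \<eta> / 2" for t
        proof -
          have dich: "t \<le> T \<or> t2 \<le> t" using t2(4)[of t] t by force
          consider "\<bar>t - c\<bar> < r" | "t \<le> c - r" | "c + r \<le> t" by linarith
          then show ?thesis
          proof cases
            case 1
            have mP: "vanish_near (jsub m P) (s0, t)" by (rule W2[OF t(1) 1])
            then have "vanish_near (jsub m' m) (s0, t)"
              unfolding m'_def vanish_near_sym[of m P] by (rule vanish_near_blend)
            moreover have "vanish_near (jsub m \<Phi>) (s0, t)"
              using dich mK[OF t(1)] vanish_near_trans[OF mP] above[OF t(1) _ t(2)] vanish_near_sym by blast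
            ultimately show ?thesis by (rule vanish_near_trans)
          next
            case 2
            have "vanish_near (jsub m' m) (s0, t)"
            proof (rule vanish_nearI[OF open_box_at[of "(s0, t)" "r / 2"] box_at_self])
              fix q assume "q \<in> box_at (s0, t) (r / 2)"
              then have "snd q \<le> c - r / 2" using 2 box_at_bounds[of q s0 t "r / 2"] by linarith
              then show "flat_at (jsub m' m) q"
                using X0 by (simp add: flat_at_jsub m'_def jadd_def jmul_flat1)
            qed (use r in simp)
            moreover have "vanish_near (jsub m \<Phi>) (s0, t)"
              using mK[OF t(1)] dich 2 r by auto
            ultimately show ?thesis by (rule vanish_near_trans)
          next
            case 3
            have "vanish_near (jsub m' P) (s0, t)"
            proof (rule vanish_nearI[OF open_box_at[of "(s0, t)" "r / 2"] box_at_self])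
              fix q assume "q \<in> box_at (s0, t) (r / 2)"
              then have "c + r / 2 \<le> snd q" using 3 box_at_bounds[of q s0 t "r / 2"] by linarith
              then show "flat_at (jsub m' P) q"
                using X1 by (simp add: flat_at_jsub m'_def jadd_def) (simp add: jsub_def)
            qed (use r in simp)
            moreover have "vanish_near (jsub P \<Phi>) (s0, t)"
              unfolding vanish_near_sym[of P] by (rule above) (use t dich t1(3)[of t] 3 r in auto)
            ultimately show ?thesis by (rule vanish_near_trans)
          qed
        qed
        show ?thesis using 1 2 3 r by blast
      qed
    qed
  qed
  obtain n where n: "2 * R \<le> real n * (\<eta> / 2)"
    using reals_Archimedean3[of "\<eta> / 2"] \<eta> by (metis half_gt_zero less_imp_le)
  obtain \<epsilon> m where \<epsilon>: "\<epsilon> > 0" and m: "smooth_jet m" "A \<epsilon> m" 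
    and mK: "\<And>t. t \<in> Kt \<Longrightarrow> t \<le> - R + real n * (\<eta> / 2) \<Longrightarrow> vanish_near (jsub m \<Phi>) (s0, t)"
    using step[of n] by blast
  have mK: "vanish_near (jsub m \<Phi>) (s0, t)" if "t \<in> Kt" for t
    using mK[OF that] R(2)[OF that] n by auto
  \<comment> \<open>Passage from the line to a strip: the points of \<open>K\<close> where the match
    fails form a compact set, so their projection is closed, and it misses
    \<open>s0\<close>.\<close>
  define B where "B = fst ` (K - {p. vanish_near (jsub m \<Phi>) p})"
  have "compact B" unfolding B_def
    by (intro compact_continuous_image continuous_intros compact_diff \<open>compact K\<close> open_vanish_near)
  then have "open (- B)" by (simp add: compact_imp_closed open_Compl)
  moreover have "s0 \<in> - B" using mK by (auto simp: B_def Kt_def)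
  ultimately obtain \<delta> where \<delta>: "\<delta> > 0" "ball s0 \<delta> \<subseteq> - B" using open_contains_ball by blast
  have "vanish_near (jsub m \<Phi>) p" if "p \<in> K" "\<bar>fst p - s0\<bar> < \<delta>" for p
  proof -
    have "fst p \<in> - B" using \<delta> that by (auto simp: dist_real_def abs_minus_commute)
    then show ?thesis using that by (auto simp: B_def)
  qed
  then show ?thesis
    using \<epsilon> \<delta> m by (intro exI[of _ "min \<epsilon> \<delta>"]) (auto simp: A_def)
qed

text \<open>
  The local corrections are glued by smooth steps in \<open>s\<close>, which commute with \<open>\<partial>\<^sub>2\<close>.
\<close>

lemma sweep:
  assumes "compact K" "closed F" and k: "smooth_jet k" and van: "\<And>p. p \<in> K \<Longrightarrow> vanish_near k p"
    and gap: "\<And>s a b. a < b \<Longrightarrow> (s, a) \<in> K \<Longrightarrow> (s, b) \<in> K \<Longrightarrow> (\<And>t. a < t \<Longrightarrow> t < b \<Longrightarrow> (s, t) \<notin> K) \<Longrightarrow>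
       \<exists>t. a < t \<and> t < b \<and> (s, t) \<notin> F"
  obtains h where "smooth_jet h" "\<And>p a b. p \<in> F \<Longrightarrow> h a (Suc b) p = k a b p"
    "\<And>p. p \<in> K \<Longrightarrow> vanish_near h p"
proof -
  define \<Phi> where "\<Phi> = prim2 k"
  have \<Phi>: "smooth_jet \<Phi>" "d2 \<Phi> = k" using smooth_jet_prim2[OF k] d2_prim2 by (auto simp: \<Phi>_def)
  define good where "good m s \<longleftrightarrow> (\<forall>t. (s, t) \<in> F \<longrightarrow> flat_at (d2 m) (s, t)) \<and> 
     (\<forall>t. (s, t) \<in> K \<longrightarrow> vanish_near (jsub m \<Phi>) (s, t))" for m s
  \<comment> \<open>The margin \<open>\<epsilon>\<close> makes solutions over adjacent intervals
    overlap, which leaves room for the transition between them. \<open>P\<close> thus holds locally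
    and passes to concatenated intervals, and Bolzano's principle gives it over the whole projection
    of \<open>K\<close>.\<close>
  define P where "P a b \<longleftrightarrow> (\<exists>\<epsilon>>0. \<exists>m. smooth_jet m \<and> (\<forall>s. a - \<epsilon> < s \<and> s < b + \<epsilon> \<longrightarrow> good m s))" for a b
  have "bounded (fst ` K)"
    by (intro compact_imp_bounded compact_continuous_image continuous_intros \<open>compact K\<close>)
  then obtain R where R: "R > 0" "\<And>p. p \<in> K \<Longrightarrow> \<bar>fst p\<bar> < R"
    using bounded_pos_less[of "fst ` K"] by auto
  have "- R \<le> R" using R by simp
  then have "P (- R) R"
  proof (induction rule: Bolzano)
    case (local x)
    obtain \<epsilon> m where e: "\<epsilon> > 0" and m: "smooth_jet m" 
      "\<And>p. p \<in> F \<Longrightarrow> \<bar>fst p - x\<bar> < \<epsilon> \<Longrightarrow> flat_at (d2 m) p"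
      "\<And>p. p \<in> K \<Longrightarrow> \<bar>fst p - x\<bar> < \<epsilon> \<Longrightarrow> vanish_near (jsub m \<Phi>) p"
      using local_match[OF assms(1,2) \<Phi>(1), unfolded \<Phi>(2), OF van gap[of _ _ x]] by blast
    have "P a b" if "a \<le> x" "x \<le> b" "b - a < \<epsilon> / 2" for a b
      unfolding P_def
      by (rule exI[of _ "\<epsilon> / 2"], intro conjI exI[of _ m] allI impI)
         (use that e m in \<open>auto simp: good_def\<close>)
    then show ?case using e by (auto intro!: exI[of _ "\<epsilon> / 2"])
  next
    case (trans a c d)
    obtain \<epsilon>1 m1 where 1: "\<epsilon>1 > 0" "smooth_jet m1" "\<And>s. a - \<epsilon>1 < s \<Longrightarrow> s < c + \<epsilon>1 \<Longrightarrow> good m1 s"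
      using trans(1) by (auto simp: P_def)
    obtain \<epsilon>2 m2 where 2: "\<epsilon>2 > 0" "smooth_jet m2" "\<And>s. c - \<epsilon>2 < s \<Longrightarrow> s < d + \<epsilon>2 \<Longrightarrow> good m2 s"
      using trans(2) by (auto simp: P_def)
    define e where "e = min \<epsilon>1 \<epsilon>2"
    have e: "e > 0" "e \<le> \<epsilon>1" "e \<le> \<epsilon>2" using 1 2 by (auto simp: e_def)
    obtain \<sigma> where \<sigma>: "smooth1 \<sigma>" "\<And>n x. x \<le> c - e / 2 \<Longrightarrow> \<sigma> n x = 0" "\<And>n x. c + e / 2 \<le> x \<Longrightarrow> \<sigma> n x = unit1 n x"
      using smooth_step[of "c - e / 2" "c + e / 2"] e by auto
    define X where "X = jprod \<sigma> unit1"
    define m where "m = jadd m1 (jmul X (jsub m2 m1))"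
    have X: "smooth_jet X" unfolding X_def by (intro smooth_jet_jprod smooth1_unit1 \<sigma>)
    have X': "flat_at (d2 X) q" for q
      by (simp add: flat_at_def X_def d2_def jprod_def unit1_def)
    have sm: "smooth_jet m" unfolding m_def
      by (intro smooth_jet_jadd smooth_jet_jmul smooth_jet_jsub 1 2 X)
    have "good m s" if s: "a - e < s" "s < d + e" for s
    proof -
      consider "\<bar>s - c\<bar> < e" | "s \<le> c - e" | "c + e \<le> s" by linarith
      then show ?thesis
      proof cases
        case c1: 1
        have g: "good m1 s" "good m2 s"
          using 1(3)[of s] 2(3)[of s] c1 s e by (auto simp: abs_less_iff)
        show ?thesis unfolding good_def
        proof (intro conjI allI impI)
          fix t assume "(s, t) \<in> F"
          then have "flat_at (d2 m1) (s, t)" "flat_at (d2 m2) (s, t)" using g by (auto simp: good_def)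
          moreover from this have "flat_at (d2 (jsub m2 m1)) (s, t)"
            by (simp add: flat_at_def d2_def jsub_def)
          ultimately show "flat_at (d2 m) (s, t)" unfolding m_def by (intro d2_blend) (auto simp: X')
        next
          fix t assume "(s, t) \<in> K"
          then have v: "vanish_near (jsub m1 \<Phi>) (s, t)" "vanish_near (jsub m2 \<Phi>) (s, t)" using g by (auto simp: good_def)
          then have "vanish_near (jsub m2 m1) (s, t)" using vanish_near_trans vanish_near_sym by blast
          then have "vanish_near (jsub m m1) (s, t)"
            unfolding m_def by (rule vanish_near_blend)
          then show "vanish_near (jsub m \<Phi>) (s, t)" using v(1) vanish_near_trans by blast
        qed
      next
        case c2: 2
        have g: "good m1 s" using 1(3)[of s] c2 s e by auto
        have v: "vanish_near (jsub m m1) (s, t)" for t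
        proof (rule vanish_nearI[OF open_box_at[of "(s, t)" "e / 2"] box_at_self])
          fix q assume "q \<in> box_at (s, t) (e / 2)"
          then have "fst q \<le> c - e / 2" using c2 box_at_bounds[of q s t "e / 2"] by linarith
          then have "flat_at X q" unfolding X_def using \<sigma>(2) by (intro flat_jprod1) auto
          then show "flat_at (jsub m m1) q" by (simp add: flat_at_jsub m_def jadd_def jmul_flat1)
        qed (use e in simp)
        then have "m a b (s, t) = m1 a b (s, t)" for a b t
          by (auto simp: vanish_near_def flat_at_jsub)
        then show ?thesis using g v vanish_near_trans
          by (auto simp: good_def d2_def flat_at_def) blast
      next
        case c3: 3
        have g: "good m2 s" using 2(3)[of s] c3 s e by auto
        have v: "vanish_near (jsub m m2) (s, t)" for t
        proof (rule vanish_nearI[OF open_box_at[of "(s, t)" "e / 2"] box_at_self])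
          fix q assume "q \<in> box_at (s, t) (e / 2)"
          then have "c + e / 2 \<le> fst q" using c3 box_at_bounds[of q s t "e / 2"] by linarith
          then have "jmul X J a b q = J a b q" for J a b
            unfolding X_def using \<sigma>(3) by (intro jmul_jprod_one) auto
          then show "flat_at (jsub m m2) q" by (simp add: flat_at_jsub m_def jadd_def) (simp add: jsub_def)
        qed (use e in simp)
        then have "m a b (s, t) = m2 a b (s, t)" for a b t
          by (auto simp: vanish_near_def flat_at_jsub)
        then show ?thesis using g v vanish_near_trans
          by (auto simp: good_def d2_def flat_at_def) blast
      qed
    qed
    then show ?case unfolding P_def using sm e by blast
  qed
  then obtain \<epsilon> m where \<epsilon>: "\<epsilon> > 0" and m: "smooth_jet m" and g: "\<And>s. - R - \<epsilon> < s \<Longrightarrow> s < R + \<epsilon> \<Longrightarrow> good m s"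
    by (auto simp: P_def)
  obtain \<sigma> where \<sigma>: "smooth1 \<sigma>" "\<And>n x. x \<le> - R - \<epsilon> / 2 \<Longrightarrow> \<sigma> n x = 0" "\<And>n x. - R \<le> x \<Longrightarrow> \<sigma> n x = unit1 n x"
    using smooth_step[of "- R - \<epsilon> / 2" "- R"] \<epsilon> by auto
  obtain \<tau> where \<tau>: "smooth1 \<tau>" "\<And>n x. x \<le> R \<Longrightarrow> \<tau> n x = 0" "\<And>n x. R + \<epsilon> / 2 \<le> x \<Longrightarrow> \<tau> n x = unit1 n x"
    using smooth_step[of R "R + \<epsilon> / 2"] \<epsilon> by auto
  \<comment> \<open>\<open>m\<close> is usable only in the strip where it is \<open>good\<close>.
    This cut-off vanishes outside the strip, equals 1 over \<open>K\<close>, and depends on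
    \<open>s\<close> alone, so it does not disturb the equation in \<open>t\<close>.\<close>
  define X where "X = jprod (\<lambda>n x. \<sigma> n x - \<tau> n x) unit1"
  define h where "h = jsub \<Phi> (jmul X m)"
  have X: "smooth_jet X" unfolding X_def by (intro smooth_jet_jprod smooth1_unit1 smooth1_diff \<sigma> \<tau>)
  have X': "flat_at (d2 X) q" for q
    by (simp add: flat_at_def X_def d2_def jprod_def unit1_def)
  show thesis
  proof (rule that)
    show "smooth_jet h" unfolding h_def by (intro smooth_jet_jsub smooth_jet_jmul X m \<Phi>)
    fix p assume p: "p \<in> F"
    have "flat_at (d2 (jmul X m)) p"
    proof (cases "- R - \<epsilon> < fst p \<and> fst p < R + \<epsilon>")
      case True
      then have "flat_at (d2 m) p" using g[of "fst p"] p unfolding good_def by (metis prod.collapse)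
      then show ?thesis
        by (auto simp: d2_jmul jadd_def jmul_flat1[OF X'] flat_at_def[of "\<lambda>a b p. _ a b p"] intro: jmul_flat2)
    next
      case False
      then have "flat_at X p"
        unfolding X_def using \<sigma>(2,3) \<tau>(2,3) \<epsilon> R by (intro flat_jprod1) auto
      then show ?thesis
        by (auto simp: d2_jmul jadd_def jmul_flat1[OF X'] flat_at_def[of "\<lambda>a b p. _ a b p"] intro: jmul_flat1)
    qed
    then have "jmul X m a (Suc b) p = 0" for a b by (simp add: flat_at_def d2_def)
    moreover have "\<Phi> a (Suc b) p = k a b p" for a b using \<Phi>(2) by (metis d2_def)
    ultimately show "h a (Suc b) p = k a b p" for a b
      by (simp add: h_def jsub_def)
  next
    fix p assume p: "p \<in> K"
    have R': "\<bar>fst p\<bar> < R" using R p by auto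
    then have "good m (fst p)" using \<epsilon> by (intro g) auto
    then have "vanish_near (jsub m \<Phi>) p" using p unfolding good_def by (metis prod.collapse)
    then obtain U where U: "open U" "p \<in> U" "\<forall>q\<in>U. flat_at (jsub m \<Phi>) q" unfolding vanish_near_def by blast
    show "vanish_near h p"
    proof (rule vanish_nearI)
      show "open (U \<inter> {q. \<bar>fst q\<bar> < R})"
        by (intro open_Int U open_Collect_less continuous_intros)
      show "p \<in> U \<inter> {q. \<bar>fst q\<bar> < R}" using U R' by simp
      fix q assume q: "q \<in> U \<inter> {q. \<bar>fst q\<bar> < R}"
      then have "jmul X m a b q = m a b q" for a b
        unfolding X_def using \<sigma>(3) \<tau>(2) by (intro jmul_jprod_one) auto
      then show "flat_at h q" using U q by (simp add: h_def flat_at_jsub)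
    qed
  qed
qed

lemma vanish_near_jswap: "vanish_near (jswap J) p \<longleftrightarrow> vanish_near J (prod.swap p)"
proof -
  have *: "vanish_near (jswap J) p" if v: "vanish_near J (prod.swap p)" for J p
  proof -
    obtain U where U: "open U" "prod.swap p \<in> U" "\<And>q. q \<in> U \<Longrightarrow> flat_at J q"
      using v unfolding vanish_near_def by blast
    show ?thesis
    proof (rule vanish_nearI)
      show "open (prod.swap -` U)" 
        by (intro open_vimage U) (auto simp: prod.swap_def intro!: continuous_intros)
    qed (use U in \<open>auto simp: flat_at_def jswap_def\<close>)
  qed
  have "jswap (jswap J) = J" by (simp add: jswap_def)
  with *[of J p] *[of "jswap J" "prod.swap p"] show ?thesis by auto
qed

text \<open>Two sweeps, one for each variable, the second applied to the result \<open>h\<close> of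
  the first. This works because a sweep returns a function vanishing near \<open>K\<close>, not only
  on it, which is exactly what it demands of its right-hand side.\<close>

lemma wave_solve:
  assumes "compact K" "closed F" and k: "smooth_jet k" and van: "\<And>p. p \<in> K \<Longrightarrow> vanish_near k p"
    and gap2: "\<And>s a b. a < b \<Longrightarrow> (s, a) \<in> K \<Longrightarrow> (s, b) \<in> K \<Longrightarrow> (\<And>t. a < t \<Longrightarrow> t < b \<Longrightarrow> (s, t) \<notin> K) \<Longrightarrow>
       \<exists>t. a < t \<and> t < b \<and> (s, t) \<notin> F"
    and gap1: "\<And>t a b. a < b \<Longrightarrow> (a, t) \<in> K \<Longrightarrow> (b, t) \<in> K \<Longrightarrow> (\<And>s. a < s \<Longrightarrow> s < b \<Longrightarrow> (s, t) \<notin> K) \<Longrightarrow>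
       \<exists>s. a < s \<and> s < b \<and> (s, t) \<notin> F"
  obtains w where "smooth_jet w" "\<And>p a b. p \<in> F \<Longrightarrow> w (Suc a) (Suc b) p = k a b p"
    "\<And>p. p \<in> K \<Longrightarrow> flat_at w p"
proof -
  obtain h where h: "smooth_jet h" "\<And>p a b. p \<in> F \<Longrightarrow> h a (Suc b) p = k a b p"
    "\<And>p. p \<in> K \<Longrightarrow> vanish_near h p"
    by (rule sweep[OF assms(1,2) k van gap2]) auto
  have sw: "(x, y) \<in> prod.swap ` A \<longleftrightarrow> (y, x) \<in> A" for x y :: real and A by force
  have "closed (prod.swap -` F)"
    by (intro closed_vimage assms) (auto simp: prod.swap_def intro!: continuous_intros)
  moreover have "prod.swap ` F = prod.swap -` F" by force
  ultimately have cF: "closed (prod.swap ` F)" by simp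
  have cK: "compact (prod.swap ` K)"
    by (rule compact_continuous_image) (auto simp: prod.swap_def assms intro!: continuous_intros)
  have V: "vanish_near (jswap h) p" if "p \<in> prod.swap ` K" for p
    using that h(3) by (auto simp: vanish_near_jswap)
  have G: "\<exists>t. a < t \<and> t < b \<and> (s, t) \<notin> prod.swap ` F"
    if "a < b" "(s, a) \<in> prod.swap ` K" "(s, b) \<in> prod.swap ` K" "\<And>t. a < t \<Longrightarrow> t < b \<Longrightarrow> (s, t) \<notin> prod.swap ` K" for s a b
    using gap1[of a b s] that unfolding sw by blast
  obtain w where w: "smooth_jet w" 
    "\<And>p a b. p \<in> prod.swap ` F \<Longrightarrow> w a (Suc b) p = jswap h a b p"
    "\<And>p. p \<in> prod.swap ` K \<Longrightarrow> vanish_near w p"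
    using sweep[OF cK cF smooth_jet_jswap[OF h(1)] V G] by blast
  show thesis
  proof (rule that[of "jswap w"])
    show "smooth_jet (jswap w)" by (intro smooth_jet_jswap w)
    show "jswap w (Suc a) (Suc b) p = k a b p" if "p \<in> F" for p a b
      using w(2)[of "prod.swap p"] h(2)[OF that] that by (simp add: jswap_def prod.swap_def)
    show "flat_at (jswap w) p" if "p \<in> K" for p
      using w(3)[of "prod.swap p"] that by (auto simp: vanish_near_def flat_at_def jswap_def prod.swap_def)
  qed
qed

lemma abs_fst_le: "\<bar>fst (h :: real \<times> real)\<bar> \<le> norm h"
  and abs_snd_le: "\<bar>snd h\<bar> \<le> norm h"
  using norm_fst_le[of "fst h" "snd h"] norm_snd_le[of "snd h" "fst h"] by simp_all

section \<open>Taylor polynomials\<close>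

text \<open>The \<open>n\<close>-th derivative of \<open>(u - c) ^ i / fact i\<close>.\<close>

definition dpow :: "nat \<Rightarrow> real \<Rightarrow> nat \<Rightarrow> real \<Rightarrow> real" where
  "dpow i c n u = (if n \<le> i then (u - c) ^ (i - n) / fact (i - n) else 0)"

text \<open>The bound is strict: \<open>tpoly m\<close> has total degree below \<open>m\<close>, so
  the usual Taylor polynomial of order \<open>n\<close> is \<open>tpoly (Suc n)\<close>.
  Differentiation then lowers \<open>Suc m\<close> to \<open>m\<close> with no exceptional case,
  \<open>tpoly 0\<close> being zero.\<close>

definition tpoly :: "nat \<Rightarrow> planar_jet \<Rightarrow> real \<times> real \<Rightarrow> planar_jet" where
  "tpoly m f x = (\<lambda>a b y. \<Sum>i<m. \<Sum>j<m - i. f i j x * jprod (dpow i (fst x)) (dpow j (snd x)) a b y)"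

lemma smooth1_dpow: "smooth1 (dpow i c)"
  unfolding smooth1_def
proof (intro allI)
  fix n x
  consider "n < i" | "n = i" | "n > i" by linarith
  then show "(dpow i c n has_real_derivative dpow i c (Suc n) x) (at x)"
  proof cases
    case 1
    then obtain k where k: "i - n = Suc k" by (metis Suc_diff_Suc)
    then have e: "i - Suc n = k" by simp
    have "((\<lambda>u. (u - c) ^ Suc k / fact (Suc k)) has_real_derivative (real (Suc k) * (x - c) ^ k) / fact (Suc k)) (at x)"
      by (rule DERIV_cdivide, rule DERIV_cong[OF DERIV_power_Suc[of "\<lambda>u. u - c" 1]])
         (auto intro!: derivative_eq_intros)
    then show ?thesis using 1 by (simp add: dpow_def[abs_def] k e fact_Suc del: power_Suc of_nat_Suc)
  qed (auto simp: dpow_def[abs_def])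
qed

lemma smooth_jet_cmult: "smooth_jet J \<Longrightarrow> smooth_jet (\<lambda>a b p. c * J a b p)"
  unfolding smooth_jet_def[of "\<lambda>a b p. c * J a b p"]
  by (intro allI, rule has_derivative_eq_rhs[OF has_derivative_mult_right[OF smooth_jetD]])
     (auto simp: algebra_simps)

lemma smooth_jet_tpoly: "smooth_jet (tpoly m f x)"
  unfolding tpoly_def by (intro smooth_jet_sum smooth_jet_cmult smooth_jet_jprod smooth1_dpow)

lemma dpow_Suc: "dpow (Suc i) c (Suc n) u = dpow i c n u" "dpow 0 c (Suc n) u = 0"
  by (simp_all add: dpow_def)

lemma tpoly_Suc1: "tpoly (Suc m) f x (Suc a) b = tpoly m (d1 f) x a b"
  by (intro ext) (simp add: tpoly_def sum.lessThan_Suc_shift jprod_def dpow_Suc d1_def del: sum.lessThan_Suc)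

lemma tpoly_Suc2: "tpoly (Suc m) f x a (Suc b) = tpoly m (d2 f) x a b"
proof (intro ext)
  fix y
  have "(\<Sum>j<Suc m - i. f i j x * jprod (dpow i (fst x)) (dpow j (snd x)) a (Suc b) y)
     = (\<Sum>j<m - i. f i (Suc j) x * jprod (dpow i (fst x)) (dpow j (snd x)) a b y)" if "i \<le> m" for i
    using that by (simp add: Suc_diff_le sum.lessThan_Suc_shift jprod_def dpow_Suc del: sum.lessThan_Suc)
  then have "tpoly (Suc m) f x a (Suc b) y
     = (\<Sum>i<Suc m. \<Sum>j<m - i. f i (Suc j) x * jprod (dpow i (fst x)) (dpow j (snd x)) a b y)"
    unfolding tpoly_def by (intro sum.cong[OF refl]) simp
  then show "tpoly (Suc m) f x a (Suc b) y = tpoly m (d2 f) x a b y"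
    by (simp add: tpoly_def d2_def)
qed

lemma tpoly_zero: "m \<le> a + b \<Longrightarrow> tpoly m f x a b y = 0"
proof (induction m arbitrary: f a b)
  case (Suc m)
  show ?case
  proof (cases a)
    case 0
    then obtain b' where "b = Suc b'" using Suc.prems by (cases b) auto
    then show ?thesis using Suc 0 by (simp add: tpoly_Suc2)
  next
    case (Suc a')
    then show ?thesis using Suc.IH Suc.prems by (simp add: tpoly_Suc1)
  qed
qed (simp add: tpoly_def)

text \<open>Reduces estimates for derivatives of Taylor polynomials to estimates for their
  values.\<close>

lemma tpoly_shift: "a + b \<le> m \<Longrightarrow> tpoly m f x a b = tpoly (m - (a + b)) (\<lambda>i j. f (a + i) (b + j)) x 0 0"
proof (induction m arbitrary: f a b)
  case (Suc m)
  show ?case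
  proof (cases a)
    case 0
    show ?thesis
    proof (cases b)
      case (Suc b')
      then show ?thesis using Suc.IH[of 0 b' "d2 f"] Suc.prems 0 by (simp add: tpoly_Suc2 d2_def)
    qed (use 0 in simp)
  next
    case (Suc a')
    then show ?thesis using Suc.IH[of a' b "d1 f"] Suc.prems by (simp add: tpoly_Suc1 d1_def)
  qed
qed simp

lemma tpoly_base: "tpoly m f x a b x = (if a + b < m then f a b x else 0)"
proof (cases "a + b < m")
  case True
  then obtain n where n: "m - (a + b) = Suc n" by (metis Suc_diff_Suc)
  have "tpoly (Suc n) f x 0 0 x = f 0 0 x" for f
  proof -
    have "f i j x * jprod (dpow i (fst x)) (dpow j (snd x)) 0 0 x = (if j = 0 then if i = 0 then f 0 0 x else 0 else 0)" for i j
      by (simp add: jprod_def dpow_def)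
    then have inner: "(\<Sum>j<Suc n - i. f i j x * jprod (dpow i (fst x)) (dpow j (snd x)) 0 0 x) = (if i = 0 then f 0 0 x else 0)" if "i \<le> n" for i
      using that by (simp add: Suc_diff_le del: sum.lessThan_Suc)
    have "tpoly (Suc n) f x 0 0 x = (\<Sum>i<Suc n. if i = 0 then f 0 0 x else 0)"
      unfolding tpoly_def by (rule sum.cong[OF refl]) (rule inner, simp)
    then show ?thesis by (simp del: sum.lessThan_Suc)
  qed
  then show ?thesis using True n tpoly_shift[of a b m f x] by simp
qed (simp add: tpoly_zero)

lemma tpoly_jsub: "tpoly m (jsub f g) x a b y = tpoly m f x a b y - tpoly m g x a b y"
  by (simp add: tpoly_def jsub_def left_diff_distrib sum_subtractf)

lemma tpoly_cong: "(\<And>a b. a + b < m \<Longrightarrow> f a b x = g a b x) \<Longrightarrow> tpoly m f x = tpoly m g x"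
  unfolding tpoly_def by (intro ext sum.cong arg_cong2[where f = times]) auto

lemma norm_tpoly_le:
  assumes "\<And>i j. i + j < m \<Longrightarrow> cmod (f i j x) * \<rho> ^ (i + j) \<le> C" and "norm (y - x) \<le> \<rho>" and "0 \<le> C"
  shows "cmod (tpoly m f x 0 0 y) \<le> real m ^ 2 * C"
proof -
  have p: "\<bar>dpow i (fst x) 0 u\<bar> \<le> \<rho> ^ i" if "\<bar>u - fst x\<bar> \<le> \<rho>" for i u and x :: "real \<times> real"
  proof -
    have "\<bar>dpow i (fst x) 0 u\<bar> = \<bar>u - fst x\<bar> ^ i / fact i" by (simp add: dpow_def power_abs)
    also have "\<dots> \<le> \<bar>u - fst x\<bar> ^ i / 1"
      by (intro divide_left_mono) (auto simp: fact_ge_1)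
    also have "\<dots> \<le> \<rho> ^ i" using that by (simp add: power_mono)
    finally show ?thesis .
  qed
  have r: "\<bar>fst y - fst x\<bar> \<le> \<rho>" "\<bar>snd y - snd x\<bar> \<le> \<rho>"
    using abs_fst_le[of "y - x"] abs_snd_le[of "y - x"] assms(2) by auto
  have t: "cmod (f i j x * jprod (dpow i (fst x)) (dpow j (snd x)) 0 0 y) \<le> C" if "i + j < m" for i j
  proof -
    have "\<bar>dpow i (fst x) 0 (fst y) * dpow j (snd x) 0 (snd y)\<bar> \<le> \<rho> ^ i * \<rho> ^ j"
      unfolding abs_mult using p[of "fst y" x i] p[of "snd y" "(snd x, 0)" j] r
      by (intro mult_mono) auto
    then have "cmod (f i j x) * \<bar>dpow i (fst x) 0 (fst y) * dpow j (snd x) 0 (snd y)\<bar> \<le> cmod (f i j x) * \<rho> ^ (i + j)"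
      by (intro mult_left_mono) (auto simp: power_add)
    then show ?thesis using assms(1)[OF that]
      by (simp add: norm_mult jprod_def abs_mult)
  qed
  have "cmod (tpoly m f x 0 0 y) \<le> (\<Sum>i<m. \<Sum>j<m - i. C)"
    unfolding tpoly_def by (intro sum_norm_le order.trans[OF norm_sum] sum_mono t) auto
  also have "\<dots> \<le> (\<Sum>i<m. real m * C)"
    using assms(3) by (intro sum_mono) (auto intro!: mult_right_mono)
  also have "\<dots> = real m ^ 2 * C" by (simp add: power2_eq_square)
  finally show ?thesis .
qed

text \<open>The partial derivatives of the remainder are the remainders, one order lower, of the
  partial derivatives. The remainder vanishes at \<open>x\<close>, so the mean value inequality
  along the segment raises the order by one; the factor 2 comes from adding the two partial
  derivatives.\<close>

lemma taylor_remainder_0: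
  assumes "smooth_jet A" and "\<And>a b p. a + b = m \<Longrightarrow> p \<in> closed_segment x y \<Longrightarrow> cmod (A a b p) \<le> M"
  shows "cmod (A 0 0 y - tpoly m A x 0 0 y) \<le> M * (2 * norm (y - x)) ^ m"
  using assms
proof (induction m arbitrary: A y)
  case 0
  then show ?case by (auto simp: tpoly_def)
next
  case (Suc m)
  define D where "D = jsub A (tpoly (Suc m) A x)"
  have D: "smooth_jet D" unfolding D_def by (intro smooth_jet_jsub Suc.prems smooth_jet_tpoly)
  have "0 \<le> cmod (A (Suc m) 0 x)" by simp
  also have "\<dots> \<le> M" by (intro Suc.prems) auto
  finally have M: "0 \<le> M" .
  define B where "B = M * (2 * norm (y - x)) ^ m"
  have seg: "norm (p - x) \<le> norm (y - x)" "closed_segment x p \<subseteq> closed_segment x y" if "p \<in> closed_segment x y" for p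
    using that segment_bound1[of p x y] by (auto simp: closed_segment_subset norm_minus_commute)
  have b: "cmod (D 1 0 p) \<le> B" "cmod (D 0 1 p) \<le> B" if p: "p \<in> closed_segment x y" for p
  proof -
    have le: "M * (2 * norm (p - x)) ^ m \<le> B"
      unfolding B_def using seg(1)[OF p] M by (intro mult_left_mono power_mono) auto
    have "cmod (d1 A 0 0 p - tpoly m (d1 A) x 0 0 p) \<le> M * (2 * norm (p - x)) ^ m"
      by (rule Suc.IH[OF smooth_jet_d1[OF Suc.prems(1)]]) (use seg(2)[OF p] Suc.prems(2) in \<open>auto simp: d1_def\<close>)
    with le show "cmod (D 1 0 p) \<le> B" by (simp add: D_def jsub_def tpoly_Suc1) (simp add: d1_def)
    have "cmod (d2 A 0 0 p - tpoly m (d2 A) x 0 0 p) \<le> M * (2 * norm (p - x)) ^ m"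
      by (rule Suc.IH[OF smooth_jet_d2[OF Suc.prems(1)]]) (use seg(2)[OF p] Suc.prems(2) in \<open>auto simp: d2_def\<close>)
    with le show "cmod (D 0 1 p) \<le> B" by (simp add: D_def jsub_def tpoly_Suc2) (simp add: d2_def)
  qed
  have "norm (D 0 0 y - D 0 0 x) \<le> (2 * B) * norm (y - x)"
  proof (rule differentiable_bound[of "closed_segment x y"])
    fix p assume p: "p \<in> closed_segment x y"
    show "(D 0 0 has_derivative (\<lambda>h. fst h *\<^sub>R D (Suc 0) 0 p + snd h *\<^sub>R D 0 (Suc 0) p)) (at p within closed_segment x y)"
      by (rule has_derivative_at_withinI[OF smooth_jetD[OF D]])
    show "onorm (\<lambda>h. fst h *\<^sub>R D (Suc 0) 0 p + snd h *\<^sub>R D 0 (Suc 0) p) \<le> 2 * B"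
    proof (rule onorm_le)
      fix h :: "real \<times> real"
      have "cmod (fst h *\<^sub>R D (Suc 0) 0 p + snd h *\<^sub>R D 0 (Suc 0) p) \<le> \<bar>fst h\<bar> * cmod (D 1 0 p) + \<bar>snd h\<bar> * cmod (D 0 1 p)"
        by (rule order.trans[OF norm_triangle_ineq]) simp
      also have "\<dots> \<le> norm h * B + norm h * B"
        using abs_fst_le[of h] abs_snd_le[of h] b[OF p] by (intro add_mono mult_mono) auto
      finally show "cmod (fst h *\<^sub>R D (Suc 0) 0 p + snd h *\<^sub>R D 0 (Suc 0) p) \<le> 2 * B * norm h" by (simp add: algebra_simps)
    qed
  qed auto
  moreover have "D 0 0 x = 0" by (simp add: D_def jsub_def tpoly_base)
  ultimately show ?case
    by (simp add: D_def jsub_def B_def mult.commute mult.left_commute)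
qed

lemma taylor_remainder:
  assumes "smooth_jet A" and "a + b \<le> m" 
    and "\<And>i j p. i + j = m \<Longrightarrow> p \<in> closed_segment x y \<Longrightarrow> cmod (A i j p) \<le> M"
  shows "cmod (A a b y - tpoly m A x a b y) \<le> M * (2 * norm (y - x)) ^ (m - (a + b))"
proof -
  define A' where "A' = (\<lambda>i j. A (a + i) (b + j))"
  have "smooth_jet A'" using assms(1) by (simp add: smooth_jet_def A'_def)
  then have "cmod (A' 0 0 y - tpoly (m - (a + b)) A' x 0 0 y) \<le> M * (2 * norm (y - x)) ^ (m - (a + b))"
    by (rule taylor_remainder_0) (use assms in \<open>auto simp: A'_def\<close>)
  then show ?thesis using tpoly_shift[OF assms(2), of A x] by (simp add: A'_def)
qed

text \<open>A polynomial of degree below \<open>m\<close> has no derivatives of order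
  \<open>m\<close>, so Taylor's formula holds with remainder bound 0 at any centre.\<close>

lemma tpoly_tpoly: "tpoly m (tpoly m f z) x a b y = tpoly m f z a b y"
proof (cases "a + b \<le> m")
  case True
  have "cmod (tpoly m f z a b y - tpoly m (tpoly m f z) x a b y) \<le> 0 * (2 * norm (y - x)) ^ (m - (a + b))"
    by (rule taylor_remainder[OF smooth_jet_tpoly True]) (simp add: tpoly_zero)
  then show ?thesis by simp
qed (simp add: tpoly_zero)

text \<open>After recentring the polynomial at \<open>z\<close> to \<open>x\<close>, the difference
  is the Taylor polynomial at \<open>x\<close> of the Whitney remainder, and the hypothesis bounds
  its coefficients.\<close>

lemma tpoly_recentre:
  assumes "\<And>a b. a + b < m \<Longrightarrow> cmod (f a b x - tpoly m f z a b x) \<le> \<rho> ^ (m - 1 - (a + b))"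
    and y: "norm (y - x) \<le> \<rho>" and ab: "a + b < m" and \<rho>: "0 \<le> \<rho>"
  shows "cmod (tpoly m f x a b y - tpoly m f z a b y) \<le> real m ^ 2 * \<rho> ^ (m - 1 - (a + b))"
proof -
  define e where "e = jsub f (tpoly m f z)"
  have "tpoly m f x a b y - tpoly m f z a b y = tpoly m e x a b y"
    by (simp add: e_def tpoly_jsub tpoly_tpoly)
  also have "\<dots> = tpoly (m - (a + b)) (\<lambda>i j. e (a + i) (b + j)) x 0 0 y"
    using ab tpoly_shift[of a b m e x] by simp
  also have "cmod \<dots> \<le> real (m - (a + b)) ^ 2 * \<rho> ^ (m - 1 - (a + b))"
  proof (rule norm_tpoly_le[OF _ y])
    fix i j assume ij: "i + j < m - (a + b)"
    then have "cmod (e (a + i) (b + j) x) * \<rho> ^ (i + j) \<le> \<rho> ^ (m - 1 - (a + i + (b + j))) * \<rho> ^ (i + j)"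
      unfolding e_def jsub_def using \<rho> by (intro mult_right_mono assms(1)) auto
    also have "\<dots> = \<rho> ^ (m - 1 - (a + b))"
      using ij by (subst power_add[symmetric]) (rule arg_cong[where f = "\<lambda>n. \<rho> ^ n"], simp)
    finally show "cmod (e (a + i) (b + j) x) * \<rho> ^ (i + j) \<le> \<rho> ^ (m - 1 - (a + b))" .
  qed (use \<rho> in simp)
  also have "\<dots> \<le> real m ^ 2 * \<rho> ^ (m - 1 - (a + b))"
    using \<rho> by (intro mult_right_mono power_mono) auto
  finally show ?thesis .
qed

section \<open>Characteristic coordinates\<close>

text \<open>
  With \<open>x\<^sub>1 = s + t\<close> and \<open>x\<^sub>2 = s - t\<close> one has \<open>\<partial>\<^sub>1\<^sup>2 - \<partial>\<^sub>2\<^sup>2 = \<partial>\<^sub>s \<partial>\<^sub>t\<close>. The operators \<open>char_d1\<close>, \<open>char_d2\<close>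
  are \<open>\<partial>\<^sub>1\<close>, \<open>\<partial>\<^sub>2\<close> acting on jets in \<open>(s, t)\<close>, and \<open>plane_ds\<close>, \<open>plane_dt\<close> are \<open>\<partial>\<^sub>s\<close>, \<open>\<partial>\<^sub>t\<close> acting on jets
  in \<open>(x\<^sub>1, x\<^sub>2)\<close>.
\<close>

definition from_char :: "real \<times> real \<Rightarrow> real \<times> real" where "from_char p = (fst p + snd p, fst p - snd p)"
definition to_char :: "real \<times> real \<Rightarrow> real \<times> real" where "to_char x = ((fst x + snd x) / 2, (fst x - snd x) / 2)"

lemma from_char_to_char [simp]: "from_char (to_char x) = x" and to_char_from_char [simp]: "to_char (from_char p) = p"
  by (simp_all add: from_char_def to_char_def prod_eq_iff add_divide_distrib diff_divide_distrib)

definition char_d1 :: "planar_jet \<Rightarrow> planar_jet" where "char_d1 J = (\<lambda>a b p. (J (Suc a) b p + J a (Suc b) p) / 2)"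
definition char_d2 :: "planar_jet \<Rightarrow> planar_jet" where "char_d2 J = (\<lambda>a b p. (J (Suc a) b p - J a (Suc b) p) / 2)"
definition plane_ds :: "planar_jet \<Rightarrow> planar_jet" where "plane_ds A = (\<lambda>a b p. A (Suc a) b p + A a (Suc b) p)"
definition plane_dt :: "planar_jet \<Rightarrow> planar_jet" where "plane_dt A = (\<lambda>a b p. A (Suc a) b p - A a (Suc b) p)"

text \<open>Higher derivatives are transported by iterating the transformed first-order operators
  and evaluating at order 0, so that the chain rule is needed for first derivatives only.\<close>

definition jet_from_char :: "planar_jet \<Rightarrow> planar_jet" where "jet_from_char J = (\<lambda>a b x. (char_d1 ^^ a) ((char_d2 ^^ b) J) 0 0 (to_char x))"
definition jet_to_char :: "planar_jet \<Rightarrow> planar_jet" where "jet_to_char A = (\<lambda>a b p. (plane_ds ^^ a) ((plane_dt ^^ b) A) 0 0 (from_char p))"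

lemma funpow_commute: "(\<And>x. f (g x) = g (f x)) \<Longrightarrow> (f ^^ n) (g x) = g ((f ^^ n) x)"
  by (induction n) auto

lemma funpow_commute': "(\<And>x. f (g x) = g (f x)) \<Longrightarrow> f ((g ^^ n) x) = (g ^^ n) (f x)"
  by (induction n) auto

lemma char_d1_char_d2: "char_d1 (char_d2 J) = char_d2 (char_d1 J)" by (simp add: char_d1_def char_d2_def fun_eq_iff field_simps)
lemma plane_ds_plane_dt: "plane_ds (plane_dt J) = plane_dt (plane_ds J)" by (simp add: plane_ds_def plane_dt_def fun_eq_iff)

lemma char_d_commute: "char_d1 (d1 J) = d1 (char_d1 J)" "char_d1 (d2 J) = d2 (char_d1 J)" "char_d2 (d1 J) = d1 (char_d2 J)" "char_d2 (d2 J) = d2 (char_d2 J)"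
  by (simp_all add: char_d1_def char_d2_def d1_def d2_def)

lemma plane_d_commute: "plane_ds (d1 J) = d1 (plane_ds J)" "plane_ds (d2 J) = d2 (plane_ds J)" "plane_dt (d1 J) = d1 (plane_dt J)" "plane_dt (d2 J) = d2 (plane_dt J)"
  by (simp_all add: plane_ds_def plane_dt_def d1_def d2_def)

lemma smooth_char_d1: assumes "smooth_jet J" shows "smooth_jet (char_d1 J)"
  using smooth_jet_cmult[OF smooth_jet_jadd[OF smooth_jet_d1[OF assms] smooth_jet_d2[OF assms]], of "1/2"]
  by (simp add: char_d1_def d1_def d2_def jadd_def)

lemma smooth_char_d2: assumes "smooth_jet J" shows "smooth_jet (char_d2 J)"
  using smooth_jet_cmult[OF smooth_jet_jsub[OF smooth_jet_d1[OF assms] smooth_jet_d2[OF assms]], of "1/2"]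
  by (simp add: char_d2_def d1_def d2_def jsub_def)

lemma smooth_plane_ds: assumes "smooth_jet J" shows "smooth_jet (plane_ds J)"
  using smooth_jet_jadd[OF smooth_jet_d1[OF assms] smooth_jet_d2[OF assms]]
  by (simp add: plane_ds_def d1_def d2_def jadd_def)

lemma smooth_plane_dt: assumes "smooth_jet J" shows "smooth_jet (plane_dt J)"
  using smooth_jet_jsub[OF smooth_jet_d1[OF assms] smooth_jet_d2[OF assms]]
  by (simp add: plane_dt_def d1_def d2_def jsub_def)

lemma smooth_funpow: "(\<And>J. smooth_jet J \<Longrightarrow> smooth_jet (f J)) \<Longrightarrow> smooth_jet J \<Longrightarrow> smooth_jet ((f ^^ n) J)"
  by (induction n) auto

lemma smooth_jet_jet_from_char:
  assumes J: "smooth_jet J" shows "smooth_jet (jet_from_char J)"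
  unfolding smooth_jet_def
proof (intro allI)
  fix a b and x :: "real \<times> real"
  define L where "L = (char_d1 ^^ a) ((char_d2 ^^ b) J)"
  have L: "smooth_jet L" unfolding L_def by (intro smooth_funpow smooth_char_d1 smooth_char_d2 J)
  have S: "(to_char has_derivative to_char) (at x)"
    unfolding to_char_def[abs_def] by (auto intro!: derivative_eq_intros)
  have 1: "jet_from_char J (Suc a) b x = char_d1 L 0 0 (to_char x)" by (simp add: jet_from_char_def L_def)
  have "char_d2 L = (char_d1 ^^ a) ((char_d2 ^^ Suc b) J)"
    unfolding L_def by (simp add: funpow_commute'[of char_d2 char_d1] char_d1_char_d2)
  then have 2: "jet_from_char J a (Suc b) x = char_d2 L 0 0 (to_char x)" by (simp add: jet_from_char_def)
  have "((\<lambda>x. L 0 0 (to_char x)) has_derivative (\<lambda>h. fst (to_char h) *\<^sub>R L (Suc 0) 0 (to_char x) + snd (to_char h) *\<^sub>R L 0 (Suc 0) (to_char x))) (at x)"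
    by (rule has_derivative_compose[OF S smooth_jetD[OF L]])
  moreover have "jet_from_char J a b = (\<lambda>x. L 0 0 (to_char x))" by (simp add: jet_from_char_def L_def)
  ultimately show "(jet_from_char J a b has_derivative (\<lambda>h. fst h *\<^sub>R jet_from_char J (Suc a) b x + snd h *\<^sub>R jet_from_char J a (Suc b) x)) (at x)"
    by (simp add: 1 2 char_d1_def char_d2_def to_char_def scaleR_conv_of_real algebra_simps add_divide_distrib diff_divide_distrib)
qed

lemma smooth_jet_jet_to_char:
  assumes J: "smooth_jet J" shows "smooth_jet (jet_to_char J)"
  unfolding smooth_jet_def
proof (intro allI)
  fix a b and x :: "real \<times> real"
  define L where "L = (plane_ds ^^ a) ((plane_dt ^^ b) J)"
  have L: "smooth_jet L" unfolding L_def by (intro smooth_funpow smooth_plane_ds smooth_plane_dt J)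
  have S: "(from_char has_derivative from_char) (at x)"
    unfolding from_char_def[abs_def] by (auto intro!: derivative_eq_intros)
  have 1: "jet_to_char J (Suc a) b x = plane_ds L 0 0 (from_char x)" by (simp add: jet_to_char_def L_def)
  have "plane_dt L = (plane_ds ^^ a) ((plane_dt ^^ Suc b) J)"
    unfolding L_def by (simp add: funpow_commute'[of plane_dt plane_ds] plane_ds_plane_dt)
  then have 2: "jet_to_char J a (Suc b) x = plane_dt L 0 0 (from_char x)" by (simp add: jet_to_char_def)
  have "((\<lambda>x. L 0 0 (from_char x)) has_derivative (\<lambda>h. fst (from_char h) *\<^sub>R L (Suc 0) 0 (from_char x) + snd (from_char h) *\<^sub>R L 0 (Suc 0) (from_char x))) (at x)"
    by (rule has_derivative_compose[OF S smooth_jetD[OF L]])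
  moreover have "jet_to_char J a b = (\<lambda>x. L 0 0 (from_char x))" by (simp add: jet_to_char_def L_def)
  ultimately show "(jet_to_char J a b has_derivative (\<lambda>h. fst h *\<^sub>R jet_to_char J (Suc a) b x + snd h *\<^sub>R jet_to_char J a (Suc b) x)) (at x)"
    by (simp add: 1 2 plane_ds_def plane_dt_def from_char_def scaleR_conv_of_real algebra_simps)
qed

text \<open>\<open>char_d1\<close> and \<open>char_d2\<close> are averages of two derivatives up to
  sign, so no constant arises. In the opposite direction sums without the factor 1/2 appear, and
  every order costs a factor 2.\<close>

lemma norm_jet_from_char_le:
  assumes "\<And>i j. i + j = a + b \<Longrightarrow> cmod (J i j (to_char x)) \<le> B"
  shows "cmod (jet_from_char J a b x) \<le> B"
proof -
  define p where "p = to_char x"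
  have s1: "cmod ((z + w) / 2) \<le> B" and s2: "cmod ((z - w) / 2) \<le> B" if "cmod z \<le> B" "cmod w \<le> B" for z w B
    using norm_triangle_ineq[of z w] norm_triangle_ineq4[of z w] that by (auto simp: norm_divide)
  have 2: "cmod ((char_d2 ^^ b) J i j p) \<le> B" if "i + j = a" for i j
    using assms that unfolding p_def[symmetric]
  proof (induction b arbitrary: i j a)
    case (Suc b)
    have "cmod ((char_d2 ^^ b) J (Suc i) j p) \<le> B" "cmod ((char_d2 ^^ b) J i (Suc j) p) \<le> B"
      using Suc.IH[of "Suc a"] Suc.prems by auto
    moreover have e: "(char_d2 ^^ Suc b) J i j p = ((char_d2 ^^ b) J (Suc i) j p - (char_d2 ^^ b) J i (Suc j) p) / 2"
      by (simp add: char_d2_def)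
    ultimately show ?case unfolding e by (intro s2)
  qed auto
  have "cmod ((char_d1 ^^ a') ((char_d2 ^^ b) J) i j p) \<le> B" if "i + j + a' = a" for i j a'
    using that
  proof (induction a' arbitrary: i j)
    case (Suc a')
    have "cmod ((char_d1 ^^ a') ((char_d2 ^^ b) J) (Suc i) j p) \<le> B" "cmod ((char_d1 ^^ a') ((char_d2 ^^ b) J) i (Suc j) p) \<le> B"
      using Suc.IH Suc.prems by auto
    moreover have e: "(char_d1 ^^ Suc a') ((char_d2 ^^ b) J) i j p
       = ((char_d1 ^^ a') ((char_d2 ^^ b) J) (Suc i) j p + (char_d1 ^^ a') ((char_d2 ^^ b) J) i (Suc j) p) / 2"
      by (simp add: char_d1_def)
    ultimately show ?case unfolding e by (intro s1)
  qed (use 2 in auto)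
  from this[of 0 0 a] show ?thesis by (simp add: jet_from_char_def p_def)
qed

lemma norm_jet_to_char_le:
  assumes "\<And>i j. i + j = a + b \<Longrightarrow> cmod (A i j (from_char p)) \<le> B"
  shows "cmod (jet_to_char A a b p) \<le> 2 ^ (a + b) * B"
proof -
  define x where "x = from_char p"
  have s1: "cmod (z + w) \<le> 2 * B" and s2: "cmod (z - w) \<le> 2 * B" if "cmod z \<le> B" "cmod w \<le> B" for z w B
    using norm_triangle_ineq[of z w] norm_triangle_ineq4[of z w] that by auto
  have 2: "cmod ((plane_dt ^^ b) A i j x) \<le> 2 ^ b * B" if "i + j = a" for i j
    using assms that unfolding x_def[symmetric]
  proof (induction b arbitrary: i j a)
    case (Suc b)
    have "cmod ((plane_dt ^^ b) A (Suc i) j x) \<le> 2 ^ b * B" "cmod ((plane_dt ^^ b) A i (Suc j) x) \<le> 2 ^ b * B"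
      using Suc.IH[of "Suc a"] Suc.prems by auto
    moreover have e: "(plane_dt ^^ Suc b) A i j x = (plane_dt ^^ b) A (Suc i) j x - (plane_dt ^^ b) A i (Suc j) x"
      by (simp add: plane_dt_def)
    ultimately show ?case unfolding e using s2 by (simp add: mult.assoc)
  qed auto
  have "cmod ((plane_ds ^^ a') ((plane_dt ^^ b) A) i j x) \<le> 2 ^ (a' + b) * B" if "i + j + a' = a" for i j a'
    using that
  proof (induction a' arbitrary: i j)
    case (Suc a')
    have "cmod ((plane_ds ^^ a') ((plane_dt ^^ b) A) (Suc i) j x) \<le> 2 ^ (a' + b) * B" "cmod ((plane_ds ^^ a') ((plane_dt ^^ b) A) i (Suc j) x) \<le> 2 ^ (a' + b) * B"
      using Suc.IH Suc.prems by auto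
    moreover have e: "(plane_ds ^^ Suc a') ((plane_dt ^^ b) A) i j x
       = (plane_ds ^^ a') ((plane_dt ^^ b) A) (Suc i) j x + (plane_ds ^^ a') ((plane_dt ^^ b) A) i (Suc j) x"
      by (simp add: plane_ds_def)
    ultimately show ?case unfolding e using s1 by (simp add: mult.assoc)
  qed (use 2 in auto)
  from this[of 0 0 a] show ?thesis by (simp add: jet_to_char_def x_def)
qed

lemma jet_from_char_jsub: "jet_from_char (jsub J K) = jsub (jet_from_char J) (jet_from_char K)"
proof -
  have "char_d1 (jsub J K) = jsub (char_d1 J) (char_d1 K)" "char_d2 (jsub J K) = jsub (char_d2 J) (char_d2 K)" for J K
    by (simp_all add: char_d1_def char_d2_def jsub_def fun_eq_iff field_simps)
  then have *: "(char_d2 ^^ b) (jsub J K) = jsub ((char_d2 ^^ b) J) ((char_d2 ^^ b) K)" "(char_d1 ^^ b) (jsub J K) = jsub ((char_d1 ^^ b) J) ((char_d1 ^^ b) K)" for b J K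
    by (induction b) auto
  then show ?thesis unfolding jet_from_char_def * by (simp add: jsub_def)
qed

lemma jet_to_char_jsub: "jet_to_char (jsub J K) = jsub (jet_to_char J) (jet_to_char K)"
proof -
  have "plane_ds (jsub J K) = jsub (plane_ds J) (plane_ds K)" "plane_dt (jsub J K) = jsub (plane_dt J) (plane_dt K)" for J K
    by (simp_all add: plane_ds_def plane_dt_def jsub_def fun_eq_iff)
  then have *: "(plane_dt ^^ b) (jsub J K) = jsub ((plane_dt ^^ b) J) ((plane_dt ^^ b) K)" "(plane_ds ^^ b) (jsub J K) = jsub ((plane_ds ^^ b) J) ((plane_ds ^^ b) K)" for b J K
    by (induction b) auto
  then show ?thesis unfolding jet_to_char_def * by (simp add: jsub_def)
qed

lemma char_d1_jet_to_char: "char_d1 (jet_to_char A) = jet_to_char (d1 A)" and char_d2_jet_to_char: "char_d2 (jet_to_char A) = jet_to_char (d2 A)"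
proof -
  have "char_d1 (jet_to_char A) a b p = jet_to_char (d1 A) a b p \<and> char_d2 (jet_to_char A) a b p = jet_to_char (d2 A) a b p" for a b p
  proof -
    define U where "U = (plane_ds ^^ a) ((plane_dt ^^ b) A)"
    have "plane_dt U = (plane_ds ^^ a) ((plane_dt ^^ Suc b) A)"
      unfolding U_def by (simp add: funpow_commute'[of plane_dt plane_ds] plane_ds_plane_dt)
    then have t: "jet_to_char A a (Suc b) p = plane_dt U 0 0 (from_char p)" by (simp add: jet_to_char_def)
    have s: "jet_to_char A (Suc a) b p = plane_ds U 0 0 (from_char p)" by (simp add: jet_to_char_def U_def)
    have "d1 U = (plane_ds ^^ a) ((plane_dt ^^ b) (d1 A))" "d2 U = (plane_ds ^^ a) ((plane_dt ^^ b) (d2 A))"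
      unfolding U_def by (simp_all add: funpow_commute[of _ d1] funpow_commute[of _ d2] plane_d_commute)
    then have "jet_to_char (d1 A) a b p = d1 U 0 0 (from_char p)" "jet_to_char (d2 A) a b p = d2 U 0 0 (from_char p)"
      by (simp_all add: jet_to_char_def)
    then show ?thesis by (simp add: char_d1_def char_d2_def s t) (simp add: plane_ds_def plane_dt_def d1_def d2_def)
  qed
  then show "char_d1 (jet_to_char A) = jet_to_char (d1 A)" "char_d2 (jet_to_char A) = jet_to_char (d2 A)" by (simp_all add: fun_eq_iff)
qed

lemma jet_from_char_jet_to_char [simp]: "jet_from_char (jet_to_char A) = A"
proof (intro ext)
  fix a b x
  have "(char_d2 ^^ b) (jet_to_char A) = jet_to_char ((d2 ^^ b) A)" for b A by (induction b) (auto simp: char_d2_jet_to_char)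
  moreover have "(char_d1 ^^ b) (jet_to_char A) = jet_to_char ((d1 ^^ b) A)" for b A by (induction b) (auto simp: char_d1_jet_to_char)
  moreover have "(d1 ^^ a) A = (\<lambda>i. A (a + i))" for a and A :: planar_jet by (induction a) (auto simp: d1_def)
  moreover have "(d2 ^^ b) A = (\<lambda>i j. A i (b + j))" for b and A :: planar_jet by (induction b) (auto simp: d2_def)
  ultimately show "jet_from_char (jet_to_char A) a b x = A a b x" by (simp add: jet_from_char_def jet_to_char_def)
qed

text \<open>The square of half the sum of two commuting derivations minus the square of half their
  difference is their product.\<close>

lemma jet_from_char_wave:
  "jet_from_char J (Suc (Suc a)) b x - jet_from_char J a (Suc (Suc b)) x = jet_from_char (d1 (d2 J)) a b x"
proof -
  define U where "U = (char_d1 ^^ a) ((char_d2 ^^ b) J)"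
  have "char_d2 (char_d2 U) = (char_d1 ^^ a) ((char_d2 ^^ Suc (Suc b)) J)"
    unfolding U_def by (simp add: funpow_commute'[of char_d2 char_d1] char_d1_char_d2)
  then have "jet_from_char J a (Suc (Suc b)) x = char_d2 (char_d2 U) 0 0 (to_char x)" by (simp add: jet_from_char_def)
  moreover have "jet_from_char J (Suc (Suc a)) b x = char_d1 (char_d1 U) 0 0 (to_char x)" by (simp add: jet_from_char_def U_def)
  moreover have "d1 (d2 U) = (char_d1 ^^ a) ((char_d2 ^^ b) (d1 (d2 J)))"
    unfolding U_def by (simp add: funpow_commute[of _ d1] funpow_commute[of _ d2] char_d_commute)
  then have "jet_from_char (d1 (d2 J)) a b x = d1 (d2 U) 0 0 (to_char x)" by (simp add: jet_from_char_def)
  moreover have "char_d1 (char_d1 U) 0 0 q - char_d2 (char_d2 U) 0 0 q = d1 (d2 U) 0 0 q" for q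
    by (simp add: char_d1_def char_d2_def d1_def d2_def field_simps)
  ultimately show ?thesis by simp
qed

lemma jet_to_char_wave:
  assumes "\<And>a b. A (Suc (Suc a)) b (from_char p) = A a (Suc (Suc b)) (from_char p)"
  shows "jet_to_char A (Suc a) (Suc b) p = 0"
proof -
  \<comment> \<open>\<open>Q\<close> is the wave equation with all its derivatives at a single
    point; both characteristic derivations preserve it, so it may be used at order 0 after they have
    been iterated.\<close>
  define Q where "Q U \<longleftrightarrow> (\<forall>a b. U (Suc (Suc a)) b (from_char p) = U a (Suc (Suc b)) (from_char p))" for U :: planar_jet
  have Q: "Q U \<Longrightarrow> Q (plane_ds U)" "Q U \<Longrightarrow> Q (plane_dt U)" for U by (simp_all add: Q_def plane_ds_def plane_dt_def)
  define U where "U = (plane_ds ^^ a) ((plane_dt ^^ b) A)"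
  have "Q ((plane_dt ^^ b) A)" using assms by (induction b) (simp_all add: Q, simp add: Q_def)
  then have "Q U" unfolding U_def by (induction a) (auto simp: Q)
  have "plane_dt (plane_ds U) = plane_ds (plane_dt U)" by (simp add: plane_ds_plane_dt)
  also have "plane_dt U = (plane_ds ^^ a) ((plane_dt ^^ Suc b) A)"
    unfolding U_def by (simp add: funpow_commute'[of plane_dt plane_ds] plane_ds_plane_dt)
  finally have "plane_dt (plane_ds U) = (plane_ds ^^ Suc a) ((plane_dt ^^ Suc b) A)" by simp
  then have "jet_to_char A (Suc a) (Suc b) p = plane_dt (plane_ds U) 0 0 (from_char p)" by (simp add: jet_to_char_def)
  also have "\<dots> = 0" using \<open>Q U\<close>[unfolded Q_def, rule_format, of 0 0] by (simp add: plane_ds_def plane_dt_def)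
  finally show ?thesis .
qed

text \<open>Both second derivatives lower the Taylor order by exactly two, so truncation preserves
  the equation. Knowing it for the jet at the centre \<open>z\<close> gives it for the polynomial at
  every \<open>y\<close>.\<close>

lemma tpoly_wave:
  assumes "\<And>a b. f (Suc (Suc a)) b z = f a (Suc (Suc b)) z"
  shows "tpoly m f z (Suc (Suc a)) b y = tpoly m f z a (Suc (Suc b)) y"
proof (cases "m < 2")
  case False
  then obtain n where m: "m = Suc (Suc n)" by (metis add_2_eq_Suc le_add_diff_inverse not_less)
  have "tpoly n (d1 (d1 f)) z = tpoly n (d2 (d2 f)) z"
    by (rule tpoly_cong) (simp add: d1_def d2_def assms)
  then show ?thesis by (simp add: m tpoly_Suc1 tpoly_Suc2)
qed (simp add: tpoly_zero)

section \<open>Approximation of a Whitney jet at a fixed scale\<close>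

text \<open>The bump is the difference of a smooth step and its unit translate, so the sum over
  translates telescopes. The index \<open>i\<close> stands for the integer
  \<open>i - L\<close>.\<close>

lemma unit_bump:
  obtains \<phi> where "smooth1 \<phi>" "\<And>n x. 1 \<le> \<bar>x\<bar> \<Longrightarrow> \<phi> n x = 0"
    "\<And>L n x. \<bar>x\<bar> \<le> real L \<Longrightarrow> (\<Sum>i<2 * L + 1. \<phi> n (x + (real L - real i))) = unit1 n x"
proof -
  obtain \<sigma> where \<sigma>: "smooth1 \<sigma>" "\<And>n x. x \<le> 0 \<Longrightarrow> \<sigma> n x = 0" "\<And>n x. 1 \<le> x \<Longrightarrow> \<sigma> n x = unit1 n x"
    using smooth_step[of 0 1] by auto
  define \<phi> where "\<phi> n x = \<sigma> n (x + 1) - \<sigma> n x" for n x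
  show thesis
  proof (rule that[of \<phi>])
    show "smooth1 \<phi>"
      using smooth1_diff[OF smooth1_affine[OF \<sigma>(1), of 1 1] \<sigma>(1)] by (simp add: \<phi>_def[abs_def])
    show "\<phi> n x = 0" if "1 \<le> \<bar>x\<bar>" for n x
    proof (cases "x \<ge> 0")
      case True
      then show ?thesis using that \<sigma>(3)[of x n] \<sigma>(3)[of "x + 1" n] by (simp add: \<phi>_def unit1_def)
    next
      case False
      then show ?thesis using that \<sigma>(2)[of x n] \<sigma>(2)[of "x + 1" n] by (simp add: \<phi>_def)
    qed
    fix L n and x :: real
    assume x: "\<bar>x\<bar> \<le> real L"
    have "(\<Sum>i<2 * L + 1. \<phi> n (x + (real L - real i)))
      = (\<Sum>i<2 * L + 1. \<sigma> n (x + real L + 1 - real i) - \<sigma> n (x + real L + 1 - real (Suc i)))"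
      by (rule sum.cong) (auto simp: \<phi>_def algebra_simps)
    also have "\<dots> = \<sigma> n (x + real L + 1 - real 0) - \<sigma> n (x + real L + 1 - real (2 * L + 1))"
      by (rule sum_lessThan_telescope')
    also have "\<dots> = unit1 n x"
      using x \<sigma>(2)[of "x - real L" n] \<sigma>(3)[of "x + real L + 1" n] by (simp add: unit1_def)
    finally show "(\<Sum>i<2 * L + 1. \<phi> n (x + (real L - real i))) = unit1 n x" .
  qed
qed

lemma compact_support_bounded:
  assumes "smooth1 \<phi>" "\<And>n x. 1 \<le> \<bar>x\<bar> \<Longrightarrow> \<phi> n x = 0"
  obtains B where "B \<ge> 0" "\<And>n x. n \<le> N \<Longrightarrow> \<bar>\<phi> n x\<bar> \<le> B"
proof -
  have "\<exists>B. \<forall>x. \<bar>\<phi> n x\<bar> \<le> B" for n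
  proof -
    have "continuous_on {-1..1} (\<phi> n)"
      using assms(1) unfolding smooth1_def by (meson DERIV_continuous_on has_field_derivative_at_within)
    then have "bounded (\<phi> n ` {-1..1})"
      by (intro compact_imp_bounded compact_continuous_image) auto
    then obtain B where B: "B > 0" "\<And>x. x \<in> {-1..1} \<Longrightarrow> \<bar>\<phi> n x\<bar> \<le> B"
      by (auto simp: bounded_pos)
    have "\<bar>\<phi> n x\<bar> \<le> B" for x
      using B assms(2)[of x n] by (cases "x \<in> {-1..1}") auto
    then show ?thesis by blast
  qed
  then obtain B where B: "\<And>n x. \<bar>\<phi> n x\<bar> \<le> B n" by metis
  have B0: "B n \<ge> 0" for n using B[of n 0] by linarith
  show thesis
  proof (rule that[of "\<Sum>n\<le>N. B n"])
    show "\<bar>\<phi> n x\<bar> \<le> (\<Sum>n\<le>N. B n)" if "n \<le> N" for n x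
      using B[of n x] member_le_sum[of n "{..N}" B] B0 that by force
  qed (simp add: sum_nonneg B0)
qed

lemma norm_pair_le: "norm (p :: real \<times> real) \<le> \<bar>fst p\<bar> + \<bar>snd p\<bar>"
  using sqrt_sum_squares_le_sum_abs[of "fst p" "snd p"] by (simp add: norm_prod_def)

lemma norm_from_char_diff_le:
  assumes "\<bar>fst p - fst q\<bar> \<le> \<delta>" "\<bar>snd p - snd q\<bar> \<le> \<delta>"
  shows "norm (from_char p - from_char q) \<le> 4 * \<delta>"
  using norm_pair_le[of "from_char p - from_char q"] assms by (auto simp: from_char_def)

lemma norm_from_char_coords: "\<bar>fst p\<bar> \<le> norm (from_char p)" "\<bar>snd p\<bar> \<le> norm (from_char p)"
  using abs_fst_le[of "from_char p"] abs_snd_le[of "from_char p"] by (auto simp: from_char_def)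

text \<open>
  \<open>F\<close> glues, by a partition of unity subordinate to a grid of mesh \<open>\<delta>\<close>, Taylor polynomials of \<open>f\<close> at
  points of \<open>K\<close> near the grid points. These polynomials solve the wave equation, and two of them
  with centres at distance \<open>O(\<delta>)\<close> differ by \<open>O(\<delta>\<^sup>m)\<close> up to factors lost in derivatives. Hence the
  wave operator of \<open>F\<close> is small near \<open>K\<close>, where it coincides with its cut-off \<open>r\<close>. The order \<open>m\<close> is
  large enough to absorb the powers of \<open>1 / \<delta>\<close> from the derivatives of the bumps and from
  the crude count of all grid points.
\<close>

lemma wave_approx_scale:
  fixes Q :: nat and f :: planar_jet
  defines "N \<equiv> Q + 2" 
  defines "M \<equiv> Q + 3 + 2 * N"
  defines "m \<equiv> M + 3 + 3 * N"
  assumes "compact K" and wave: "\<And>z a b. z \<in> K \<Longrightarrow> f (Suc (Suc a)) b z = f a (Suc (Suc b)) z"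
    and \<rho>0: "\<rho>0 > 0" and W: "\<And>x z a b. x \<in> K \<Longrightarrow> z \<in> K \<Longrightarrow> norm (x - z) \<le> \<rho>0 \<Longrightarrow> a + b < m \<Longrightarrow>
       cmod (f a b x - tpoly m f z a b x) \<le> norm (x - z) ^ (m - 1 - (a + b))"
  obtains C \<delta>0 where "C \<ge> 0" "\<delta>0 > 0"
    "\<And>\<delta>. 0 < \<delta> \<Longrightarrow> \<delta> < \<delta>0 \<Longrightarrow> \<exists>F r. smooth_jet F \<and> smooth_jet r \<and>
       (\<forall>z\<in>K. \<forall>y a b. norm (y - z) \<le> \<delta> \<longrightarrow> a + b \<le> Q \<longrightarrow> cmod (jet_from_char F a b y - tpoly m f z a b y) \<le> C * \<delta> ^ Suc Q) \<and>
       (\<forall>p a b. a + b \<le> Q \<longrightarrow> cmod (r a b p) \<le> C * \<delta> ^ Suc Q) \<and>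
       (\<forall>p. from_char p \<in> K \<longrightarrow> vanish_near (jsub (d1 (d2 F)) r) p)"
proof -
  obtain \<phi> where \<phi>: "smooth1 \<phi>" "\<And>n x. 1 \<le> \<bar>x\<bar> \<Longrightarrow> \<phi> n x = 0"
    "\<And>L n x. \<bar>x\<bar> \<le> real L \<Longrightarrow> (\<Sum>i<2 * L + 1. \<phi> n (x + (real L - real i))) = unit1 n x"
    using unit_bump by blast
  obtain B where B: "B \<ge> 0" "\<And>n x. n \<le> N \<Longrightarrow> \<bar>\<phi> n x\<bar> \<le> B"
    using compact_support_bounded[OF \<phi>(1,2)] by blast
  have "bounded K" using \<open>compact K\<close> compact_imp_bounded by blast
  then obtain R where R: "R > 0" "\<And>z. z \<in> K \<Longrightarrow> norm z \<le> R" unfolding bounded_pos by blast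
  define C1 where "C1 = 2 * R + 31"
  define C2 where "C2 = C1 ^ 2 * (2 ^ N * (B ^ 2 * (2 ^ N * (real m ^ 2 * 32 ^ (M + 2 + 2 * N)))))"
  define C3 where "C3 = 2 ^ Q * ((C1 ^ 2 * B ^ 2) * C2)"
  have C: "C1 > 0" "C2 \<ge> 0" "C3 \<ge> 0" using R B by (auto simp: C1_def C2_def C3_def)
  \<comment> \<open>Distances in units of \<open>\<delta>\<close>: a bump reaches 4 from its grid
    point; the cut-off \<open>\<theta>\<close> uses grid points within 8 of \<open>K\<close>, so it
    lives within 12. A bump active at such a point has its grid point within 16 of \<open>K\<close>
    and its Taylor centre within 20 of the point, hence within 32 of the reference centre
    \<open>z\<close>, where the Whitney condition must still apply.\<close>
  define \<delta>0 where "\<delta>0 = min (\<rho>0 / 32) (1 / 32)"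
  show thesis
  proof (rule that[of "C2 + C3" \<delta>0])
    fix \<delta> :: real assume \<delta>: "0 < \<delta>" "\<delta> < \<delta>0"
    then have \<delta>': "32 * \<delta> \<le> \<rho>0" "32 * \<delta> \<le> 1" "\<delta> \<le> 1" by (auto simp: \<delta>0_def)
    \<comment> \<open>The grid has to cover the \<open>12 * \<delta>\<close>-neighbourhood of
      \<open>K\<close>; since \<open>\<delta> \<le> 1\<close>, the radius \<open>R + 14\<close> is
      ample.\<close>
    define L where "L = nat \<lceil>(R + 14) / \<delta>\<rceil>"
    have "(R + 14) / \<delta> > 0" using R \<delta> by simp
    then have L: "(R + 14) / \<delta> \<le> real L" "real L \<le> (R + 14) / \<delta> + 1"
      unfolding L_def by linarith+
    have L1: "R + 14 \<le> real L * \<delta>" using L(1) \<delta> by (simp add: divide_le_eq)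
    have "1 \<le> 1 / \<delta>" using \<delta> \<delta>' by simp
    moreover have "real (2 * L + 1) = 2 * real L + 1" by simp
    ultimately have "real (2 * L + 1) \<le> 2 * ((R + 14) / \<delta>) + 3 * (1 / \<delta>)"
      using L(2) by linarith
    also have "\<dots> = C1 / \<delta>" by (simp add: C1_def add_divide_distrib)
    finally have L2: "real (2 * L + 1) \<le> C1 / \<delta>" .
    define g where "g i n s = (1 / \<delta>) ^ n * \<phi> n ((1 / \<delta>) * s + (real L - real i))" for i n s
    define c where "c i = (real i - real L) * \<delta>" for i
    have g_smooth: "smooth1 (g i)" for i
      unfolding g_def[abs_def] by (rule smooth1_affine[OF \<phi>(1)])
    have g_bound: "\<bar>g i n s\<bar> \<le> B * (1 / \<delta>) ^ N" if "n \<le> N" for i n s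
    proof -
      have "(1 / \<delta>) ^ n \<le> (1 / \<delta>) ^ N" using that \<open>1 \<le> 1 / \<delta>\<close> by (rule power_increasing)
      then have "(1 / \<delta>) ^ n * \<bar>\<phi> n ((1 / \<delta>) * s + (real L - real i))\<bar> \<le> (1 / \<delta>) ^ N * B"
        using B that \<delta> by (intro mult_mono) auto
      then show ?thesis using \<delta> by (simp add: g_def abs_mult mult.commute)
    qed
    have g_zero: "g i n s = 0" if "\<delta> \<le> \<bar>s - c i\<bar>" for i n s
    proof -
      have "(1 / \<delta>) * s + (real L - real i) = (s - c i) / \<delta>"
        using \<delta> by (simp add: c_def field_simps)
      moreover have "1 \<le> \<bar>(s - c i) / \<delta>\<bar>" using that \<delta> by (simp add: abs_divide)
      ultimately show ?thesis using \<phi>(2) by (simp add: g_def)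
    qed
    have g_sum: "(\<Sum>i<2 * L + 1. g i n s) = unit1 n s" if "\<bar>s\<bar> \<le> real L * \<delta>" for n s
    proof -
      have "\<bar>(1 / \<delta>) * s\<bar> \<le> real L" using that \<delta> by (simp add: abs_mult divide_le_eq)
      from \<phi>(3)[OF this, of n] show ?thesis
        unfolding g_def sum_distrib_left[symmetric] by (simp add: unit1_def)
    qed
    define I where "I = {..<2 * L + 1} \<times> {..<2 * L + 1}"
    define cc where "cc k = (c (fst k), c (snd k))" for k
    define Bf where "Bf k = jprod (g (fst k)) (g (snd k))" for k
    define BB where "BB = (B * (1 / \<delta>) ^ N) ^ 2"
    have BB0: "BB \<ge> 0" by (simp add: BB_def)
    have cardI: "real (card I) \<le> (C1 / \<delta>) ^ 2"
    proof -
      have "real (card I) = real (2 * L + 1) ^ 2" by (simp add: I_def power2_eq_square algebra_simps)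
      also have "\<dots> \<le> (C1 / \<delta>) ^ 2" by (intro power_mono L2) simp
      finally show ?thesis .
    qed
    have Bf_smooth: "smooth_jet (Bf k)" for k unfolding Bf_def by (intro smooth_jet_jprod g_smooth)
    have Bf_bound: "cmod (Bf k a b p) \<le> BB" if "a \<le> N" "b \<le> N" for k a b p
    proof -
      have "\<bar>g (fst k) a (fst p)\<bar> * \<bar>g (snd k) b (snd p)\<bar> \<le> BB"
        unfolding BB_def power2_eq_square using B \<delta> by (intro mult_mono g_bound that) auto
      then show ?thesis by (simp add: Bf_def jprod_def norm_mult)
    qed
    have Bf_flat: "flat_at (Bf k) p" if "\<delta> \<le> \<bar>fst p - fst (cc k)\<bar> \<or> \<delta> \<le> \<bar>snd p - snd (cc k)\<bar>" for k p
      using that g_zero by (auto simp: Bf_def cc_def flat_at_def jprod_def)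
    have Bf_supp: "norm (from_char p - from_char (cc k)) \<le> 4 * \<delta>" if "\<not> flat_at (Bf k) p" for k p
      using Bf_flat[of p k] that by (intro norm_from_char_diff_le) linarith+
    have Bf_sum: "(\<Sum>k\<in>I. Bf k a b p) = (if a = 0 \<and> b = 0 then 1 else 0)"
      if "\<bar>fst p\<bar> \<le> real L * \<delta>" "\<bar>snd p\<bar> \<le> real L * \<delta>" for a b p
    proof -
      have "(\<Sum>k\<in>I. Bf k a b p) = of_real ((\<Sum>i<2 * L + 1. g i a (fst p)) * (\<Sum>j<2 * L + 1. g j b (snd p)))"
        unfolding sum_product sum.cartesian_product I_def of_real_sum
        by (intro sum.cong) (auto simp: Bf_def jprod_def)
      then show ?thesis by (simp only: g_sum that) (simp add: unit1_def)
    qed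
    have in_box: "\<bar>fst p\<bar> \<le> real L * \<delta> \<and> \<bar>snd p\<bar> \<le> real L * \<delta>" if "z \<in> K" "norm (from_char p - z) \<le> 12 * \<delta>" for p z
    proof -
      have "norm (from_char p) \<le> norm z + norm (from_char p - z)" by (metis add.commute diff_add_cancel norm_triangle_ineq)
      also have "\<dots> \<le> R + 14" using R(2)[OF that(1)] that(2) \<delta>' by auto
      finally show ?thesis using norm_from_char_coords[of p] L1 by linarith
    qed
    define T where "T z = tpoly m f z" for z
    \<comment> \<open>For grid points far from \<open>K\<close> this choice is arbitrary. That is
      harmless: the glued terms are smooth for any centre, and bumps active within
      \<open>12 * \<delta>\<close> of \<open>K\<close> have a genuine one.\<close>
    define zz where "zz k = (SOME z. z \<in> K \<and> norm (from_char (cc k) - z) \<le> 16 * \<delta>)" for k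
    define F where "F = (\<lambda>a b p. \<Sum>k\<in>I. jmul (Bf k) (jet_to_char (T (zz k))) a b p)"
    have F_smooth: "smooth_jet F"
      unfolding F_def T_def by (intro smooth_jet_sum smooth_jet_jmul Bf_smooth smooth_jet_jet_to_char smooth_jet_tpoly)
    have E: "cmod (F a b p - jet_to_char (T z) a b p) \<le> C2 * \<delta> ^ M"
      if z: "z \<in> K" and pz: "norm (from_char p - z) \<le> 12 * \<delta>" and ab: "a + b \<le> N" for z p a b
    proof -
      define \<rho> where "\<rho> = 32 * \<delta>"
      define G where "G = 2 ^ N * (BB * (2 ^ N * (real m ^ 2 * \<rho> ^ (m - 1 - N))))"
      have \<rho>: "0 \<le> \<rho>" "\<rho> \<le> 1" "\<rho> \<le> \<rho>0" using \<delta> \<delta>' by (auto simp: \<rho>_def)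
      \<comment> \<open>The bumps sum to 1 here, so \<open>T z\<close> is glued from copies of
        itself, and the error becomes a sum of bumps times differences of Taylor
        polynomials.\<close>
      have "jet_to_char (T z) a b p = jmul (\<lambda>a b p. \<Sum>k\<in>I. Bf k a b p) (jet_to_char (T z)) a b p"
        by (rule jmul_one[symmetric]) (rule Bf_sum; use in_box[OF z pz] in simp)
      then have "F a b p - jet_to_char (T z) a b p = (\<Sum>k\<in>I. jmul (Bf k) (jet_to_char (jsub (T (zz k)) (T z))) a b p)"
        by (simp add: F_def jmul_sum1 jet_to_char_jsub jmul_jsub2 sum_subtractf)
      also have "cmod \<dots> \<le> real (card I) * G"
      proof (rule sum_norm_bound)
        fix k assume "k \<in> I"
        have G0: "0 \<le> G" using BB0 \<rho> by (simp add: G_def)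
        show "cmod (jmul (Bf k) (jet_to_char (jsub (T (zz k)) (T z))) a b p) \<le> G"
        proof (cases "flat_at (Bf k) p")
          case True
          then show ?thesis using G0 by (simp add: jmul_flat1)
        next
          case False
          have k: "norm (from_char p - from_char (cc k)) \<le> 4 * \<delta>" by (rule Bf_supp[OF False])
          have "norm (from_char (cc k) - z) \<le> norm (from_char p - z) + norm (from_char p - from_char (cc k))"
            using norm_triangle_ineq4[of "from_char p - z" "from_char p - from_char (cc k)"] by simp
          then have "z \<in> K \<and> norm (from_char (cc k) - z) \<le> 16 * \<delta>" using z pz k by auto
          then have zz: "zz k \<in> K" "norm (from_char (cc k) - zz k) \<le> 16 * \<delta>"
            unfolding zz_def by (metis (mono_tags, lifting) someI)+
          have pzz: "norm (from_char p - zz k) \<le> 20 * \<delta>"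
            using norm_triangle_ineq[of "from_char p - from_char (cc k)" "from_char (cc k) - zz k"] k zz by simp
          have zzz: "norm (zz k - z) \<le> 32 * \<delta>"
            using norm_triangle_ineq4[of "from_char p - z" "from_char p - zz k"] pzz pz by simp
          have t: "cmod (jsub (T (zz k)) (T z) i j (from_char p)) \<le> real m ^ 2 * \<rho> ^ (m - 1 - N)" if "i + j \<le> N" for i j
          proof -
            have ij: "i + j < m" using that by (simp add: m_def)
            have "cmod (tpoly m f (zz k) i j (from_char p) - tpoly m f z i j (from_char p)) \<le> real m ^ 2 * \<rho> ^ (m - 1 - (i + j))"
            proof (rule tpoly_recentre[OF _ _ ij \<rho>(1)])
              show "norm (from_char p - zz k) \<le> \<rho>" using pzz \<delta> by (simp add: \<rho>_def)
              fix a b assume "a + b < m"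
              then have "cmod (f a b (zz k) - tpoly m f z a b (zz k)) \<le> norm (zz k - z) ^ (m - 1 - (a + b))"
                using zzz \<delta>' by (intro W zz z) auto
              also have "\<dots> \<le> \<rho> ^ (m - 1 - (a + b))" using zzz by (intro power_mono) (auto simp: \<rho>_def)
              finally show "cmod (f a b (zz k) - tpoly m f z a b (zz k)) \<le> \<rho> ^ (m - 1 - (a + b))" .
            qed
            also have "\<dots> \<le> real m ^ 2 * \<rho> ^ (m - 1 - N)"
              using \<rho> that by (intro mult_left_mono power_decreasing) auto
            finally show ?thesis by (simp add: T_def jsub_def)
          qed
          have s: "cmod (jet_to_char (jsub (T (zz k)) (T z)) i j p) \<le> 2 ^ N * (real m ^ 2 * \<rho> ^ (m - 1 - N))" if "i \<le> a" "j \<le> b" for i j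
          proof -
            have "cmod (jet_to_char (jsub (T (zz k)) (T z)) i j p) \<le> 2 ^ (i + j) * (real m ^ 2 * \<rho> ^ (m - 1 - N))"
              using that ab by (intro norm_jet_to_char_le t) auto
            also have "\<dots> \<le> 2 ^ N * (real m ^ 2 * \<rho> ^ (m - 1 - N))"
              using that ab \<rho> by (intro mult_right_mono power_increasing) auto
            finally show ?thesis .
          qed
          have "cmod (jmul (Bf k) (jet_to_char (jsub (T (zz k)) (T z))) a b p) \<le> 2 ^ (a + b) * (BB * (2 ^ N * (real m ^ 2 * \<rho> ^ (m - 1 - N))))"
            using ab by (intro norm_jmul_le Bf_bound s) auto
          also have "\<dots> \<le> G"
            unfolding G_def using ab BB0 \<rho> by (intro mult_right_mono power_increasing) auto
          finally show ?thesis .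
        qed
      qed
      also have "\<dots> \<le> (C1 / \<delta>) ^ 2 * G"
        using BB0 \<rho> by (intro mult_right_mono cardI) (simp add: G_def)
      also have "\<dots> = C2 * \<delta> ^ M"
      proof -
        \<comment> \<open>The number of grid points costs \<open>\<delta> ^ 2\<close> and the
          derivatives of the bumps cost \<open>\<delta> ^ (2 * N)\<close>; what remains is
          \<open>\<delta> ^ M\<close>. This fixes the choice of \<open>m\<close>.\<close>
        have "m - 1 - N = M + 2 + 2 * N" by (simp add: m_def)
        then have "\<rho> ^ (m - 1 - N) = 32 ^ (M + 2 + 2 * N) * (\<delta> ^ M * \<delta> ^ 2 * (\<delta> ^ N) ^ 2)"
          by (simp add: \<rho>_def power_mult_distrib power_add power_mult[symmetric] mult.commute[of 2] power2_eq_square[of \<delta>])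
        then show ?thesis
          using \<delta> by (simp add: G_def C2_def BB_def power_divide power_mult_distrib)
      qed
      finally show ?thesis .
    qed
    define near where "near = {k \<in> I. \<exists>z\<in>K. norm (from_char (cc k) - z) \<le> 8 * \<delta>}"
    \<comment> \<open>A partial sum of the partition of unity is a cut-off: it equals 1 near
      \<open>K\<close> and vanishes where nothing is known about the wave operator of
      \<open>F\<close>. Thus \<open>r\<close> is small on the whole plane, as needed for integrating
      it.\<close>
    define \<theta> where "\<theta> = (\<lambda>a b p. \<Sum>k\<in>near. Bf k a b p)"
    define r where "r = jmul \<theta> (d1 (d2 F))"
    have near: "near \<subseteq> I" "finite near" by (auto simp: near_def I_def intro: finite_subset)
    have r_smooth: "smooth_jet r" unfolding r_def \<theta>_def
      by (intro smooth_jet_jmul smooth_jet_sum Bf_smooth smooth_jet_d1 smooth_jet_d2 F_smooth)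
    have pow: "\<delta> ^ M \<le> \<delta> ^ Suc Q" using \<delta> \<delta>' by (intro power_decreasing) (auto simp: M_def)
    have r_bound: "cmod (r a b p) \<le> C3 * \<delta> ^ Suc Q" if ab: "a + b \<le> Q" for p a b
    proof (cases "\<forall>k\<in>near. flat_at (Bf k) p")
      case True
      then have "flat_at \<theta> p" by (simp add: flat_at_def \<theta>_def)
      then show ?thesis using C \<delta> by (simp add: r_def jmul_flat1)
    next
      case False
      then obtain k z where k: "k \<in> near" "\<not> flat_at (Bf k) p" and z: "z \<in> K" "norm (from_char (cc k) - z) \<le> 8 * \<delta>"
        unfolding near_def by blast
      have pz: "norm (from_char p - z) \<le> 12 * \<delta>"
        using norm_triangle_ineq[of "from_char p - from_char (cc k)" "from_char (cc k) - z"] Bf_supp[OF k(2)] z(2) by simp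
      have 1: "cmod (d1 (d2 F) i j p) \<le> C2 * \<delta> ^ M" if "i \<le> a" "j \<le> b" for i j
      proof -
        \<comment> \<open>The local Taylor polynomial solves the equation, so the error bound
          \<open>E\<close> for \<open>F\<close> is at once a bound for its wave operator. The two
          additional derivatives are the reason for \<open>N = Q + 2\<close>.\<close>
        have "jet_to_char (T z) (Suc i) (Suc j) p = 0"
          unfolding T_def by (intro jet_to_char_wave tpoly_wave wave z)
        then show ?thesis using E[OF z(1) pz, of "Suc i" "Suc j"] that ab by (simp add: d1_def d2_def N_def)
      qed
      have 2: "cmod (\<theta> i j p) \<le> (C1 / \<delta>) ^ 2 * BB" if "i \<le> a" "j \<le> b" for i j
      proof -
        have "cmod (\<theta> i j p) \<le> real (card near) * BB"
          unfolding \<theta>_def using that ab by (intro sum_norm_bound Bf_bound) (auto simp: N_def)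
        also have "\<dots> \<le> (C1 / \<delta>) ^ 2 * BB"
        proof (rule mult_right_mono[OF _ BB0])
          have "card near \<le> card I" using near by (intro card_mono) (auto simp: I_def)
          then show "real (card near) \<le> (C1 / \<delta>) ^ 2" using cardI by linarith
        qed
        finally show ?thesis .
      qed
      have "cmod (r a b p) \<le> 2 ^ (a + b) * ((C1 / \<delta>) ^ 2 * BB * (C2 * \<delta> ^ M))"
        unfolding r_def by (intro norm_jmul_le 1 2)
      also have "\<dots> \<le> 2 ^ Q * ((C1 / \<delta>) ^ 2 * BB * (C2 * \<delta> ^ M))"
        using ab BB0 C \<delta> by (intro mult_right_mono power_increasing) auto
      also have "\<dots> = C3 * \<delta> ^ Suc Q"
      proof -
        \<comment> \<open>Multiplication by \<open>\<theta>\<close> costs the same powers once more,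
          hence the excess \<open>2 + 2 * N\<close> of \<open>M\<close> over
          \<open>Suc Q\<close>.\<close>
        have "\<delta> ^ M = \<delta> ^ Suc Q * \<delta> ^ 2 * (\<delta> ^ N) ^ 2"
          unfolding power_mult[symmetric] power_add[symmetric]
          by (rule arg_cong[where f = "\<lambda>n. \<delta> ^ n"]) (simp add: M_def)
        then show ?thesis using \<delta> by (simp add: C3_def BB_def power_divide power_mult_distrib)
      qed
      finally show ?thesis .
    qed
    have van: "vanish_near (jsub (d1 (d2 F)) r) p" if p: "from_char p \<in> K" for p
    proof (rule vanish_nearI[OF open_box_at box_at_self[OF \<delta>(1)]])
      fix q assume q: "q \<in> box_at p \<delta>"
      have qp: "norm (from_char q - from_char p) \<le> 4 * \<delta>"
        using q by (intro norm_from_char_diff_le) (auto simp: box_at_def)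
      have far: "flat_at (Bf k) q" if "k \<in> I - near" for k
      proof (rule ccontr)
        assume "\<not> flat_at (Bf k) q"
        from Bf_supp[OF this] have "norm (from_char (cc k) - from_char p) \<le> 8 * \<delta>"
          using norm_triangle_ineq4[of "from_char q - from_char p" "from_char q - from_char (cc k)"] qp by simp
        then show False using p that by (auto simp: near_def)
      qed
      have "\<theta> a b q = (\<Sum>k\<in>I. Bf k a b q)" for a b
        unfolding \<theta>_def by (rule sum.mono_neutral_left) (use near far in \<open>auto simp: I_def flat_at_def\<close>)
      also have "(\<Sum>k\<in>I. Bf k a b q) = (if a = 0 \<and> b = 0 then 1 else 0)" for a b
        by (rule Bf_sum) (use in_box[OF p, of q] qp \<delta> in auto)
      finally have "jmul \<theta> J a b q = J a b q" for J a b by (rule jmul_one)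
      then show "flat_at (jsub (d1 (d2 F)) r) q" by (simp add: r_def flat_at_jsub)
    qed
    have F_bound: "cmod (jet_from_char F a b y - tpoly m f z a b y) \<le> (C2 + C3) * \<delta> ^ Suc Q"
      if "z \<in> K" "norm (y - z) \<le> \<delta>" "a + b \<le> Q" for z y a b
    proof -
      have "jet_from_char F a b y - tpoly m f z a b y = jet_from_char (jsub F (jet_to_char (T z))) a b y"
        by (simp add: jet_from_char_jsub T_def) (simp add: jsub_def)
      also have "cmod \<dots> \<le> C2 * \<delta> ^ M"
      proof (rule norm_jet_from_char_le)
        fix i j assume "i + j = a + b"
        then show "cmod (jsub F (jet_to_char (T z)) i j (to_char y)) \<le> C2 * \<delta> ^ M"
          unfolding jsub_def using that \<delta> by (intro E) (auto simp: N_def)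
      qed
      also have "\<dots> \<le> (C2 + C3) * \<delta> ^ Suc Q"
        using C \<delta> pow by (intro mult_mono) auto
      finally show ?thesis .
    qed
    have "C3 * \<delta> ^ Suc Q \<le> (C2 + C3) * \<delta> ^ Suc Q" using C \<delta> by (intro mult_right_mono) auto
    then have r_bound': "cmod (r a b p) \<le> (C2 + C3) * \<delta> ^ Suc Q" if "a + b \<le> Q" for p a b
      using r_bound[OF that, of p] by linarith
    show "\<exists>F r. smooth_jet F \<and> smooth_jet r \<and>
       (\<forall>z\<in>K. \<forall>y a b. norm (y - z) \<le> \<delta> \<longrightarrow> a + b \<le> Q \<longrightarrow> cmod (jet_from_char F a b y - tpoly m f z a b y) \<le> (C2 + C3) * \<delta> ^ Suc Q) \<and>
       (\<forall>p a b. a + b \<le> Q \<longrightarrow> cmod (r a b p) \<le> (C2 + C3) * \<delta> ^ Suc Q) \<and>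
       (\<forall>p. from_char p \<in> K \<longrightarrow> vanish_near (jsub (d1 (d2 F)) r) p)"
      by (rule exI[of _ F], rule exI[of _ r], intro conjI allI ballI impI F_smooth r_smooth F_bound r_bound' van)
  qed (use C \<rho>0 in \<open>auto simp: \<delta>0_def\<close>)
qed

section \<open>Whitney estimates\<close>

text \<open>Dominates the constants of both regimes below: \<open>1 + 2 ^ Suc n\<close> for nearby
  points and \<open>1 + real (Suc n) ^ 2\<close> for distant ones.\<close>

definition whitney_const :: "nat \<Rightarrow> real" where "whitney_const n = 1 + real (Suc n) ^ 2 + 2 ^ Suc n"

text \<open>For points closer than \<open>\<delta>\<close>, Taylor's formula is applied to
  \<open>A - tpoly m f x\<close> along the segment, which may leave \<open>K\<close>; this is why
  \<open>H2\<close> ranges over a full neighbourhood and one more order. For points further apart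
  the remainder is bounded term by term, and the factor \<open>\<delta> ^ n\<close> in
  \<open>H2\<close> supplies the missing powers of the distance.\<close>

lemma whitney_difference:
  assumes A: "smooth_jet A" and \<delta>: "0 < \<delta>" "\<delta> \<le> 1" and \<eta>: "0 \<le> \<eta>" and nm: "n < m"
    and H1: "\<And>x y a b. x \<in> K \<Longrightarrow> y \<in> K \<Longrightarrow> norm (y - x) < \<delta> \<Longrightarrow> a + b \<le> n \<Longrightarrow>
      cmod (f a b y - tpoly m f x a b y) \<le> \<eta> * norm (y - x) ^ (n - (a + b))"
    and H2: "\<And>z y a b. z \<in> K \<Longrightarrow> norm (y - z) \<le> \<delta> \<Longrightarrow> a + b \<le> Suc n \<Longrightarrow>
      cmod (A a b y - tpoly m f z a b y) \<le> \<eta> * \<delta> ^ n"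
  shows "\<And>x a b. x \<in> K \<Longrightarrow> a + b \<le> n \<Longrightarrow> cmod (jsub f A a b x) \<le> \<eta>"
    and "\<And>x y a b. x \<in> K \<Longrightarrow> y \<in> K \<Longrightarrow> a + b \<le> n \<Longrightarrow>
      cmod (jsub f A a b y - tpoly (Suc n) (jsub f A) x a b y) \<le> whitney_const n * \<eta> * norm (y - x) ^ (n - (a + b))"
proof -
  define e where "e = jsub f A"
  have \<delta>n: "\<delta> ^ n \<le> 1" using \<delta> by (simp add: power_le_one)
  have e: "cmod (e a b x) \<le> \<eta> * \<delta> ^ n" if "x \<in> K" "a + b \<le> n" for x a b
    using H2[OF that(1), of x a b] that \<delta> nm by (simp add: tpoly_base e_def jsub_def norm_minus_commute)
  have "\<eta> * \<delta> ^ n \<le> \<eta>" using \<delta>n \<eta> mult_left_le by blast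
  then show "cmod (jsub f A a b x) \<le> \<eta>" if "x \<in> K" "a + b \<le> n" for x a b
    using e[OF that] by (simp add: e_def)
  fix x y a b assume x: "x \<in> K" and y: "y \<in> K" and ab: "a + b \<le> n"
  define \<rho> where "\<rho> = norm (y - x)"
  define l where "l = n - (a + b)"
  show "cmod (jsub f A a b y - tpoly (Suc n) (jsub f A) x a b y) \<le> whitney_const n * \<eta> * norm (y - x) ^ (n - (a + b))"
  proof (cases "\<rho> < \<delta>")
    case True
    define D where "D = jsub A (tpoly m f x)"
    have D: "smooth_jet D" unfolding D_def by (intro smooth_jet_jsub A smooth_jet_tpoly)
    have "tpoly (Suc n) e x = tpoly (Suc n) (jsub (tpoly m f x) A) x"
      by (rule tpoly_cong) (use nm in \<open>simp add: e_def jsub_def tpoly_base\<close>)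
    then have eq: "e a b y - tpoly (Suc n) e x a b y = (f a b y - tpoly m f x a b y) - (D a b y - tpoly (Suc n) D x a b y)"
      by (simp add: tpoly_jsub D_def) (simp add: e_def jsub_def)
    have 1: "cmod (f a b y - tpoly m f x a b y) \<le> \<eta> * \<rho> ^ l"
      using H1[OF x y _ ab] True by (simp add: \<rho>_def l_def)
    have "cmod (D a b y - tpoly (Suc n) D x a b y) \<le> (\<eta> * \<delta> ^ n) * (2 * norm (y - x)) ^ (Suc n - (a + b))"
    proof (rule taylor_remainder[OF D])
      fix i j p assume ij: "i + j = Suc n" and p: "p \<in> closed_segment x y"
      have "norm (p - x) \<le> \<delta>"
        using segment_bound1[OF p] True by (simp add: \<rho>_def norm_minus_commute)
      then show "cmod (D i j p) \<le> \<eta> * \<delta> ^ n"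
        using H2[OF x, of p i j] ij by (simp add: D_def jsub_def)
    qed (use ab in simp)
    also have "\<dots> \<le> \<eta> * (2 * \<rho>) ^ Suc l"
      using \<open>\<eta> * \<delta> ^ n \<le> \<eta>\<close> ab by (simp add: \<rho>_def l_def Suc_diff_le del: power_Suc) (intro mult_right_mono; simp)
    also have "\<dots> = \<eta> * (2 ^ Suc l * \<rho> ^ l) * \<rho>" by (simp add: power_mult_distrib)
    also have "\<dots> \<le> \<eta> * (2 ^ Suc n * \<rho> ^ l) * 1"
      using \<eta> True \<delta> by (intro mult_mono mult_left_mono power_increasing mult_right_mono) (auto simp: \<rho>_def l_def)
    finally have 2: "cmod (D a b y - tpoly (Suc n) D x a b y) \<le> \<eta> * (2 ^ Suc n * \<rho> ^ l)" by simp
    have "cmod (e a b y - tpoly (Suc n) e x a b y) \<le> \<eta> * \<rho> ^ l + \<eta> * (2 ^ Suc n * \<rho> ^ l)"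
      unfolding eq by (rule order.trans[OF norm_triangle_ineq4 add_mono[OF 1 2]])
    also have "\<dots> = (1 + 2 ^ Suc n) * (\<eta> * \<rho> ^ l)" by (simp add: algebra_simps)
    also have "\<dots> \<le> whitney_const n * (\<eta> * \<rho> ^ l)"
      using \<eta> by (intro mult_right_mono) (auto simp: whitney_const_def \<rho>_def)
    finally show ?thesis by (simp add: e_def \<rho>_def l_def)
  next
    case False
    then have \<rho>: "\<delta> \<le> \<rho>" "0 \<le> \<rho>" by (auto simp: \<rho>_def)
    have le: "\<eta> * \<delta> ^ n * \<rho> ^ k \<le> \<eta> * \<rho> ^ l" if "k \<le> l" for k
    proof -
      have "\<delta> ^ n \<le> \<delta> ^ (l - k)" using \<delta> by (intro power_decreasing) (auto simp: l_def)
      also have "\<dots> \<le> \<rho> ^ (l - k)" using \<rho> \<delta> by (intro power_mono) auto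
      finally have "\<delta> ^ n * \<rho> ^ k \<le> \<rho> ^ (l - k) * \<rho> ^ k" using \<rho> by (intro mult_right_mono) auto
      also have "\<dots> = \<rho> ^ l" using that by (simp add: power_add[symmetric])
      finally show ?thesis using \<eta> by (simp add: mult.assoc mult_left_mono)
    qed
    have 1: "cmod (e a b y) \<le> \<eta> * \<rho> ^ l"
      using e[OF y ab] le[of 0] by simp
    have "cmod (tpoly (Suc n - (a + b)) (\<lambda>i j. e (a + i) (b + j)) x 0 0 y) \<le> real (Suc n - (a + b)) ^ 2 * (\<eta> * \<rho> ^ l)"
    proof (rule norm_tpoly_le[of _ _ _ \<rho>])
      fix i j assume ij: "i + j < Suc n - (a + b)"
      then have "cmod (e (a + i) (b + j) x) * \<rho> ^ (i + j) \<le> \<eta> * \<delta> ^ n * \<rho> ^ (i + j)"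
        using \<rho> by (intro mult_right_mono e x) auto
      also have "\<dots> \<le> \<eta> * \<rho> ^ l" using ij by (intro le) (simp add: l_def)
      finally show "cmod (e (a + i) (b + j) x) * \<rho> ^ (i + j) \<le> \<eta> * \<rho> ^ l" .
    qed (use \<rho> \<eta> in \<open>auto simp: \<rho>_def\<close>)
    also have "\<dots> \<le> real (Suc n) ^ 2 * (\<eta> * \<rho> ^ l)"
      using \<eta> \<rho> by (intro mult_right_mono power_mono) auto
    finally have 2: "cmod (tpoly (Suc n) e x a b y) \<le> real (Suc n) ^ 2 * (\<eta> * \<rho> ^ l)"
      using tpoly_shift[of a b "Suc n" e x] ab by simp
    have "cmod (e a b y - tpoly (Suc n) e x a b y) \<le> \<eta> * \<rho> ^ l + real (Suc n) ^ 2 * (\<eta> * \<rho> ^ l)"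
      by (rule order.trans[OF norm_triangle_ineq4 add_mono[OF 1 2]])
    also have "\<dots> = (1 + real (Suc n) ^ 2) * (\<eta> * \<rho> ^ l)" by (simp add: algebra_simps)
    also have "\<dots> \<le> whitney_const n * (\<eta> * \<rho> ^ l)"
      using \<eta> \<rho> by (intro mult_right_mono) (auto simp: whitney_const_def)
    finally show ?thesis by (simp add: e_def \<rho>_def l_def)
  qed
qed

section \<open>Bounds for double primitives and approximation on a compact set\<close>

definition prim1 :: "planar_jet \<Rightarrow> planar_jet" where "prim1 J = jswap (prim2 (jswap J))"

lemma smooth_jet_prim1: "smooth_jet J \<Longrightarrow> smooth_jet (prim1 J)"
  unfolding prim1_def by (intro smooth_jet_jswap smooth_jet_prim2)

lemma d1_prim1: "d1 (prim1 J) = J"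
  by (simp add: d1_def prim1_def prim2_def jswap_def)

text \<open>At order 0 in \<open>t\<close> the length of the interval of integration enters; higher
  orders are derivatives of \<open>J\<close> itself. \<open>1 \<le> R\<close> lets one constant
  serve both.\<close>

lemma norm_prim2_le:
  assumes J: "smooth_jet J" and "1 \<le> R" "\<bar>snd p\<bar> \<le> R" "a + b \<le> Q" "0 \<le> c"
    and "\<And>a b t. a + b \<le> Q \<Longrightarrow> \<bar>t\<bar> \<le> R \<Longrightarrow> cmod (J a b (fst p, t)) \<le> c"
  shows "cmod (prim2 J a b p) \<le> R * c"
proof (cases b)
  case 0
  have "cmod (integral {0..1} (\<lambda>v. snd p *\<^sub>R J a 0 (fst p, snd p * v))) \<le> (R * c) * (1 - 0)"
  proof (rule integral_bound)
    show "continuous_on {0..1} (\<lambda>v. snd p *\<^sub>R J a 0 (fst p, snd p * v))"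
      by (intro continuous_intros continuous_on_jet_comp J)
    fix v :: real assume v: "v \<in> {0..1}"
    then have "\<bar>snd p * v\<bar> \<le> R * 1" unfolding abs_mult using assms by (intro mult_mono) auto
    then have "cmod (J a 0 (fst p, snd p * v)) \<le> c" using assms(4,6) 0 by simp
    then show "cmod (snd p *\<^sub>R J a 0 (fst p, snd p * v)) \<le> R * c"
      unfolding norm_scaleR using assms by (intro mult_mono) auto
  qed simp
  then show ?thesis by (simp add: 0 prim2_def)
next
  case (Suc b')
  have "cmod (J a b' (fst p, snd p)) \<le> 1 * c" using assms(3,4) assms(6)[of a b' "snd p"] Suc by simp
  also have "\<dots> \<le> R * c" using assms by (intro mult_right_mono) auto
  finally show ?thesis by (simp add: Suc prim2_def)
qed

lemma norm_prim1_prim2_le: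
  assumes J: "smooth_jet J" and "1 \<le> R" "\<bar>fst p\<bar> \<le> R" "\<bar>snd p\<bar> \<le> R" "a + b \<le> Q" "0 \<le> c"
    and "\<And>a b q. a + b \<le> Q \<Longrightarrow> cmod (J a b q) \<le> c"
  shows "cmod (prim1 (prim2 J) a b p) \<le> R * (R * c)"
proof -
  have "cmod (prim2 (jswap (prim2 J)) b a (snd p, fst p)) \<le> R * (R * c)"
  proof (rule norm_prim2_le[of _ _ _ _ _ Q])
    fix i j t assume "i + j \<le> Q" "\<bar>t\<bar> \<le> R"
    then show "cmod (jswap (prim2 J) i j (fst (snd p, fst p), t)) \<le> R * c"
      unfolding jswap_def using assms by (auto intro!: norm_prim2_le[of _ _ _ _ _ Q])
  qed (use assms in \<open>auto intro!: smooth_jet_jswap smooth_jet_prim2 simp: add.commute\<close>)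
  then show ?thesis by (simp add: prim1_def jswap_def)
qed

lemma jet_from_char_flat: "flat_at J (to_char x) \<Longrightarrow> jet_from_char J a b x = 0"
  using norm_jet_from_char_le[of a b J x 0] by (simp add: flat_at_def)

text \<open>The approximant is \<open>G - w2 - w\<close>, carried back to the plane:
  \<open>w2\<close> is the double primitive of the small error, itself small on bounded sets, and
  \<open>w\<close> solves the remaining equation exactly on \<open>F\<close> while being flat on
  \<open>K\<close>.\<close>

lemma wave_approx:
  fixes f :: planar_jet and K F :: "(real \<times> real) set"
  assumes "compact K" "closed F" and wave: "\<And>z a b. z \<in> K \<Longrightarrow> f (Suc (Suc a)) b z = f a (Suc (Suc b)) z"
    and W: "\<And>m. \<exists>\<rho>>0. \<forall>x\<in>K. \<forall>z\<in>K. \<forall>a b. norm (x - z) \<le> \<rho> \<longrightarrow> a + b < m \<longrightarrow>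
       cmod (f a b x - tpoly m f z a b x) \<le> norm (x - z) ^ (m - 1 - (a + b))"
    and gap2: "\<And>s a b. a < b \<Longrightarrow> from_char (s, a) \<in> K \<Longrightarrow> from_char (s, b) \<in> K \<Longrightarrow> (\<And>t. a < t \<Longrightarrow> t < b \<Longrightarrow> from_char (s, t) \<notin> K) \<Longrightarrow>
       \<exists>t. a < t \<and> t < b \<and> from_char (s, t) \<notin> F"
    and gap1: "\<And>t a b. a < b \<Longrightarrow> from_char (a, t) \<in> K \<Longrightarrow> from_char (b, t) \<in> K \<Longrightarrow> (\<And>s. a < s \<Longrightarrow> s < b \<Longrightarrow> from_char (s, t) \<notin> K) \<Longrightarrow>
       \<exists>s. a < s \<and> s < b \<and> from_char (s, t) \<notin> F"
    and \<epsilon>: "\<epsilon> > 0"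
  obtains A where "smooth_jet A" "\<And>y a b. y \<in> F \<Longrightarrow> A (Suc (Suc a)) b y = A a (Suc (Suc b)) y"
    "\<And>n x a b. n \<le> N \<Longrightarrow> x \<in> K \<Longrightarrow> a + b \<le> n \<Longrightarrow> cmod (jsub f A a b x) \<le> \<epsilon>"
    "\<And>n x y a b. n \<le> N \<Longrightarrow> x \<in> K \<Longrightarrow> y \<in> K \<Longrightarrow> a + b \<le> n \<Longrightarrow>
      cmod (jsub f A a b y - tpoly (Suc n) (jsub f A) x a b y) \<le> \<epsilon> * norm (y - x) ^ (n - (a + b))"
proof -
  \<comment> \<open>One order more than \<open>N\<close>: Whitney remainders of order
    \<open>n \<le> N\<close> are estimated through derivatives of order
    \<open>Suc n\<close>.\<close>
  define Q where "Q = Suc N"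
  define m where "m = (Q + 3 + 2 * (Q + 2)) + 3 + 3 * (Q + 2)"
  obtain \<rho>0 where \<rho>0: "\<rho>0 > 0" "\<And>x z a b. x \<in> K \<Longrightarrow> z \<in> K \<Longrightarrow> norm (x - z) \<le> \<rho>0 \<Longrightarrow> a + b < m \<Longrightarrow>
       cmod (f a b x - tpoly m f z a b x) \<le> norm (x - z) ^ (m - 1 - (a + b))"
    using W[of m] by blast
  obtain C \<delta>0 where C: "C \<ge> 0" "\<delta>0 > 0"
    "\<And>\<delta>. 0 < \<delta> \<Longrightarrow> \<delta> < \<delta>0 \<Longrightarrow> \<exists>G r. smooth_jet G \<and> smooth_jet r \<and>
       (\<forall>z\<in>K. \<forall>y a b. norm (y - z) \<le> \<delta> \<longrightarrow> a + b \<le> Q \<longrightarrow> cmod (jet_from_char G a b y - tpoly m f z a b y) \<le> C * \<delta> ^ Suc Q) \<and>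
       (\<forall>p a b. a + b \<le> Q \<longrightarrow> cmod (r a b p) \<le> C * \<delta> ^ Suc Q) \<and>
       (\<forall>p. from_char p \<in> K \<longrightarrow> vanish_near (jsub (d1 (d2 G)) r) p)"
    by (rule wave_approx_scale[OF assms(1) wave \<rho>0(1) \<rho>0(2)[unfolded m_def], folded m_def]) (auto intro: that)
  have "bounded K" using \<open>compact K\<close> compact_imp_bounded by blast
  then obtain R0 where R0: "R0 > 0" "\<And>z. z \<in> K \<Longrightarrow> norm z \<le> R0" unfolding bounded_pos by blast
  define R where "R = R0 + 1"
  have R: "R \<ge> 1" using R0 by (simp add: R_def)
  define C' where "C' = C + R * (R * C)"
  have C': "C' \<ge> 0" using C R by (simp add: C'_def)
  have whitney: "whitney_const n \<le> whitney_const N" "1 \<le> whitney_const n" if "n \<le> N" for n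
    using that by (auto simp: whitney_const_def intro!: add_mono power_mono power_increasing)
  define \<eta> where "\<eta> = \<epsilon> / whitney_const N"
  have \<eta>: "\<eta> > 0" "whitney_const N * \<eta> = \<epsilon>" using whitney(2)[of N] \<epsilon> by (auto simp: \<eta>_def)
  have \<eta>': "\<eta> \<le> \<epsilon>" using \<eta> whitney(2)[of N] mult_right_mono[of 1 "whitney_const N" \<eta>] by simp
  \<comment> \<open>\<open>\<delta> \<le> \<eta>\<close> turns a surplus power of the distance into
    the factor \<open>\<eta>\<close> in \<open>H1\<close>;
    \<open>\<delta> \<le> \<eta> / (C' + 1)\<close> turns a surplus power of \<open>\<delta>\<close>
    into that factor in \<open>est\<close>, with \<open>+ 1\<close> covering
    \<open>C' = 0\<close>.\<close>
  define \<delta> where "\<delta> = Min {\<delta>0 / 2, 1, \<rho>0, \<eta>, \<eta> / (C' + 1)}"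
  have \<delta>: "0 < \<delta>" "\<delta> < \<delta>0" "\<delta> \<le> 1" "\<delta> \<le> \<rho>0" "\<delta> \<le> \<eta>" "\<delta> \<le> \<eta> / (C' + 1)"
    using C C' \<eta> \<rho>0 by (auto simp: \<delta>_def Min_less_iff)
  have "\<delta> * (C' + 1) \<le> \<eta>" using \<delta>(6) C' by (simp add: le_divide_eq)
  then have C\<delta>: "C' * \<delta> \<le> \<eta>" using \<delta>(1) by (simp add: algebra_simps)
  obtain G r where Gr: "smooth_jet G" "smooth_jet r"
    "\<forall>z\<in>K. \<forall>y a b. norm (y - z) \<le> \<delta> \<longrightarrow> a + b \<le> Q \<longrightarrow> cmod (jet_from_char G a b y - tpoly m f z a b y) \<le> C * \<delta> ^ Suc Q"
    "\<forall>p a b. a + b \<le> Q \<longrightarrow> cmod (r a b p) \<le> C * \<delta> ^ Suc Q"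
    "\<forall>p. from_char p \<in> K \<longrightarrow> vanish_near (jsub (d1 (d2 G)) r) p"
    using C(3)[OF \<delta>(1,2)] by (elim exE conjE) (rule that; assumption)
  note G = Gr(1) and r = Gr(2) and GT = Gr(3)[rule_format] and rb = Gr(4)[rule_format] and kv = Gr(5)[rule_format]
  define w2 where "w2 = prim1 (prim2 r)"
  have w2: "smooth_jet w2" unfolding w2_def by (intro smooth_jet_prim1 smooth_jet_prim2 r)
  have w2d: "d1 (d2 w2) = r" unfolding w2_def by (simp add: d1_d2 d1_prim1 d2_prim2)
  define k where "k = jsub (d1 (d2 G)) r"
  have k: "smooth_jet k" unfolding k_def by (intro smooth_jet_jsub smooth_jet_d1 smooth_jet_d2 G r)
  have to_char_image: "to_char ` S = from_char -` S" for S :: "(real \<times> real) set"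
    by (auto intro: image_eqI[of _ to_char "from_char p" for p])
  have cK: "compact (from_char -` K)" unfolding to_char_image[symmetric] to_char_def
    by (intro compact_continuous_image continuous_intros \<open>compact K\<close>) auto
  have cF: "closed (from_char -` F)" unfolding from_char_def
    by (intro closed_vimage \<open>closed F\<close>) (auto intro!: continuous_intros simp: from_char_def)
  obtain w where w: "smooth_jet w" "\<And>p a b. p \<in> from_char -` F \<Longrightarrow> w (Suc a) (Suc b) p = k a b p"
    "\<And>p. p \<in> from_char -` K \<Longrightarrow> flat_at w p"
  proof (rule wave_solve[OF cK cF k])
    show "vanish_near k p" if "p \<in> from_char -` K" for p
      using kv that by (simp add: k_def)
  next
    fix s a b :: real
    assume "a < b" "(s, a) \<in> from_char -` K" "(s, b) \<in> from_char -` K" "\<And>t. a < t \<Longrightarrow> t < b \<Longrightarrow> (s, t) \<notin> from_char -` K"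
    then show "\<exists>t>a. t < b \<and> (s, t) \<notin> from_char -` F" using gap2[of a b s] by simp
  next
    fix t a b :: real
    assume "a < b" "(a, t) \<in> from_char -` K" "(b, t) \<in> from_char -` K" "\<And>s. a < s \<Longrightarrow> s < b \<Longrightarrow> (s, t) \<notin> from_char -` K"
    then show "\<exists>s>a. s < b \<and> (s, t) \<notin> from_char -` F" using gap1[of a b t] by simp
  qed (rule that)
  \<comment> \<open>\<open>w\<close> is controlled only on \<open>K\<close>, where it is flat. The
    estimates on a neighbourhood are therefore made for \<open>A'\<close>, whose jet on
    \<open>K\<close> is that of \<open>A\<close>.\<close>
  define A' where "A' = jet_from_char (jsub G w2)"
  define A where "A = jet_from_char (jsub (jsub G w2) w)"
  have A': "smooth_jet A'" unfolding A'_def by (intro smooth_jet_jet_from_char smooth_jet_jsub G w2)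
  have AK: "A a b x = A' a b x" if "x \<in> K" for a b x
  proof -
    have "jet_from_char w a b x = 0" by (intro jet_from_char_flat w(3)) (simp add: that)
    then show ?thesis by (simp add: A_def A'_def jet_from_char_jsub) (simp add: jsub_def)
  qed
  have est: "cmod (A' a b y - tpoly m f z a b y) \<le> \<eta> * \<delta> ^ n"
    if z: "z \<in> K" and y: "norm (y - z) \<le> \<delta>" and ab: "a + b \<le> Suc n" and n: "n \<le> N" for z y a b n
  proof -
    have abQ: "a + b \<le> Q" using ab n by (simp add: Q_def)
    have "norm y \<le> norm z + norm (y - z)" by (metis add.commute diff_add_cancel norm_triangle_ineq)
    then have "norm y \<le> R" using R0(2)[OF z] y \<delta> by (simp add: R_def)
    then have yR: "\<bar>fst (to_char y)\<bar> \<le> R" "\<bar>snd (to_char y)\<bar> \<le> R" 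
      using norm_from_char_coords[of "to_char y"] by auto
    have 1: "cmod (jet_from_char w2 a b y) \<le> R * (R * (C * \<delta> ^ Suc Q))"
      unfolding w2_def using C \<delta> abQ
      by (intro norm_jet_from_char_le norm_prim1_prim2_le[OF r R yR _ _ rb, of _ _ Q]) auto
    have 2: "cmod (jet_from_char G a b y - tpoly m f z a b y) \<le> C * \<delta> ^ Suc Q" by (rule GT[OF z y abQ])
    have 3: "A' a b y - tpoly m f z a b y = (jet_from_char G a b y - tpoly m f z a b y) - jet_from_char w2 a b y"
      by (simp add: A'_def jet_from_char_jsub) (simp add: jsub_def)
    have "cmod (A' a b y - tpoly m f z a b y) \<le> C * \<delta> ^ Suc Q + R * (R * (C * \<delta> ^ Suc Q))"
      unfolding 3 using 1 2 norm_triangle_ineq4[of "jet_from_char G a b y - tpoly m f z a b y" "jet_from_char w2 a b y"] by linarith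
    also have "\<dots> = (C' * \<delta>) * \<delta> ^ Q" by (simp add: C'_def algebra_simps)
    also have "\<dots> \<le> \<eta> * \<delta> ^ n"
      using C\<delta> \<delta> n \<eta> by (intro mult_mono power_decreasing) (auto simp: Q_def)
    finally show ?thesis .
  qed
  have H1: "cmod (f a b y - tpoly m f x a b y) \<le> \<eta> * norm (y - x) ^ (n - (a + b))"
    if "x \<in> K" "y \<in> K" "norm (y - x) < \<delta>" "a + b \<le> n" "n \<le> N" for x y a b n
  proof -
    have "cmod (f a b y - tpoly m f x a b y) \<le> norm (y - x) ^ (m - 1 - (a + b))"
      using that \<delta> by (intro \<rho>0) (auto simp: m_def Q_def)
    also have "\<dots> \<le> norm (y - x) ^ Suc (n - (a + b))"
      using that \<delta> by (intro power_decreasing) (auto simp: m_def Q_def)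
    also have "\<dots> \<le> \<eta> * norm (y - x) ^ (n - (a + b))"
      using that \<delta> by (simp add: mult_right_mono)
    finally show ?thesis .
  qed
  have e: "jsub f A a b x = jsub f A' a b x" if "x \<in> K" for a b x using AK[OF that] by (simp add: jsub_def)
  have te: "tpoly (Suc n) (jsub f A) x = tpoly (Suc n) (jsub f A') x" if "x \<in> K" for n x
    by (rule tpoly_cong) (rule e[OF that])
  show thesis
  proof (rule that[of A])
    show "smooth_jet A" unfolding A_def by (intro smooth_jet_jet_from_char smooth_jet_jsub G w2 w)
    show "A (Suc (Suc a)) b y = A a (Suc (Suc b)) y" if "y \<in> F" for y a b
    proof -
      have "flat_at (d1 (d2 (jsub (jsub G w2) w))) (to_char y)"
        unfolding flat_at_def
      proof (intro allI)
        fix i j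
        have "w (Suc i) (Suc j) (to_char y) = k i j (to_char y)" by (rule w(2)) (simp add: that)
        moreover have "w2 (Suc i) (Suc j) (to_char y) = r i j (to_char y)"
          unfolding w2d[symmetric] by (simp add: d1_def d2_def)
        ultimately show "d1 (d2 (jsub (jsub G w2) w)) i j (to_char y) = 0"
          by (simp add: d1_def d2_def jsub_def k_def)
      qed
      from jet_from_char_flat[OF this] jet_from_char_wave[of "jsub (jsub G w2) w" a b y] show ?thesis
        by (simp add: A_def)
    qed
    fix n x a b assume n: "n \<le> N" and x: "x \<in> K" and ab: "a + b \<le> n"
    have nm: "n < m" using n by (simp add: m_def Q_def)
    show "cmod (jsub f A a b x) \<le> \<epsilon>"
      unfolding e[OF x] using \<eta>'
      by (rule order.trans[rotated], intro whitney_difference(1)[OF A' \<delta>(1,3) less_imp_le[OF \<eta>(1)] nm _ _ x ab])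
         (rule H1[OF _ _ _ _ n] est[OF _ _ _ n]; assumption)+
    fix y assume y: "y \<in> K"
    have "cmod (jsub f A' a b y - tpoly (Suc n) (jsub f A') x a b y) \<le> whitney_const n * \<eta> * norm (y - x) ^ (n - (a + b))"
      by (rule whitney_difference(2)[OF A' \<delta>(1,3) less_imp_le[OF \<eta>(1)] nm _ _ x y ab])
         (rule H1[OF _ _ _ _ n] est[OF _ _ _ n]; assumption)+
    also have "\<dots> \<le> (whitney_const N * \<eta>) * norm (y - x) ^ (n - (a + b))"
      using whitney(1)[OF n] \<eta> by (intro mult_right_mono) auto
    finally show "cmod (jsub f A a b y - tpoly (Suc n) (jsub f A) x a b y) \<le> \<epsilon> * norm (y - x) ^ (n - (a + b))"
      by (simp add: e[OF y] te[OF x] \<eta>(2))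
  qed
qed

section \<open>Whitney jets on the plane\<close>

definition pair :: "real ^ 2 \<Rightarrow> real \<times> real" where "pair x = (x $ 1, x $ 2)"
definition vec2 :: "real \<times> real \<Rightarrow> real ^ 2" where "vec2 p = vector [fst p, snd p]"
definition mindex :: "nat \<Rightarrow> nat \<Rightarrow> multiindex" where "mindex a b = vector [a, b]"

lemma pair_vec2 [simp]: "pair (vec2 p) = p" and vec2_pair [simp]: "vec2 (pair x) = x"
  by (simp_all add: pair_def vec2_def vec_eq_iff forall_2)

lemma mindex_nth [simp]: "mindex a b $ 1 = a" "mindex a b $ 2 = b" "mindex (\<alpha> $ 1) (\<alpha> $ 2) = \<alpha>"
  by (simp_all add: mindex_def vec_eq_iff forall_2)

lemma mi_abs_2: "mi_abs \<alpha> = \<alpha> $ 1 + \<alpha> $ 2"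
  by (simp add: mi_abs_def UNIV_2)

lemma add_axis: "\<alpha> + axis 1 1 = mindex (Suc (\<alpha> $ 1)) (\<alpha> $ 2)" "\<alpha> + axis 2 1 = mindex (\<alpha> $ 1) (Suc (\<alpha> $ 2))"
  by (simp_all add: vec_eq_iff forall_2 axis_def)

lemma norm_pair: "norm (pair x - pair y) = norm (x - y)"
  by (simp add: pair_def norm_prod_def norm_vec_def L2_set_def UNIV_2)

lemma continuous_pair: "continuous_on S pair" and continuous_vec2: "continuous_on T vec2"
proof -
  show "continuous_on S pair" unfolding pair_def by (intro continuous_intros)
  have c: "continuous_on T (\<lambda>p::real \<times> real. \<chi> i::2. if i = 1 then fst p else snd p)"
  proof (rule continuous_on_vec_lambda)
    fix i :: 2
    show "continuous_on T (\<lambda>p::real \<times> real. if i = 1 then fst p else snd p)"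
      by (cases "i = 1") (auto intro!: continuous_intros)
  qed
  have eq: "vec2 = (\<lambda>p::real \<times> real. \<chi> i::2. if i = 1 then fst p else snd p)"
    by (auto simp: vec2_def vec_eq_iff forall_2 fun_eq_iff)
  show "continuous_on T vec2" unfolding eq by (rule c)
qed

definition pairjet :: "jet \<Rightarrow> planar_jet" where "pairjet f = (\<lambda>a b p. f (mindex a b) (vec2 p))"

lemma taylor_tpoly: "taylor n f x y = tpoly (Suc n) (pairjet f) (pair x) 0 0 (pair y)"
proof -
  have "taylor n f x y = (\<Sum>(i, j)\<in>(SIGMA i:{..<Suc n}. {..<Suc n - i}). 
     pairjet f i j (pair x) * jprod (dpow i (x $ 1)) (dpow j (x $ 2)) 0 0 (pair y))"
    unfolding taylor_def
  proof (rule sum.reindex_bij_witness[of _ "\<lambda>(i, j). mindex i j" "\<lambda>\<alpha>. (\<alpha> $ 1, \<alpha> $ 2)"], goal_cases)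
    case (5 \<alpha>)
    have "pairjet f (\<alpha> $ 1) (\<alpha> $ 2) (pair x) = f \<alpha> x" by (simp add: pairjet_def)
    moreover have "mi_fact \<alpha> = fact (\<alpha> $ 1) * fact (\<alpha> $ 2)"
      "mi_power (y - x) \<alpha> = (y $ 1 - x $ 1) ^ (\<alpha> $ 1) * (y $ 2 - x $ 2) ^ (\<alpha> $ 2)"
      by (simp_all add: mi_fact_def mi_power_def UNIV_2 mult.commute)
    ultimately show ?case
      by (simp add: jprod_def dpow_def) (simp add: pair_def mult.commute)
  qed (auto simp: mi_abs_2)
  also have "\<dots> = tpoly (Suc n) (pairjet f) (pair x) 0 0 (pair y)"
    unfolding tpoly_def by (subst sum.Sigma) (auto simp: pair_def)
  finally show ?thesis .
qed

lemma partial_deriv_smooth_jet: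
  assumes A: "smooth_jet A"
  shows "partial_deriv 1 (\<lambda>y. A a b (pair y)) = (\<lambda>y. A (Suc a) b (pair y))"
    and "partial_deriv 2 (\<lambda>y. A a b (pair y)) = (\<lambda>y. A a (Suc b) (pair y))"
proof -
  show "partial_deriv 1 (\<lambda>y. A a b (pair y)) = (\<lambda>y. A (Suc a) b (pair y))"
  proof
    fix x :: "real ^ 2"
    have "((\<lambda>t. x $ 1 + t) has_vector_derivative 1) (at 0)" by (auto intro!: derivative_eq_intros)
    from vector_diff_chain_at[OF this] smooth_jet_partial1[OF A, of a b "x $ 2" "x $ 1 + 0" UNIV]
    have "((\<lambda>t. A a b (x $ 1 + t, x $ 2)) has_vector_derivative A (Suc a) b (x $ 1, x $ 2)) (at 0)"
      by (fastforce simp: o_def)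
    then show "partial_deriv 1 (\<lambda>y. A a b (pair y)) x = A (Suc a) b (pair x)"
      by (simp add: partial_deriv_def pair_def axis_def vector_derivative_at)
  qed
  show "partial_deriv 2 (\<lambda>y. A a b (pair y)) = (\<lambda>y. A a (Suc b) (pair y))"
  proof
    fix x :: "real ^ 2"
    have "((\<lambda>t. x $ 2 + t) has_vector_derivative 1) (at 0)" by (auto intro!: derivative_eq_intros)
    from vector_diff_chain_at[OF this] smooth_jet_partial2[OF A, of a b "x $ 1" "x $ 2 + 0" UNIV]
    have "((\<lambda>t. A a b (x $ 1, x $ 2 + t)) has_vector_derivative A a (Suc b) (x $ 1, x $ 2)) (at 0)"
      by (fastforce simp: o_def)
    then show "partial_deriv 2 (\<lambda>y. A a b (pair y)) x = A a (Suc b) (pair x)"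
      by (simp add: partial_deriv_def pair_def axis_def vector_derivative_at)
  qed
qed

lemma mi_deriv_smooth_jet:
  assumes A: "smooth_jet A" shows "mi_deriv \<alpha> (\<lambda>y. A 0 0 (pair y)) = (\<lambda>y. A (\<alpha> $ 1) (\<alpha> $ 2) (pair y))"
proof -
  have "(partial_deriv 2 ^^ b) (\<lambda>y. A 0 0 (pair y)) = (\<lambda>y. A 0 b (pair y))" for b
    by (induction b) (simp_all add: partial_deriv_smooth_jet[OF A])
  moreover have "(partial_deriv 1 ^^ a) (\<lambda>y. A 0 b (pair y)) = (\<lambda>y. A a b (pair y))" for a b
    by (induction a) (simp_all add: partial_deriv_smooth_jet[OF A])
  ultimately show ?thesis by (simp add: mi_deriv_def)
qed

lemma mi_deriv_taylor:
  "mi_deriv \<alpha> (taylor n f x) y = tpoly (Suc n) (pairjet f) (pair x) (\<alpha> $ 1) (\<alpha> $ 2) (pair y)"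
proof -
  have "taylor n f x = (\<lambda>y. tpoly (Suc n) (pairjet f) (pair x) 0 0 (pair y))" by (simp add: taylor_tpoly fun_eq_iff)
  then show ?thesis using mi_deriv_smooth_jet[OF smooth_jet_tpoly] by simp
qed

definition whitney_rem :: "nat \<Rightarrow> jet \<Rightarrow> multiindex \<Rightarrow> real ^ 2 \<Rightarrow> real ^ 2 \<Rightarrow> complex" where
  "whitney_rem n f \<alpha> x y = f \<alpha> y - mi_deriv \<alpha> (taylor n f x) y"

lemma whitney_rem_pair:
  "whitney_rem n f \<alpha> x y = pairjet f (\<alpha> $ 1) (\<alpha> $ 2) (pair y) - tpoly (Suc n) (pairjet f) (pair x) (\<alpha> $ 1) (\<alpha> $ 2) (pair y)"
  by (simp add: whitney_rem_def mi_deriv_taylor) (simp add: pairjet_def)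

lemma pairjet_diff: "pairjet (\<lambda>\<alpha> x. f \<alpha> x - g \<alpha> x) = jsub (pairjet f) (pairjet g)"
  by (simp add: pairjet_def jsub_def)

lemma whitney_rem_diff:
  "whitney_rem n (\<lambda>\<alpha> x. f \<alpha> x - g \<alpha> x) \<alpha> x y = whitney_rem n f \<alpha> x y - whitney_rem n g \<alpha> x y"
  by (simp add: whitney_rem_pair pairjet_diff tpoly_jsub) (simp add: jsub_def)

lemma whitney_rem_cong:
  assumes "\<And>\<alpha>. f \<alpha> x = g \<alpha> x" "\<And>\<alpha>. f \<alpha> y = g \<alpha> y"
  shows "whitney_rem n f \<alpha> x y = whitney_rem n g \<alpha> x y"
proof -
  have "taylor n f x = taylor n g x" by (simp add: taylor_def assms fun_eq_iff)
  then show ?thesis by (simp add: whitney_rem_def assms)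
qed

section \<open>Comparison and triangle inequality for the Whitney seminorms\<close>

lemma whitney_q_le:
  assumes "\<And>\<alpha> x y. mi_abs \<alpha> \<le> n \<Longrightarrow> x \<in> K \<Longrightarrow> y \<in> K \<Longrightarrow> x \<noteq> y \<Longrightarrow> norm (x - y) < t \<Longrightarrow>
     ennreal (cmod (whitney_rem n f \<alpha> x y) / norm (x - y) ^ (n - mi_abs \<alpha>)) \<le> B"
  shows "whitney_q K n t f \<le> B"
  unfolding whitney_q_def using assms unfolding whitney_rem_def by (intro Sup_least) auto

lemma whitney_q_ge:
  assumes "mi_abs \<alpha> \<le> n" "x \<in> K" "y \<in> K" "x \<noteq> y" "norm (x - y) < t"
  shows "ennreal (cmod (whitney_rem n f \<alpha> x y) / norm (x - y) ^ (n - mi_abs \<alpha>)) \<le> whitney_q K n t f"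
  unfolding whitney_q_def using assms unfolding whitney_rem_def by (intro Sup_upper) auto

lemma whitney_q_cong:
  assumes "\<And>\<alpha> x. x \<in> K \<Longrightarrow> f \<alpha> x = g \<alpha> x"
  shows "whitney_q K n t f = whitney_q K n t g"
proof -
  have *: "whitney_q K n t f \<le> whitney_q K n t g" if "\<And>\<alpha> x. x \<in> K \<Longrightarrow> f \<alpha> x = g \<alpha> x" for f g
  proof (rule whitney_q_le)
    fix \<alpha> x y assume a: "mi_abs \<alpha> \<le> n" "x \<in> K" "y \<in> K" "x \<noteq> y" "norm (x - y) < t"
    have "whitney_rem n f \<alpha> x y = whitney_rem n g \<alpha> x y" by (rule whitney_rem_cong) (use that a in auto)
    then show "ennreal (cmod (whitney_rem n f \<alpha> x y) / norm (x - y) ^ (n - mi_abs \<alpha>)) \<le> whitney_q K n t g"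
      using whitney_q_ge[OF a, of g] by simp
  qed
  show ?thesis by (intro antisym *) (use assms in auto)
qed

lemma whitney_norm_cong:
  assumes "\<And>\<alpha> x. x \<in> K \<Longrightarrow> f \<alpha> x = g \<alpha> x"
  shows "whitney_norm n K f = whitney_norm n K g"
proof -
  have "{ennreal (cmod (f \<alpha> x)) | \<alpha> x. x \<in> K \<and> mi_abs \<alpha> \<le> n} = {ennreal (cmod (g \<alpha> x)) | \<alpha> x. x \<in> K \<and> mi_abs \<alpha> \<le> n}"
    using assms by (intro Collect_cong) (metis (no_types, lifting))
  then show ?thesis by (simp add: whitney_norm_def whitney_q_cong[OF assms])
qed

lemma whitney_norm_mono:
  assumes "K \<subseteq> K'" shows "whitney_norm n K f \<le> whitney_norm n K' f"
proof -
  have q: "whitney_q K n t f \<le> whitney_q K' n t f" for t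
    by (intro whitney_q_le whitney_q_ge) (use assms in auto)
  show ?thesis
    unfolding whitney_norm_def by (intro add_mono Sup_subset_mono SUP_mono' q) (use assms in blast)
qed

lemma whitney_norm_le:
  assumes "\<And>\<alpha> x. x \<in> K \<Longrightarrow> mi_abs \<alpha> \<le> n \<Longrightarrow> ennreal (cmod (f \<alpha> x)) \<le> B"
    and "\<And>\<alpha> x y. mi_abs \<alpha> \<le> n \<Longrightarrow> x \<in> K \<Longrightarrow> y \<in> K \<Longrightarrow> x \<noteq> y \<Longrightarrow> 
     ennreal (cmod (whitney_rem n f \<alpha> x y) / norm (x - y) ^ (n - mi_abs \<alpha>)) \<le> C"
  shows "whitney_norm n K f \<le> B + C"
  unfolding whitney_norm_def using assms
  by (intro add_mono Sup_least SUP_least whitney_q_le) auto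

lemma whitney_norm_ge1:
  "x \<in> K \<Longrightarrow> mi_abs \<alpha> \<le> n \<Longrightarrow> ennreal (cmod (f \<alpha> x)) \<le> Sup {ennreal (cmod (f \<alpha> x)) | \<alpha> x. x \<in> K \<and> mi_abs \<alpha> \<le> n}"
  by (intro Sup_upper) auto

lemma whitney_norm_triangle:
  "whitney_norm n K (\<lambda>\<alpha> x. f \<alpha> x - h \<alpha> x) \<le> whitney_norm n K (\<lambda>\<alpha> x. f \<alpha> x - g \<alpha> x) + whitney_norm n K (\<lambda>\<alpha> x. g \<alpha> x - h \<alpha> x)"
proof -
  define S where "S f = Sup {ennreal (cmod (f \<alpha> x)) | \<alpha> x. x \<in> K \<and> mi_abs \<alpha> \<le> n}" for f :: jet
  define q where "q f = (SUP t\<in>{0<..}. whitney_q K n t f)" for f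
  define u v where "u = (\<lambda>\<alpha> x. f \<alpha> x - g \<alpha> x)" and "v = (\<lambda>\<alpha> x. g \<alpha> x - h \<alpha> x)"
  define w where "w = (\<lambda>\<alpha> x. f \<alpha> x - h \<alpha> x)"
  have S: "ennreal (cmod (f \<alpha> x)) \<le> S f" if "x \<in> K" "mi_abs \<alpha> \<le> n" for f \<alpha> x
    unfolding S_def by (rule whitney_norm_ge1[OF that])
  have q: "ennreal (cmod (whitney_rem n f \<alpha> x y) / norm (x - y) ^ (n - mi_abs \<alpha>)) \<le> q f"
    if "mi_abs \<alpha> \<le> n" "x \<in> K" "y \<in> K" "x \<noteq> y" for f \<alpha> x y
  proof -
    \<comment> \<open>The supremum over \<open>t\<close> removes the bound on the distance:
      \<open>t = norm (x - y) + 1\<close> admits this pair.\<close>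
    have "ennreal (cmod (whitney_rem n f \<alpha> x y) / norm (x - y) ^ (n - mi_abs \<alpha>)) \<le> whitney_q K n (norm (x - y) + 1) f"
      by (rule whitney_q_ge[OF that]) simp
    also have "\<dots> \<le> q f"
      unfolding q_def by (rule SUP_upper) (simp add: add_nonneg_pos)
    finally show ?thesis .
  qed
  have "whitney_norm n K w \<le> (S u + S v) + (q u + q v)"
  proof (rule whitney_norm_le)
    fix \<alpha> x assume a: "x \<in> K" "mi_abs \<alpha> \<le> n"
    have "cmod (w \<alpha> x) \<le> cmod (u \<alpha> x) + cmod (v \<alpha> x)"
      using norm_triangle_ineq[of "u \<alpha> x" "v \<alpha> x"] by (simp add: u_def v_def w_def)
    then have "ennreal (cmod (w \<alpha> x)) \<le> ennreal (cmod (u \<alpha> x)) + ennreal (cmod (v \<alpha> x))"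
      by (simp flip: ennreal_plus)
    also have "\<dots> \<le> S u + S v" by (intro add_mono S a)
    finally show "ennreal (cmod (w \<alpha> x)) \<le> S u + S v" .
  next
    fix \<alpha> x y assume a: "mi_abs \<alpha> \<le> n" "x \<in> K" "y \<in> K" "x \<noteq> y"
    define d where "d = norm (x - y) ^ (n - mi_abs \<alpha>)"
    have d: "d > 0" using a by (simp add: d_def)
    have "whitney_rem n w \<alpha> x y = whitney_rem n u \<alpha> x y + whitney_rem n v \<alpha> x y"
      by (simp add: u_def v_def w_def whitney_rem_diff)
    then have "cmod (whitney_rem n w \<alpha> x y) / d \<le> (cmod (whitney_rem n u \<alpha> x y) + cmod (whitney_rem n v \<alpha> x y)) / d"
      using d by (intro divide_right_mono) (auto simp: norm_triangle_ineq)
    then have "ennreal (cmod (whitney_rem n w \<alpha> x y) / d) \<le> ennreal (cmod (whitney_rem n u \<alpha> x y) / d) + ennreal (cmod (whitney_rem n v \<alpha> x y) / d)"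
      using d by (simp add: add_divide_distrib flip: ennreal_plus)
    also have "\<dots> \<le> q u + q v" unfolding d_def by (intro add_mono q a)
    finally show "ennreal (cmod (whitney_rem n w \<alpha> x y) / norm (x - y) ^ (n - mi_abs \<alpha>)) \<le> q u + q v" by (simp add: d_def)
  qed
  also have "\<dots> = whitney_norm n K u + whitney_norm n K v"
    by (simp add: whitney_norm_def S_def q_def ac_simps)
  finally show ?thesis by (simp add: u_def v_def w_def)
qed

text \<open>Convergence to 0 gives \<open>whitney_q < 1\<close> at some scale, hence an estimate
  with constant 1. Smallness is regained later by taking \<open>m\<close> larger than the order of
  interest.\<close>

lemma whitney_jet_pair:
  assumes "is_whitney_jet_on K f"
  shows "\<exists>\<rho>>0. \<forall>x\<in>pair ` K. \<forall>z\<in>pair ` K. \<forall>a b. norm (x - z) \<le> \<rho> \<longrightarrow> a + b < m \<longrightarrow>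
       cmod (pairjet f a b x - tpoly m (pairjet f) z a b x) \<le> norm (x - z) ^ (m - 1 - (a + b))"
proof (cases m)
  case (Suc n)
  have "((\<lambda>t. whitney_q K n t f) \<longlongrightarrow> 0) (at_right 0)"
    using assms by (simp add: is_whitney_jet_on_def)
  then have "eventually (\<lambda>t. whitney_q K n t f < 1) (at_right 0)"
    by (rule order_tendstoD) simp
  then obtain c where c: "c > 0" "\<And>t. 0 < t \<Longrightarrow> t < c \<Longrightarrow> whitney_q K n t f < 1"
    by (auto simp: eventually_at_right_field)
  have "cmod (pairjet f a b (pair x) - tpoly m (pairjet f) (pair z) a b (pair x)) \<le> norm (x - z) ^ (m - 1 - (a + b))"
    if "x \<in> K" "z \<in> K" "norm (x - z) \<le> c / 4" "a + b < m" for x z a b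
  proof (cases "x = z")
    case True
    then show ?thesis using that by (simp add: tpoly_base)
  next
    case False
    define d where "d = norm (z - x) ^ (n - (a + b))"
    have d: "d > 0" using False by (simp add: d_def)
    have "ennreal (cmod (whitney_rem n f (mindex a b) z x) / d) \<le> whitney_q K n (c / 2) f"
      unfolding d_def using whitney_q_ge[of "mindex a b" n z K x "c / 2" f] that False c Suc
      by (simp add: mi_abs_2 norm_minus_commute)
    also have "\<dots> < 1" using c by simp
    finally have "cmod (whitney_rem n f (mindex a b) z x) / d < 1" by simp
    then have "cmod (whitney_rem n f (mindex a b) z x) \<le> d" using d by simp
    then show ?thesis by (simp add: whitney_rem_pair d_def Suc norm_minus_commute)
  qed
  then show ?thesis using c by (intro exI[of _ "c / 4"]) (auto simp: norm_pair)
qed (auto intro: exI[of _ 1])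

section \<open>Smooth functions as Whitney jets and elements of the kernel\<close>

definition planejet :: "planar_jet \<Rightarrow> jet" where "planejet A = (\<lambda>\<alpha> x. A (\<alpha> $ 1) (\<alpha> $ 2) (pair x))"

lemma pairjet_planejet: "pairjet (planejet A) = A"
  by (simp add: pairjet_def planejet_def)

lemma smooth_jet_bounded:
  assumes "smooth_jet A" "compact S"
  obtains M where "M \<ge> 0" "\<And>i j p. i + j = n \<Longrightarrow> p \<in> S \<Longrightarrow> cmod (A i j p) \<le> M"
proof -
  have "\<exists>M\<ge>0. \<forall>p\<in>S. cmod (A i j p) \<le> M" for i j
  proof -
    have "bounded (A i j ` S)"
      by (intro compact_imp_bounded compact_continuous_image smooth_jet_continuous assms)
    then show ?thesis unfolding bounded_pos by (metis imageI less_imp_le)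
  qed
  then obtain M where M: "\<And>i j. M i j \<ge> 0" "\<And>i j p. p \<in> S \<Longrightarrow> cmod (A i j p) \<le> M i j" by metis
  show thesis
  proof (rule that[of "\<Sum>i\<le>n. M i (n - i)"])
    fix i j p assume ij: "i + j = n" and p: "p \<in> S"
    have "cmod (A i j p) \<le> M i (n - i)" using M(2)[OF p, of i j] ij by auto
    also have "\<dots> \<le> (\<Sum>i\<le>n. M i (n - i))"
      using ij M(1) by (intro member_le_sum) auto
    finally show "cmod (A i j p) \<le> (\<Sum>i\<le>n. M i (n - i))" .
  qed (simp add: sum_nonneg M)
qed

text \<open>Taylor's formula gives one power of the distance more than the quotient divides by, so
  \<open>whitney_q\<close> is at most linear in \<open>t\<close>. The derivatives are bounded on a
  ball containing \<open>K\<close> because segments between points of \<open>K\<close> may leave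
  \<open>K\<close>.\<close>

lemma is_whitney_jet_planejet:
  assumes A: "smooth_jet A" and "compact K"
  shows "is_whitney_jet_on K (planejet A)"
  unfolding is_whitney_jet_on_def
proof (intro conjI allI)
  show "continuous_on K (planejet A \<alpha>)" for \<alpha>
    unfolding planejet_def by (rule continuous_on_jet_comp[OF A continuous_pair])
  fix n
  have "compact (pair ` K)" using assms(2) continuous_pair by (rule compact_continuous_image[rotated])
  then obtain R where "\<forall>p\<in>pair ` K. norm p \<le> R"
    using compact_imp_bounded bounded_iff by metis
  then have R: "pair ` K \<subseteq> cball 0 R" by (simp add: subset_eq del: ball_simps)
  obtain M where M: "M \<ge> 0" "\<And>i j p. i + j = Suc n \<Longrightarrow> p \<in> cball 0 R \<Longrightarrow> cmod (A i j p) \<le> M"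
    using smooth_jet_bounded[OF A compact_cball] by metis
  define c where "c = M * 2 ^ Suc n"
  have le: "whitney_q K n t (planejet A) \<le> ennreal (c * t)" if t: "t > 0" for t
  proof (rule whitney_q_le)
    fix \<alpha> x y assume a: "mi_abs \<alpha> \<le> n" "x \<in> K" "y \<in> K" "x \<noteq> y" "norm (x - y) < t"
    define l where "l = n - mi_abs \<alpha>"
    have l: "Suc n - (\<alpha> $ 1 + \<alpha> $ 2) = Suc l" "Suc l \<le> Suc n" using a by (auto simp: l_def mi_abs_2 Suc_diff_le)
    have "cmod (whitney_rem n (planejet A) \<alpha> x y) \<le> M * (2 * norm (pair y - pair x)) ^ (Suc n - (\<alpha> $ 1 + \<alpha> $ 2))"
      unfolding whitney_rem_pair pairjet_planejet
    proof (rule taylor_remainder[OF A])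
      fix i j p assume "i + j = Suc n" and p: "p \<in> closed_segment (pair x) (pair y)"
      moreover have "closed_segment (pair x) (pair y) \<subseteq> cball 0 R"
        using R a by (intro closed_segment_subset) auto
      ultimately show "cmod (A i j p) \<le> M" using M(2) by blast
    qed (use a in \<open>simp add: mi_abs_2\<close>)
    also have "\<dots> = M * (2 ^ Suc l * norm (x - y) ^ Suc l)"
      by (simp only: l norm_pair norm_minus_commute[of y x] power_mult_distrib)
    also have "\<dots> \<le> M * (2 ^ Suc n * norm (x - y) ^ Suc l)"
      using M l by (intro mult_left_mono mult_right_mono power_increasing) auto
    also have "\<dots> = c * norm (x - y) * norm (x - y) ^ l" by (simp add: c_def)
    finally have "cmod (whitney_rem n (planejet A) \<alpha> x y) / norm (x - y) ^ l \<le> c * norm (x - y)"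
      using a by (simp add: divide_le_eq)
    also have "\<dots> \<le> c * t" using a M by (intro mult_left_mono) (auto simp: c_def)
    finally show "ennreal (cmod (whitney_rem n (planejet A) \<alpha> x y) / norm (x - y) ^ (n - mi_abs \<alpha>)) \<le> ennreal (c * t)"
      unfolding l_def by (rule ennreal_leI)
  qed
  have "((\<lambda>t. ennreal (c * t)) \<longlongrightarrow> ennreal (c * 0)) (at_right 0)"
    by (intro tendsto_ennrealI tendsto_intros)
  then have lim: "((\<lambda>t. ennreal (c * t)) \<longlongrightarrow> 0) (at_right 0)" by simp
  show "((\<lambda>t. whitney_q K n t (planejet A)) \<longlongrightarrow> 0) (at_right 0)"
    by (rule tendsto_sandwich[OF _ _ tendsto_const lim])
       (auto simp: eventually_at_right_field intro!: exI[of _ 1] le)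
qed

lemma is_whitney_jet_cong:
  assumes "\<And>\<alpha> x. x \<in> K \<Longrightarrow> f \<alpha> x = g \<alpha> x"
  shows "is_whitney_jet_on K f \<longleftrightarrow> is_whitney_jet_on K g"
proof -
  have "continuous_on K (f \<alpha>) \<longleftrightarrow> continuous_on K (g \<alpha>)" for \<alpha>
    by (rule continuous_on_cong) (auto simp: assms)
  moreover have "whitney_q K n t f = whitney_q K n t g" for n t
    by (rule whitney_q_cong) (rule assms)
  ultimately show ?thesis by (simp add: is_whitney_jet_on_def)
qed

lemma is_whitney_jet_restrict:
  "K \<subseteq> F \<Longrightarrow> is_whitney_jet_on K (jet_restrict F f) \<longleftrightarrow> is_whitney_jet_on K f"
  by (rule is_whitney_jet_cong) (auto simp: jet_restrict_def)

lemma kernel_space_wave: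
  "f \<in> kernel_space wave_symbol F \<longleftrightarrow> f \<in> whitney_space F \<and>
     (\<forall>\<alpha> x. f (\<alpha> + axis 1 1 + axis 1 1) x = f (\<alpha> + axis 2 1 + axis 2 1) x)"
  by (simp add: kernel_space_def poly_D_wave_symbol jet_partial_def fun_eq_iff)

lemma add_axis_axis:
  "\<alpha> + axis 1 1 + axis 1 1 = mindex (Suc (Suc (\<alpha> $ 1))) (\<alpha> $ 2)" "\<alpha> + axis 2 1 + axis 2 1 = mindex (\<alpha> $ 1) (Suc (Suc (\<alpha> $ 2)))"
  by (simp_all add: vec_eq_iff forall_2 axis_def)

lemma planejet_kernel:
  assumes A: "smooth_jet A" "\<And>y a b. y \<in> pair ` F \<Longrightarrow> A (Suc (Suc a)) b y = A a (Suc (Suc b)) y"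
  shows "jet_restrict F (planejet A) \<in> kernel_space wave_symbol F"
proof -
  have "continuous_on F (planejet A \<alpha>)" for \<alpha>
    unfolding planejet_def by (rule continuous_on_jet_comp[OF A(1) continuous_pair])
  then have "continuous_on F (jet_restrict F (planejet A) \<alpha>)" for \<alpha>
    by (rule continuous_on_eq) (simp add: jet_restrict_def)
  moreover have "is_whitney_jet_on K (jet_restrict F (planejet A))" if "compact K" "K \<subseteq> F" for K
    using is_whitney_jet_planejet[OF A(1) that(1)] is_whitney_jet_restrict[OF that(2)] by blast
  moreover have "jet_restrict F (planejet A) (\<alpha> + axis 1 1 + axis 1 1) x = jet_restrict F (planejet A) (\<alpha> + axis 2 1 + axis 2 1) x" for \<alpha> x
    unfolding add_axis_axis using A(2)[of "pair x"] by (simp add: jet_restrict_def planejet_def)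
  ultimately show ?thesis
    unfolding kernel_space_wave whitney_space_def by (simp add: jet_restrict_def)
qed

lemma kernel_space_restrict:
  assumes "F1 \<subseteq> F2" "f \<in> kernel_space wave_symbol F2"
  shows "jet_restrict F1 f \<in> kernel_space wave_symbol F1"
proof -
  have f: "\<And>\<alpha>. continuous_on F2 (f \<alpha>)" "\<And>K. compact K \<Longrightarrow> K \<subseteq> F2 \<Longrightarrow> is_whitney_jet_on K f"
    using assms(2) by (auto simp: kernel_space_wave whitney_space_def)
  have "continuous_on F1 (f \<alpha>)" for \<alpha> using f(1) assms(1) continuous_on_subset by blast
  then have "continuous_on F1 (jet_restrict F1 f \<alpha>)" for \<alpha>
    by (rule continuous_on_eq) (simp add: jet_restrict_def)
  moreover have "is_whitney_jet_on K (jet_restrict F1 f)" if "compact K" "K \<subseteq> F1" for K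
    using f(2)[OF that(1)] is_whitney_jet_restrict[OF that(2)] that assms(1) by blast
  ultimately show ?thesis
    using assms(2) by (auto simp: kernel_space_wave whitney_space_def jet_restrict_def)
qed

text \<open>Seminorms of different orders are not compared with each other, so a neighbourhood
  controls all orders up to \<open>N\<close>. Intersections are then handled by the maximum of the
  orders, the union of the compact sets and the smaller radius.\<close>

lemma whitney_topology_ball:
  assumes "openin (whitney_topology F) U" "f \<in> U"
  shows "\<exists>N K \<epsilon>. compact K \<and> K \<subseteq> F \<and> \<epsilon> > 0 \<and> (\<forall>h\<in>whitney_space F. 
     (\<forall>n\<le>N. whitney_norm n K (\<lambda>\<alpha> x. h \<alpha> x - f \<alpha> x) < ennreal \<epsilon>) \<longrightarrow> h \<in> U)"
proof -
  have "generate_topology_on {whitney_ball F n K g \<epsilon> | n K g \<epsilon>.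
          compact K \<and> K \<subseteq> F \<and> g \<in> whitney_space F \<and> \<epsilon> > 0} U"
    using assms(1) unfolding whitney_topology_def by (rule openin_topology_generated_by)
  then show ?thesis using assms(2)
  proof (induction rule: generate_topology_on.induct)
    case Empty
    then show ?case by simp
  next
    case (UN \<K>)
    then obtain V where V: "V \<in> \<K>" "f \<in> V" by blast
    then show ?case using UN.IH[OF V] by (meson UnionI)
  next
    case (Int a b)
    obtain N K \<epsilon> where 1: "compact K" "K \<subseteq> F" "\<epsilon> > 0" "\<And>h. h \<in> whitney_space F \<Longrightarrow> 
     (\<And>n. n \<le> N \<Longrightarrow> whitney_norm n K (\<lambda>\<alpha> x. h \<alpha> x - f \<alpha> x) < ennreal \<epsilon>) \<Longrightarrow> h \<in> a"
      using Int.IH(1) Int.prems by blast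
    obtain N' K' \<epsilon>' where 2: "compact K'" "K' \<subseteq> F" "\<epsilon>' > 0" "\<And>h. h \<in> whitney_space F \<Longrightarrow> 
     (\<And>n. n \<le> N' \<Longrightarrow> whitney_norm n K' (\<lambda>\<alpha> x. h \<alpha> x - f \<alpha> x) < ennreal \<epsilon>') \<Longrightarrow> h \<in> b"
      using Int.IH(2) Int.prems by blast
    show ?case
    proof (intro exI[of _ "max N N'"] exI[of _ "K \<union> K'"] exI[of _ "min \<epsilon> \<epsilon>'"] conjI ballI impI)
      fix h assume h: "h \<in> whitney_space F" and
        n: "\<forall>n\<le>max N N'. whitney_norm n (K \<union> K') (\<lambda>\<alpha> x. h \<alpha> x - f \<alpha> x) < ennreal (min \<epsilon> \<epsilon>')"
      have le: "ennreal (min \<epsilon> \<epsilon>') \<le> ennreal \<epsilon>" "ennreal (min \<epsilon> \<epsilon>') \<le> ennreal \<epsilon>'" by (auto intro: ennreal_leI)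
      have "h \<in> a"
      proof (rule 1(4)[OF h])
        fix i assume "i \<le> N"
        then have "whitney_norm i (K \<union> K') (\<lambda>\<alpha> x. h \<alpha> x - f \<alpha> x) < ennreal (min \<epsilon> \<epsilon>')" using n by simp
        then show "whitney_norm i K (\<lambda>\<alpha> x. h \<alpha> x - f \<alpha> x) < ennreal \<epsilon>"
          using whitney_norm_mono[of K "K \<union> K'" i] le(1) by (meson Un_upper1 le_less_trans less_le_trans)
      qed
      moreover have "h \<in> b"
      proof (rule 2(4)[OF h])
        fix i assume "i \<le> N'"
        then have "whitney_norm i (K \<union> K') (\<lambda>\<alpha> x. h \<alpha> x - f \<alpha> x) < ennreal (min \<epsilon> \<epsilon>')" using n by simp
        then show "whitney_norm i K' (\<lambda>\<alpha> x. h \<alpha> x - f \<alpha> x) < ennreal \<epsilon>'"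
          using whitney_norm_mono[of K' "K \<union> K'" i] le(2) by (meson Un_upper2 le_less_trans less_le_trans)
      qed
      ultimately show "h \<in> a \<inter> b" by simp
    qed (use 1 2 in auto)
  next
    case (Basis s)
    then obtain n K g \<epsilon> where s: "s = whitney_ball F n K g \<epsilon>" "compact K" "K \<subseteq> F" "\<epsilon> > 0" by blast
    have f: "whitney_norm n K (\<lambda>\<alpha> x. f \<alpha> x - g \<alpha> x) < ennreal \<epsilon>"
      using Basis.prems by (simp add: s whitney_ball_def)
    then obtain r where r: "r \<ge> 0" "whitney_norm n K (\<lambda>\<alpha> x. f \<alpha> x - g \<alpha> x) = ennreal r"
      by (cases "whitney_norm n K (\<lambda>\<alpha> x. f \<alpha> x - g \<alpha> x)") auto
    have "r < \<epsilon>" using f r by (simp add: ennreal_less_iff)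
    show ?case
    proof (intro exI[of _ n] exI[of _ K] exI[of _ "\<epsilon> - r"] conjI ballI impI s)
      fix h assume h: "h \<in> whitney_space F" and n: "\<forall>i\<le>n. whitney_norm i K (\<lambda>\<alpha> x. h \<alpha> x - f \<alpha> x) < ennreal (\<epsilon> - r)"
      have "whitney_norm n K (\<lambda>\<alpha> x. h \<alpha> x - g \<alpha> x) \<le> whitney_norm n K (\<lambda>\<alpha> x. h \<alpha> x - f \<alpha> x) + ennreal r"
        using whitney_norm_triangle[of n K h g f] by (simp add: r)
      also have "\<dots> < ennreal (\<epsilon> - r) + ennreal r"
        using n by (simp add: add.commute[of _ "ennreal r"] ennreal_add_left_cancel_less)
      also have "\<dots> = ennreal \<epsilon>" using r \<open>r < \<epsilon>\<close> by (simp flip: ennreal_plus)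
      finally show "h \<in> s" using h by (simp add: s whitney_ball_def)
    qed (use \<open>r < \<epsilon>\<close> in simp)
  qed
qed

section \<open>Gaps on characteristic lines and the density theorem\<close>

lemma segment_component:
  fixes \<gamma> :: "real \<Rightarrow> real ^ 2" and \<tau> :: "real ^ 2 \<Rightarrow> real"
  assumes ab: "a < b" "\<gamma> a \<in> F" "\<gamma> b \<in> F" "\<And>t. a < t \<Longrightarrow> t < b \<Longrightarrow> \<gamma> t \<notin> F"
    and cont: "continuous_on UNIV \<gamma>" "continuous_on UNIV \<tau>" and inv: "\<And>t. \<tau> (\<gamma> t) = t" and H: "H = range \<gamma>"
  shows "\<gamma> ` {a<..<b} \<in> components ((UNIV - F) \<inter> H)" "bounded (\<gamma> ` {a<..<b})"
proof -
  have "\<gamma> ` {a<..<b} \<subseteq> \<gamma> ` {a..b}" by auto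
  moreover have "compact (\<gamma> ` {a..b})" 
    by (intro compact_continuous_image continuous_on_subset[OF cont(1)]) auto
  ultimately show "bounded (\<gamma> ` {a<..<b})" using compact_imp_bounded bounded_subset by blast
  show "\<gamma> ` {a<..<b} \<in> components ((UNIV - F) \<inter> H)"
    unfolding in_components_maximal
  proof (intro conjI allI impI)
    show "\<gamma> ` {a<..<b} \<noteq> {}" using ab by auto
    show "\<gamma> ` {a<..<b} \<subseteq> (UNIV - F) \<inter> H" using ab(4) by (auto simp: H)
    show "connected (\<gamma> ` {a<..<b})"
      by (intro connected_continuous_image continuous_on_subset[OF cont(1)]) auto
    fix D assume D: "D \<noteq> {} \<and> \<gamma> ` {a<..<b} \<subseteq> D \<and> D \<subseteq> (UNIV - F) \<inter> H \<and> connected D"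
    have DH: "x = \<gamma> (\<tau> x)" if "x \<in> D" for x using D that inv by (auto simp: H)
    have cT: "connected (\<tau> ` D)"
      using D by (intro connected_continuous_image continuous_on_subset[OF cont(2)]) auto
    have no: "a \<notin> \<tau> ` D" "b \<notin> \<tau> ` D" using D DH ab(2,3) by auto
    define c where "c = (a + b) / 2"
    have c: "a < c" "c < b" using ab by (auto simp: c_def)
    then have cD: "c \<in> \<tau> ` D" using D inv by (force intro: image_eqI[of _ _ "\<gamma> c"])
    \<comment> \<open>The parameters of \<open>D\<close> form an interval containing the midpoint
      \<open>c\<close>; leaving \<open>(a, b)\<close> it would contain \<open>a\<close> or
      \<open>b\<close>, the parameter of a point of \<open>F\<close>.\<close>
    have "t \<in> {a<..<b}" if t: "t \<in> \<tau> ` D" for t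
    proof (rule ccontr)
      assume "t \<notin> {a<..<b}"
      then have "t \<le> a \<or> b \<le> t" by auto
      then show False
        using connectedD_interval[OF cT t cD, of a] connectedD_interval[OF cT cD t, of b] no c by auto
    qed
    then have "D \<subseteq> \<gamma> ` {a<..<b}" using DH by blast
    then show "D = \<gamma> ` {a<..<b}" using D by blast
  qed
qed

text \<open>A gap of \<open>F1\<close> on a characteristic line is a bounded component of the
  complement on that line, so by hypothesis it is not contained in \<open>F2\<close>. Lines with
  fixed \<open>s\<close> have normal (1, 1), lines with fixed \<open>t\<close> have normal (1,
  -1).\<close>

lemma characteristic_gap:
  fixes F1 F2 :: "(real ^ 2) set"
  assumes hyp: "\<And>H. characteristic_hyperplane wave_symbol H \<Longrightarrow>
           \<not> (\<exists>C \<in> components ((UNIV - F1) \<inter> H). bounded C \<and> C \<subseteq> F2)"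
    and "a < b"
  shows "vec2 (from_char (s, a)) \<in> F1 \<Longrightarrow> vec2 (from_char (s, b)) \<in> F1 \<Longrightarrow> (\<And>t. a < t \<Longrightarrow> t < b \<Longrightarrow> vec2 (from_char (s, t)) \<notin> F1) \<Longrightarrow>
       \<exists>t. a < t \<and> t < b \<and> vec2 (from_char (s, t)) \<notin> F2"
    and "vec2 (from_char (a, s)) \<in> F1 \<Longrightarrow> vec2 (from_char (b, s)) \<in> F1 \<Longrightarrow> (\<And>t. a < t \<Longrightarrow> t < b \<Longrightarrow> vec2 (from_char (t, s)) \<notin> F1) \<Longrightarrow>
       \<exists>t. a < t \<and> t < b \<and> vec2 (from_char (t, s)) \<notin> F2"
proof -
  have cont: "continuous_on UNIV (\<lambda>t. vec2 (from_char (s, t)))" "continuous_on UNIV (\<lambda>t. vec2 (from_char (t, s)))"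
    unfolding from_char_def by (intro continuous_on_compose2[OF continuous_vec2[of UNIV]] continuous_intros; simp)+
  have cont': "continuous_on UNIV (\<lambda>x. snd (to_char (pair x)))" "continuous_on UNIV (\<lambda>x. fst (to_char (pair x)))"
    unfolding to_char_def by (auto intro!: continuous_intros continuous_pair)
  have nth: "vec2 p $ 1 = fst p" "vec2 p $ 2 = snd p" for p by (simp_all add: vec2_def)
  {
    assume e: "vec2 (from_char (s, a)) \<in> F1" "vec2 (from_char (s, b)) \<in> F1" "\<And>t. a < t \<Longrightarrow> t < b \<Longrightarrow> vec2 (from_char (s, t)) \<notin> F1"
    define H where "H = {x :: real ^ 2. (\<Sum>j\<in>UNIV. x $ j * (vector [1, 1] :: real ^ 2) $ j) = 2 * s}"
    have "characteristic_hyperplane wave_symbol H"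
      unfolding characteristic_hyperplane_def H_def
      by (intro exI[of _ "vector [1, 1]"] exI[of _ "2 * s"]) (auto simp: principal_part_wave_symbol vec_eq_iff forall_2)
    moreover have H: "H = range (\<lambda>t. vec2 (from_char (s, t)))"
    proof (intro equalityI subsetI)
      fix x assume "x \<in> H"
      then have "x = vec2 (from_char (s, x $ 1 - s))"
        by (auto simp: H_def UNIV_2 vec_eq_iff forall_2 nth from_char_def)
      then show "x \<in> range (\<lambda>t. vec2 (from_char (s, t)))" by (rule range_eqI)
    qed (auto simp: H_def UNIV_2 nth from_char_def)
    ultimately have "\<not> (\<lambda>t. vec2 (from_char (s, t))) ` {a<..<b} \<subseteq> F2"
      using hyp segment_component[OF \<open>a < b\<close> e cont(1) cont'(1) _ H] by fastforce
    then show "\<exists>t. a < t \<and> t < b \<and> vec2 (from_char (s, t)) \<notin> F2" by auto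
  }
  {
    assume e: "vec2 (from_char (a, s)) \<in> F1" "vec2 (from_char (b, s)) \<in> F1" "\<And>t. a < t \<Longrightarrow> t < b \<Longrightarrow> vec2 (from_char (t, s)) \<notin> F1"
    define H where "H = {x :: real ^ 2. (\<Sum>j\<in>UNIV. x $ j * (vector [1, - 1] :: real ^ 2) $ j) = 2 * s}"
    have "characteristic_hyperplane wave_symbol H"
      unfolding characteristic_hyperplane_def H_def
      by (intro exI[of _ "vector [1, - 1]"] exI[of _ "2 * s"]) (auto simp: principal_part_wave_symbol vec_eq_iff forall_2)
    moreover have H: "H = range (\<lambda>t. vec2 (from_char (t, s)))"
    proof (intro equalityI subsetI)
      fix x assume "x \<in> H"
      then have "x = vec2 (from_char (x $ 1 - s, s))"
        by (auto simp: H_def UNIV_2 vec_eq_iff forall_2 nth from_char_def)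
      then show "x \<in> range (\<lambda>t. vec2 (from_char (t, s)))" by (rule range_eqI)
    qed (auto simp: H_def UNIV_2 nth from_char_def)
    ultimately have "\<not> (\<lambda>t. vec2 (from_char (t, s))) ` {a<..<b} \<subseteq> F2"
      using hyp segment_component[OF \<open>a < b\<close> e cont(2) cont'(2) _ H] by fastforce
    then show "\<exists>t. a < t \<and> t < b \<and> vec2 (from_char (t, s)) \<notin> F2" by auto
  }
qed

lemma wave_jet_approx:
  fixes F1 F2 :: "(real ^ 2) set"
  assumes "closed F1" "closed F2" 
    and hyp: "\<And>H. characteristic_hyperplane wave_symbol H \<Longrightarrow>
           \<not> (\<exists>C \<in> components ((UNIV - F1) \<inter> H). bounded C \<and> C \<subseteq> F2)"
    and f: "f \<in> kernel_space wave_symbol F1" and K: "compact K" "K \<subseteq> F1" and \<epsilon>: "\<epsilon> > 0"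
  obtains A where "smooth_jet A" "\<And>y a b. y \<in> pair ` F2 \<Longrightarrow> A (Suc (Suc a)) b y = A a (Suc (Suc b)) y"
    "\<And>n. n \<le> N \<Longrightarrow> whitney_norm n K (\<lambda>\<alpha> x. planejet A \<alpha> x - f \<alpha> x) < ennreal \<epsilon>"
proof -
  obtain R0 where R0: "R0 > 0" "\<And>x. x \<in> K \<Longrightarrow> norm x \<le> R0"
    using compact_imp_bounded[OF K(1)] unfolding bounded_pos by blast
  define B where "B = {p :: real \<times> real. \<bar>fst p\<bar> \<le> R0 \<and> \<bar>snd p\<bar> \<le> R0}"
  \<comment> \<open>By convexity of the box, every gap of \<open>L\<close> on a characteristic line is a gap of \<open>F1\<close>.\<close>
  define L where "L = F1 \<inter> (\<lambda>x. to_char (pair x)) -` B"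
  have npr: "norm (pair x) = norm x" for x using norm_pair[of x 0] by (simp add: pair_def zero_prod_def)
  have KL: "K \<subseteq> L"
  proof
    fix x assume x: "x \<in> K"
    have "\<bar>fst (to_char (pair x))\<bar> \<le> norm x" "\<bar>snd (to_char (pair x))\<bar> \<le> norm x"
      using norm_from_char_coords[of "to_char (pair x)"] by (auto simp: npr)
    then show "x \<in> L" using x K(2) R0(2)[OF x] by (auto simp: L_def B_def)
  qed
  have contS: "continuous_on UNIV (\<lambda>x. to_char (pair x))"
    unfolding to_char_def by (auto intro!: continuous_intros continuous_pair)
  have "B = {- R0..R0} \<times> {- R0..R0}" by (auto simp: B_def abs_le_iff)
  then have cB: "compact B" by (simp add: compact_Times)
  have "closed L" unfolding L_def
    by (intro closed_Int \<open>closed F1\<close> closed_vimage compact_imp_closed cB contS)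
  moreover have "L \<subseteq> (\<lambda>p. vec2 (from_char p)) ` B" 
    by (auto simp: L_def intro!: image_eqI[of _ _ "to_char (pair x)" for x])
  moreover have "compact ((\<lambda>p. vec2 (from_char p)) ` B)"
    unfolding from_char_def
    by (intro compact_continuous_image cB continuous_on_compose2[OF continuous_vec2[of UNIV]] continuous_intros) auto
  ultimately have L: "compact L" by (metis inf.absorb_iff2 compact_Int_closed)
  have LF: "L \<subseteq> F1" by (auto simp: L_def)
  have inL: "from_char p \<in> pair ` S \<longleftrightarrow> vec2 (from_char p) \<in> S" for p S
    by (metis imageE imageI pair_vec2 vec2_pair)
  have mem: "vec2 (from_char p) \<in> L \<longleftrightarrow> vec2 (from_char p) \<in> F1 \<and> p \<in> B" for p by (auto simp: L_def)
  have fw: "is_whitney_jet_on L f" using f L LF by (auto simp: kernel_space_wave whitney_space_def)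
  have wave: "pairjet f (Suc (Suc a)) b z = pairjet f a (Suc (Suc b)) z" for a b z
    using f[unfolded kernel_space_wave add_axis_axis, THEN conjunct2, rule_format, of "mindex a b" "vec2 z"] by (simp add: pairjet_def)
  have closF2: "closed (pair ` F2)"
  proof -
    have "pair ` F2 = vec2 -` F2" by (auto intro: image_eqI[of _ pair "vec2 p" for p])
    then show ?thesis using closed_vimage[OF assms(2) continuous_vec2] by simp
  qed
  have cprL: "compact (pair ` L)" by (rule compact_continuous_image[OF continuous_pair L])
  \<comment> \<open>The seminorm adds a supremum of values and one of remainders; a third for each
    leaves the inequality strict.\<close>
  have \<epsilon>3: "\<epsilon> / 3 > 0" using \<epsilon> by simp
  show thesis
  proof (rule wave_approx[of "pair ` L" "pair ` F2" "pairjet f" "\<epsilon> / 3" N, OF cprL closF2 wave whitney_jet_pair[OF fw] _ _ \<epsilon>3])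
    fix s a b :: real
    assume ab: "a < b" "from_char (s, a) \<in> pair ` L" "from_char (s, b) \<in> pair ` L" "\<And>t. a < t \<Longrightarrow> t < b \<Longrightarrow> from_char (s, t) \<notin> pair ` L"
    show "\<exists>t. a < t \<and> t < b \<and> from_char (s, t) \<notin> pair ` F2"
    proof -
      have "(s, t) \<in> B" if "a < t" "t < b" for t
        using ab(2,3) that unfolding inL mem by (auto simp: B_def abs_le_iff)
      then show ?thesis
        unfolding inL by (intro characteristic_gap(1)[OF hyp ab(1)]) (use ab in \<open>auto simp: inL mem\<close>)
    qed
  next
    fix t a b :: real
    assume ab: "a < b" "from_char (a, t) \<in> pair ` L" "from_char (b, t) \<in> pair ` L" "\<And>s. a < s \<Longrightarrow> s < b \<Longrightarrow> from_char (s, t) \<notin> pair ` L"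
    show "\<exists>s. a < s \<and> s < b \<and> from_char (s, t) \<notin> pair ` F2"
    proof -
      have "(s, t) \<in> B" if "a < s" "s < b" for s
        using ab(2,3) that unfolding inL mem by (auto simp: B_def abs_le_iff)
      then show ?thesis
        unfolding inL by (intro characteristic_gap(2)[OF hyp ab(1)]) (use ab in \<open>auto simp: inL mem\<close>)
    qed
  next
    fix A assume A: "smooth_jet A" "\<And>y a b. y \<in> pair ` F2 \<Longrightarrow> A (Suc (Suc a)) b y = A a (Suc (Suc b)) y"
      and est0: "\<And>n x a b. n \<le> N \<Longrightarrow> x \<in> pair ` L \<Longrightarrow> a + b \<le> n \<Longrightarrow> cmod (jsub (pairjet f) A a b x) \<le> \<epsilon> / 3"
      and est1: "\<And>n x y a b. n \<le> N \<Longrightarrow> x \<in> pair ` L \<Longrightarrow> y \<in> pair ` L \<Longrightarrow> a + b \<le> n \<Longrightarrow>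
      cmod (jsub (pairjet f) A a b y - tpoly (Suc n) (jsub (pairjet f) A) x a b y) \<le> \<epsilon> / 3 * norm (y - x) ^ (n - (a + b))"
    show thesis
    proof (rule that[OF A])
      fix n assume n: "n \<le> N"
      define e where "e = (\<lambda>\<alpha> x. planejet A \<alpha> x - f \<alpha> x)"
      have pe: "pairjet e a b p = - jsub (pairjet f) A a b p" for a b p
        by (simp add: e_def pairjet_def planejet_def jsub_def)
      have te: "tpoly m (pairjet e) z a b y = - tpoly m (jsub (pairjet f) A) z a b y" for m z a b y
        by (simp add: tpoly_def pe sum_negf)
      have "whitney_norm n K e \<le> ennreal (\<epsilon> / 3) + ennreal (\<epsilon> / 3)"
      proof (rule whitney_norm_le)
        fix \<alpha> x assume a: "x \<in> K" "mi_abs \<alpha> \<le> n"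
        have "e \<alpha> x = pairjet e (\<alpha> $ 1) (\<alpha> $ 2) (pair x)" by (simp add: pairjet_def)
        then have "cmod (e \<alpha> x) \<le> \<epsilon> / 3"
          using est0[OF n, of "pair x" "\<alpha> $ 1" "\<alpha> $ 2"] a KL by (auto simp: pe mi_abs_2)
        then show "ennreal (cmod (e \<alpha> x)) \<le> ennreal (\<epsilon> / 3)" by (rule ennreal_leI)
      next
        fix \<alpha> x y assume a: "mi_abs \<alpha> \<le> n" "x \<in> K" "y \<in> K" "x \<noteq> y"
        have "cmod (whitney_rem n e \<alpha> x y) = cmod (jsub (pairjet f) A (\<alpha> $ 1) (\<alpha> $ 2) (pair y) - tpoly (Suc n) (jsub (pairjet f) A) (pair x) (\<alpha> $ 1) (\<alpha> $ 2) (pair y))"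
          unfolding whitney_rem_pair pe te by (metis minus_diff_minus norm_minus_cancel)
        also have "\<dots> \<le> \<epsilon> / 3 * norm (x - y) ^ (n - mi_abs \<alpha>)"
          using est1[OF n, of "pair x" "pair y" "\<alpha> $ 1" "\<alpha> $ 2"] a KL by (auto simp: mi_abs_2 norm_pair norm_minus_commute[of y x])
        finally have "cmod (whitney_rem n e \<alpha> x y) / norm (x - y) ^ (n - mi_abs \<alpha>) \<le> \<epsilon> / 3"
          using a by (simp add: divide_le_eq)
        then show "ennreal (cmod (whitney_rem n e \<alpha> x y) / norm (x - y) ^ (n - mi_abs \<alpha>)) \<le> ennreal (\<epsilon> / 3)"
          by (rule ennreal_leI)
      qed
      also have "\<dots> = ennreal (\<epsilon> / 3 + \<epsilon> / 3)" using \<epsilon> by (intro ennreal_plus[symmetric]) auto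
      also have "\<dots> < ennreal \<epsilon>" using \<epsilon> by (intro ennreal_lessI) auto
      finally show "whitney_norm n K (\<lambda>\<alpha> x. planejet A \<alpha> x - f \<alpha> x) < ennreal \<epsilon>" by (simp add: e_def)
    qed
  qed
qed

theorem corollary17:
  fixes F1 F2 :: "(real ^ 2) set"
  assumes "closed F1" and "closed F2"
    and "F1 \<subseteq> F2" and "F1 \<noteq> F2"
    and "\<And>H. characteristic_hyperplane wave_symbol H \<Longrightarrow>
           \<not> (\<exists>C \<in> components ((UNIV - F1) \<inter> H). bounded C \<and> C \<subseteq> F2)"
  shows "runge_pair wave_symbol F1 F2"
proof -
  define S where "S = kernel_space wave_symbol F1"
  define I where "I = jet_restrict F1 ` kernel_space wave_symbol F2"
  have SW: "S \<subseteq> whitney_space F1" by (auto simp: S_def kernel_space_def)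
  have IS: "I \<subseteq> S" using kernel_space_restrict[OF assms(3)] by (auto simp: I_def S_def)
  have "f \<in> topspace (whitney_topology F1)" if "f \<in> whitney_space F1" for f
  proof -
    \<comment> \<open>Over the empty compact set the seminorm is 0, so every jet lies in a subbasic
      ball and the topology lives on the whole space.\<close>
    have "whitney_norm 0 {} (\<lambda>\<alpha> x. f \<alpha> x - f \<alpha> x) \<le> 0 + 0" by (rule whitney_norm_le) auto
    then have "f \<in> whitney_ball F1 0 {} f 1" using that by (simp add: whitney_ball_def)
    moreover have "whitney_ball F1 0 {} f 1 \<in> {whitney_ball F1 n K g \<epsilon> | n K g \<epsilon>.
          compact K \<and> K \<subseteq> F1 \<and> g \<in> whitney_space F1 \<and> \<epsilon> > 0}"
      using that by (intro CollectI exI[of _ 0] exI[of _ "{}"] exI[of _ f] exI[of _ 1]) auto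
    ultimately show ?thesis unfolding whitney_topology_def topology_generated_by_topspace by (rule UnionI[rotated])
  qed
  then have top: "topspace (subtopology (whitney_topology F1) S) = S"
    using SW by (auto simp: topspace_subtopology)
  have "f \<in> subtopology (whitney_topology F1) S closure_of I" if f: "f \<in> S" for f
    unfolding in_closure_of top
  proof (intro conjI allI impI f)
    fix T assume T: "f \<in> T \<and> openin (subtopology (whitney_topology F1) S) T"
    then obtain U where U: "openin (whitney_topology F1) U" "T = U \<inter> S"
      by (auto simp: openin_subtopology)
    obtain N K \<epsilon> where K: "compact K" "K \<subseteq> F1" "\<epsilon> > 0" "\<And>h. h \<in> whitney_space F1 \<Longrightarrow> 
     (\<And>n. n \<le> N \<Longrightarrow> whitney_norm n K (\<lambda>\<alpha> x. h \<alpha> x - f \<alpha> x) < ennreal \<epsilon>) \<Longrightarrow> h \<in> U"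
      using whitney_topology_ball[OF U(1), of f] T U(2) by blast
    obtain A where A: "smooth_jet A" "\<And>y a b. y \<in> pair ` F2 \<Longrightarrow> A (Suc (Suc a)) b y = A a (Suc (Suc b)) y"
      "\<And>n. n \<le> N \<Longrightarrow> whitney_norm n K (\<lambda>\<alpha> x. planejet A \<alpha> x - f \<alpha> x) < ennreal \<epsilon>"
      using wave_jet_approx[OF assms(1,2,5) f[unfolded S_def] K(1-3), of N] by blast
    define h where "h = jet_restrict F1 (jet_restrict F2 (planejet A))"
    have hI: "h \<in> I" unfolding h_def I_def by (intro imageI planejet_kernel A)
    have "h \<in> U"
    proof (rule K(4))
      show "h \<in> whitney_space F1" using hI IS SW by blast
      fix n assume "n \<le> N"
      have "whitney_norm n K (\<lambda>\<alpha> x. h \<alpha> x - f \<alpha> x) = whitney_norm n K (\<lambda>\<alpha> x. planejet A \<alpha> x - f \<alpha> x)"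
        by (rule whitney_norm_cong) (use K(2) assms(3) in \<open>auto simp: h_def jet_restrict_def\<close>)
      then show "whitney_norm n K (\<lambda>\<alpha> x. h \<alpha> x - f \<alpha> x) < ennreal \<epsilon>" using A(3) \<open>n \<le> N\<close> by simp
    qed
    then show "\<exists>y. y \<in> I \<and> y \<in> T" using hI IS U(2) by blast
  qed
  moreover have "subtopology (whitney_topology F1) S closure_of I \<subseteq> S"
    using closure_of_subset_topspace[of "subtopology (whitney_topology F1) S" I] top by simp
  ultimately show ?thesis unfolding runge_pair_def S_def[symmetric] I_def[symmetric] by blast
qed

end
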